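(* Let $m\geq 1$, let $D_{2m}=\langle r,s\mid s^2=e=r^m,\ srs=r^{-1}\rangle$ be the dihedral group with $2m$ elements, $D_2=\langle s\rangle$ and $D_2'=\langle rs\rangle$. Let $\underline{R}$ be a $D_2$-Tambara functor and let $\varphi\colon D_{2m}\to D_{2m}$ be the automorphism determined by $\varphi(rs)=s$ and $\varphi(r)=r$, so that $\varphi(D_2')=D_2$. Then there is an isomorphism of simplicial $D_{2m}$-Tambara functors \[ \mathcal{L}_{P_{2m}}^{D_{2m};D_2}(\underline{R})\;\cong\; B\big(N_{D_2}^{D_{2m}}\underline{R},\,N_e^{D_{2m}}i_e\underline{R},\,N_{D_2'}^{D_{2m}}\varphi^*(\underline{R})\big), \] and the homotopy groups of $\mathcal{L}_{P_{2m}}^{D_{2m};D_2}(\underline{R})$ are isomorphic to the Real $D_{2m}$-Hochschild homology $\underline{HR}_*^{D_{2m}}(\underline{R})$ of $\underline{R}$, viewed as a discrete $E_\sigma$-ring, with values in graded $D_{2m}$-Mackey functors.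
   Context: Norms. For finite groups $H<G$, $i_H^G$ is restriction from $G$- to $H$-Tambara functors and $N_H^G$ its left adjoint (the norm). At the free level $N_H^G\underline{R}(G/e)\cong\bigotimes_{G/H}\underline{R}(H/e)$ with the tensor induction action: for a transversal $g_1,\dots,g_n$ of $H$ in $G$, $g(\bigotimes_{g_iH}r_i)=\bigotimes_{g_{j_i}H}(g_{j_i}^{-1}gg_i)\cdot r_i$, where $g_{j_i}^{-1}gg_i\in H$. An $e$-Tambara functor is a commutative ring, and $i_e\underline{R}=i_e^H\underline{R}$ is the commutative ring $\underline{R}(H/e)$. $\Box$ is the box product. Pullback. If $\varphi\colon K\to K'$ is an isomorphism of groups and $\underline{R}$ a $K'$-Tambara functor, $\varphi^*\underline{R}$ is the $K$-Tambara functor with $(\varphi^*\underline{R})(K/L)=\underline{R}(K'/\varphi(L))$ and with conjugations, restrictions, transfers and norms taken from $\underline{R}$ along $\varphi$ (e.g. $c_k:=c_{\varphi(k)}$). Here it is applied to $\varphi|_{D_2'}\colon D_2'\to D_2$. The simplicial $D_{2m}$-set $P_{2m}$ (a model of the $1$-skeleton of a regular $2m$-gon). Its nondegenerate simplices are two orbits in degree $0$, $D_{2m}\cdot x_0=\{x_0,\dots,x_{m-1}\}\cong D_{2m}/\langle s\rangle$ and $D_{2m}\cdot x_0'=\{x_0',\dots,x_{m-1}'\}\cong D_{2m}/\langle rs\rangle$, and one free orbit in degree $1$, $\{y_g\mid g\in D_{2m}\}$, with $d_0(y_{r^k})=x_k'$, $d_0(y_{r^ks})=x'_{k-1}$, $d_1(y_{r^k})=x_k=d_1(y_{r^ks})$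 (indices modulo $m$). Thus $(P_{2m})_n\cong D_{2m}/D_2\sqcup\bigsqcup_{i=1}^nD_{2m}/e\sqcup D_{2m}/D_2'$. The Loday construction. $\mathcal{L}_{P_{2m}}^{D_{2m};D_2}(\underline{R})$ is the simplicial $D_{2m}$-Tambara functor obtained by assigning $N_{D_2}^{D_{2m}}\underline{R}$ to each orbit $D_{2m}/D_2$, $N_e^{D_{2m}}i_e\underline{R}$ to each orbit $D_{2m}/e$, and $N_{D_2'}^{D_{2m}}\varphi^*\underline{R}$ to each orbit $D_{2m}/D_2'$, and taking the box product over the orbits of $(P_{2m})_n$. Fold maps induce multiplications, inclusions of the empty set induce unit maps, and the standard projections $D_{2m}/e\to D_{2m}/D_2$ and $D_{2m}/e\to D_{2m}/D_2'$ induce the composites $N_e^{D_{2m}}i_e\underline{R}\cong N_{D_2}^{D_{2m}}N_e^{D_2}i_e\underline{R}\to N_{D_2}^{D_{2m}}\underline{R}$ and $N_e^{D_{2m}}i_e\underline{R}\cong N_{D_2'}^{D_{2m}}N_e^{D_2'}i_e\underline{R}\to N_{D_2'}^{D_{2m}}\varphi^*\underline{R}$. The first map in each is the reordering isomorphism. The second is the norm of the counit $N_e^{D_2}i_e\underline{R}\to\underline{R}$, respectively of the map $N_e^{D_2'}i_e\underline{R}\to\varphi^*\underline{R}$ adjoint to the identity of $\underline{R}(D_2/e)$. Here norms of restrictions to the trivial group carry the flip action $\gamma(\bigotimes_gt_g)=\bigotimes_{\gamma g}t_g$ (the group only permutes tensor factors), so e.g. the counit is $\bigotimes_gt_g\mapsto\prod_gg\,t_g$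 at the free level. $B(M,A,N)$ is the two-sided bar construction with $n$-simplices $M\Box A^{\Box n}\Box N$. Here $A=N_e^{D_{2m}}i_e\underline{R}$ acts on the outer terms via the two composites just described. Real $D_{2m}$-Hochschild homology of a discrete $E_\sigma$-ring $\underline{R}$ (every $D_2$-Tambara functor is an example) is the graded $D_{2m}$-Mackey functor \[\underline{HR}_*^{D_{2m}}(\underline{R}):=\pi_*B\big(N_{D_2}^{D_{2m}}\underline{R},N_e^{D_{2m}}i_e^*\underline{R},N_{D_2'}^{D_{2m}}c_\zeta^*(\underline{R})\big),\] where $c_\zeta$ denotes the isomorphism $D_2'\cong D_2$. *)

theory Defs
  imports "HOL-Algebra.Ring" "HOL-Algebra.RingHom" "HOL-Algebra.AbelCoset" "HOL-Algebra.Group_Action"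
    "HOL-Algebra.Generated_Groups" "HOL-Library.Nat_Bijection"
begin

section \<open>Finite G-sets\<close>

text \<open>
  Groups have their elements in \<^typ>\<open>nat\<close>, and so do finite G-sets.  The finite G-sets with points
  in \<^typ>\<open>nat\<close> are a small category equivalent to the category of all finite G-sets, and a
  Tambara functor is a structure indexed by it.
\<close>

record gset =
  pts :: "nat set"
  act :: "nat \<Rightarrow> nat \<Rightarrow> nat"

definition is_gset :: "nat monoid \<Rightarrow> gset \<Rightarrow> bool" where
  "is_gset G X \<longleftrightarrow> finite (pts X)
     \<and> (\<forall>g\<in>carrier G. \<forall>x\<in>pts X. act X g x \<in> pts X)
     \<and> (\<forall>x\<in>pts X. act X \<one>\<^bsub>G\<^esub> x = x)
     \<and> (\<forall>g\<in>carrier G. \<forall>h\<in>carrier G. \<forall>x\<in>pts X. act X (g \<otimes>\<^bsub>G\<^esub> h) x = act X g (act X h x))"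

definition gmap :: "nat monoid \<Rightarrow> gset \<Rightarrow> gset \<Rightarrow> (nat \<Rightarrow> nat) \<Rightarrow> bool" where
  "gmap G X Y f \<longleftrightarrow> is_gset G X \<and> is_gset G Y \<and> f \<in> pts X \<rightarrow> pts Y
     \<and> (\<forall>g\<in>carrier G. \<forall>x\<in>pts X. f (act X g x) = act Y g (f x))"

definition is_coproduct ::
    "nat monoid \<Rightarrow> gset \<Rightarrow> gset \<Rightarrow> gset \<Rightarrow> (nat \<Rightarrow> nat) \<Rightarrow> (nat \<Rightarrow> nat) \<Rightarrow> bool" where
  "is_coproduct G X Y W i j \<longleftrightarrow> gmap G X W i \<and> gmap G Y W j
     \<and> inj_on i (pts X) \<and> inj_on j (pts Y)
     \<and> i ` pts X \<inter> j ` pts Y = {} \<and> i ` pts X \<union> j ` pts Y = pts W"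

text \<open>The square with sides \<open>p : W \<rightarrow> X\<close>, \<open>q : W \<rightarrow> Y\<close>, \<open>f : X \<rightarrow> Z\<close>, \<open>g : Y \<rightarrow> Z\<close> is a pullback.\<close>

definition is_pullback ::
    "nat monoid \<Rightarrow> gset \<Rightarrow> gset \<Rightarrow> gset \<Rightarrow> gset \<Rightarrow> (nat \<Rightarrow> nat) \<Rightarrow> (nat \<Rightarrow> nat) \<Rightarrow> (nat \<Rightarrow> nat)
      \<Rightarrow> (nat \<Rightarrow> nat) \<Rightarrow> bool" where
  "is_pullback G W X Y Z p q f g \<longleftrightarrow>
     gmap G W X p \<and> gmap G W Y q \<and> gmap G X Z f \<and> gmap G Y Z g
     \<and> (\<forall>w\<in>pts W. f (p w) = g (q w))
     \<and> (\<forall>x\<in>pts X. \<forall>y\<in>pts Y. f x = g y \<longrightarrow> (\<exists>!w. w \<in> pts W \<and> p w = x \<and> q w = y))"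

text \<open>
  Exponential diagrams on \<open>f : X \<rightarrow> Y\<close> and \<open>g : Y \<rightarrow> Z\<close>: \<open>q : B \<rightarrow> Z\<close> is the dependent product of
  \<open>f\<close> along \<open>g\<close> (its fibre over \<open>z\<close> is the set of sections \<open>\<sigma>\<close> of \<open>f\<close> over the fibre of \<open>g\<close> at
  \<open>z\<close>), \<open>A\<close> with \<open>w : A \<rightarrow> Y\<close> and \<open>p : A \<rightarrow> B\<close> is the pullback of \<open>g\<close> and \<open>q\<close>, and
  \<open>e : A \<rightarrow> X\<close> is the evaluation of sections.
\<close>

definition is_exponential ::
    "nat monoid \<Rightarrow> gset \<Rightarrow> gset \<Rightarrow> gset \<Rightarrow> gset \<Rightarrow> gset \<Rightarrow> (nat \<Rightarrow> nat) \<Rightarrow> (nat \<Rightarrow> nat)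
      \<Rightarrow> (nat \<Rightarrow> nat) \<Rightarrow> (nat \<Rightarrow> nat) \<Rightarrow> (nat \<Rightarrow> nat) \<Rightarrow> (nat \<Rightarrow> nat) \<Rightarrow> bool" where
  "is_exponential G X Y Z A B f g e p q w \<longleftrightarrow>
     gmap G X Y f \<and> is_pullback G A Y B Z w p g q \<and> gmap G A X e
     \<and> (\<forall>a\<in>pts A. f (e a) = w a)
     \<and> (\<forall>z\<in>pts Z. \<forall>\<sigma>. (\<forall>y\<in>pts Y. g y = z \<longrightarrow> \<sigma> y \<in> pts X \<and> f (\<sigma> y) = y) \<longrightarrow>
          (\<exists>!b. b \<in> pts B \<and> q b = z \<and> (\<forall>a\<in>pts A. p a = b \<longrightarrow> e a = \<sigma> (w a))))"

section \<open>Tambara functors\<close>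

record 'a tambara_data =
  tval :: "gset \<Rightarrow> 'a ring"
  tres :: "gset \<Rightarrow> gset \<Rightarrow> (nat \<Rightarrow> nat) \<Rightarrow> 'a \<Rightarrow> 'a"
  ttr :: "gset \<Rightarrow> gset \<Rightarrow> (nat \<Rightarrow> nat) \<Rightarrow> 'a \<Rightarrow> 'a"
  tnm :: "gset \<Rightarrow> gset \<Rightarrow> (nat \<Rightarrow> nat) \<Rightarrow> 'a \<Rightarrow> 'a"

text \<open>
  For \<open>f : X \<rightarrow> Y\<close>, \<^term>\<open>tres T X Y f\<close> goes from the value at \<open>Y\<close> to the value at \<open>X\<close>, and
  \<^term>\<open>ttr T X Y f\<close> and \<^term>\<open>tnm T X Y f\<close> go from the value at \<open>X\<close> to the value at \<open>Y\<close>.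
\<close>

locale tambara =
  fixes G :: "nat monoid" and T :: "'a tambara_data"
  assumes val_cring: "is_gset G X \<Longrightarrow> cring (tval T X)"
    and res_hom: "gmap G X Y f \<Longrightarrow> tres T X Y f \<in> ring_hom (tval T Y) (tval T X)"
    and tr_hom: "gmap G X Y f \<Longrightarrow> ttr T X Y f \<in> hom (add_monoid (tval T X)) (add_monoid (tval T Y))"
    and nm_hom: "gmap G X Y f \<Longrightarrow> tnm T X Y f \<in> hom (tval T X) (tval T Y)"
    and nm_one: "gmap G X Y f \<Longrightarrow> tnm T X Y f \<one>\<^bsub>tval T X\<^esub> = \<one>\<^bsub>tval T Y\<^esub>"
    and map_cong: "\<lbrakk>gmap G X Y f; \<And>x. x \<in> pts X \<Longrightarrow> f x = f' x\<rbrakk>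
       \<Longrightarrow> (\<forall>b\<in>carrier (tval T Y). tres T X Y f b = tres T X Y f' b)
         \<and> (\<forall>a\<in>carrier (tval T X). ttr T X Y f a = ttr T X Y f' a \<and> tnm T X Y f a = tnm T X Y f' a)"
    and map_id: "\<lbrakk>is_gset G X; a \<in> carrier (tval T X)\<rbrakk>
       \<Longrightarrow> tres T X X id a = a \<and> ttr T X X id a = a \<and> tnm T X X id a = a"
    and res_comp: "\<lbrakk>gmap G X Y f; gmap G Y Z g; c \<in> carrier (tval T Z)\<rbrakk>
       \<Longrightarrow> tres T X Z (g \<circ> f) c = tres T X Y f (tres T Y Z g c)"
    and tr_comp: "\<lbrakk>gmap G X Y f; gmap G Y Z g; a \<in> carrier (tval T X)\<rbrakk>
       \<Longrightarrow> ttr T X Z (g \<circ> f) a = ttr T Y Z g (ttr T X Y f a)"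
    and nm_comp: "\<lbrakk>gmap G X Y f; gmap G Y Z g; a \<in> carrier (tval T X)\<rbrakk>
       \<Longrightarrow> tnm T X Z (g \<circ> f) a = tnm T Y Z g (tnm T X Y f a)"
    and tr_base_change: "\<lbrakk>is_pullback G W X Y Z p q f g; a \<in> carrier (tval T X)\<rbrakk>
       \<Longrightarrow> tres T Y Z g (ttr T X Z f a) = ttr T W Y q (tres T W X p a)"
    and nm_base_change: "\<lbrakk>is_pullback G W X Y Z p q f g; a \<in> carrier (tval T X)\<rbrakk>
       \<Longrightarrow> tres T Y Z g (tnm T X Z f a) = tnm T W Y q (tres T W X p a)"
    and distributive: "\<lbrakk>is_exponential G X Y Z A B f g e p q w; a \<in> carrier (tval T X)\<rbrakk>
       \<Longrightarrow> tnm T Y Z g (ttr T X Y f a) = ttr T B Z q (tnm T A B p (tres T A X e a))"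
    and val_coproduct: "is_coproduct G X Y W i j
       \<Longrightarrow> bij_betw (\<lambda>c. (tres T X W i c, tres T Y W j c))
             (carrier (tval T W)) (carrier (tval T X) \<times> carrier (tval T Y))"
    and val_empty: "\<lbrakk>is_gset G X; pts X = {}\<rbrakk> \<Longrightarrow> carrier (tval T X) = {\<zero>\<^bsub>tval T X\<^esub>}"

definition tambara_hom ::
    "nat monoid \<Rightarrow> 'a tambara_data \<Rightarrow> 'b tambara_data \<Rightarrow> (gset \<Rightarrow> 'a \<Rightarrow> 'b) \<Rightarrow> bool" where
  "tambara_hom G S T h \<longleftrightarrow>
     (\<forall>X. is_gset G X \<longrightarrow> h X \<in> ring_hom (tval S X) (tval T X))
     \<and> (\<forall>X Y f. gmap G X Y f \<longrightarrow>
          (\<forall>b\<in>carrier (tval S Y). h X (tres S X Y f b) = tres T X Y f (h Y b))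
          \<and> (\<forall>a\<in>carrier (tval S X). h Y (ttr S X Y f a) = ttr T X Y f (h X a)
                                   \<and> h Y (tnm S X Y f a) = tnm T X Y f (h X a)))"

definition tambara_iso ::
    "nat monoid \<Rightarrow> 'a tambara_data \<Rightarrow> 'b tambara_data \<Rightarrow> (gset \<Rightarrow> 'a \<Rightarrow> 'b) \<Rightarrow> bool" where
  "tambara_iso G S T h \<longleftrightarrow> tambara_hom G S T h
     \<and> (\<forall>X. is_gset G X \<longrightarrow> bij_betw (h X) (carrier (tval S X)) (carrier (tval T X)))"

section \<open>Restriction, pullback along an isomorphism of groups, and norms\<close>

abbreviation subgrp :: "nat monoid \<Rightarrow> nat set \<Rightarrow> nat monoid" where
  "subgrp G H \<equiv> G\<lparr>carrier := H\<rparr>"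

text \<open>
  \<^term>\<open>coset_rep G H g\<close> is the least element of \<open>g H\<close>.  The induced G-set \<open>G \<times>\<^sub>H X\<close> is the set of
  pairs \<open>(t, x)\<close> with \<open>t\<close> in the transversal of these representatives.
\<close>

definition coset_rep :: "nat monoid \<Rightarrow> nat set \<Rightarrow> nat \<Rightarrow> nat" where
  "coset_rep G H g = (LEAST t. t \<in> g <#\<^bsub>G\<^esub> H)"

definition ind :: "nat monoid \<Rightarrow> nat set \<Rightarrow> gset \<Rightarrow> gset" where
  "ind G H X = \<lparr>
     pts = {prod_encode (t, x) | t x. t \<in> coset_rep G H ` carrier G \<and> x \<in> pts X},
     act = (\<lambda>g c. case prod_decode c of (t, x) \<Rightarrow>
              let u = coset_rep G H (g \<otimes>\<^bsub>G\<^esub> t)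
              in prod_encode (u, act X (inv\<^bsub>G\<^esub> u \<otimes>\<^bsub>G\<^esub> g \<otimes>\<^bsub>G\<^esub> t) x)) \<rparr>"

definition ind_map :: "(nat \<Rightarrow> nat) \<Rightarrow> nat \<Rightarrow> nat" where
  "ind_map f c = (case prod_decode c of (t, x) \<Rightarrow> prod_encode (t, f x))"

text \<open>\<open>i\<^sub>H\<^sup>G T\<close> is given by \<open>X \<mapsto> T (G \<times>\<^sub>H X)\<close>; in particular its value at \<open>H/L\<close> is \<open>T(G/L)\<close>.\<close>

definition restr :: "nat monoid \<Rightarrow> nat set \<Rightarrow> 'a tambara_data \<Rightarrow> 'a tambara_data" where
  "restr G H T = \<lparr>
     tval = (\<lambda>X. tval T (ind G H X)),
     tres = (\<lambda>X Y f. tres T (ind G H X) (ind G H Y) (ind_map f)),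
     ttr = (\<lambda>X Y f. ttr T (ind G H X) (ind G H Y) (ind_map f)),
     tnm = (\<lambda>X Y f. tnm T (ind G H X) (ind G H Y) (ind_map f)) \<rparr>"

text \<open>
  For an isomorphism of groups \<open>\<phi> : K \<rightarrow> K'\<close>, \<^term>\<open>push_gset K \<phi> X\<close> is the K-set \<open>X\<close> made into a
  K'-set along the inverse of \<open>\<phi>\<close>; it turns \<open>K/L\<close> into \<open>K'/\<phi>(L)\<close>.
\<close>

definition push_gset :: "nat set \<Rightarrow> (nat \<Rightarrow> nat) \<Rightarrow> gset \<Rightarrow> gset" where
  "push_gset K \<phi> X = X\<lparr>act := (\<lambda>k. act X (inv_into K \<phi> k))\<rparr>"

definition pull :: "nat set \<Rightarrow> (nat \<Rightarrow> nat) \<Rightarrow> 'a tambara_data \<Rightarrow> 'a tambara_data" where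
  "pull K \<phi> R = \<lparr>
     tval = (\<lambda>X. tval R (push_gset K \<phi> X)),
     tres = (\<lambda>X Y. tres R (push_gset K \<phi> X) (push_gset K \<phi> Y)),
     ttr = (\<lambda>X Y. ttr R (push_gset K \<phi> X) (push_gset K \<phi> Y)),
     tnm = (\<lambda>X Y. tnm R (push_gset K \<phi> X) (push_gset K \<phi> Y)) \<rparr>"

text \<open>
  \<open>\<eta> : R \<rightarrow> i\<^sub>H\<^sup>G N\<close> is a universal arrow from \<open>R\<close> to \<open>i\<^sub>H\<^sup>G\<close>, tested on the Tambara functors with values
  in a given type.
\<close>

definition universal_arrow ::
    "nat monoid \<Rightarrow> nat set \<Rightarrow> 'a tambara_data \<Rightarrow> 'b tambara_data \<Rightarrow> (gset \<Rightarrow> 'a \<Rightarrow> 'b) \<Rightarrow> 'c itself \<Rightarrow> bool"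
  where
  "universal_arrow G H R N \<eta> (_ :: 'c itself) \<longleftrightarrow>
     tambara G N \<and> tambara_hom (subgrp G H) R (restr G H N) \<eta>
     \<and> (\<forall>(T :: 'c tambara_data) f. tambara G T \<and> tambara_hom (subgrp G H) R (restr G H T) f \<longrightarrow>
          (\<exists>h. tambara_hom G N T h
             \<and> (\<forall>X. is_gset (subgrp G H) X \<longrightarrow>
                  (\<forall>x\<in>carrier (tval R X). h (ind G H X) (\<eta> X x) = f X x)))
          \<and> (\<forall>h h'. tambara_hom G N T h \<and> tambara_hom G N T h'
               \<and> (\<forall>X. is_gset (subgrp G H) X \<longrightarrow>
                    (\<forall>x\<in>carrier (tval R X). h (ind G H X) (\<eta> X x) = f X x
                                           \<and> h' (ind G H X) (\<eta> X x) = f X x))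
               \<longrightarrow> (\<forall>X. is_gset G X \<longrightarrow> (\<forall>c\<in>carrier (tval N X). h X c = h' X c))))"

text \<open>
  HOL cannot test against all types inside a definition, so the norm of \<open>R\<close> takes its values in a
  type that is large enough for all Tambara functors generated by \<open>R\<close>: sets of formal expressions
  in the Tambara operations with generators from \<open>R\<close>.  The theorem \<open>norm_universal\<close> below shows that
  the norm exists and that it is universal for Tambara functors with values in an arbitrary type.
\<close>

datatype 'a tambara_term =
    Gen gset 'a
  | Zero gset
  | One gset
  | Neg gset "'a tambara_term"
  | Add gset "'a tambara_term" "'a tambara_term"
  | Mul gset "'a tambara_term" "'a tambara_term"
  | Res gset gset "nat \<Rightarrow> nat" "'a tambara_term"
  | Tr gset gset "nat \<Rightarrow> nat" "'a tambara_term"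
  | Nm gset gset "nat \<Rightarrow> nat" "'a tambara_term"

type_synonym 'a norm_val = "'a tambara_term set"

definition norm_pair ::
    "nat monoid \<Rightarrow> nat set \<Rightarrow> 'a tambara_data
      \<Rightarrow> 'a norm_val tambara_data \<times> (gset \<Rightarrow> 'a \<Rightarrow> 'a norm_val)" where
  "norm_pair G H R = (SOME (N, \<eta>). universal_arrow G H R N \<eta> TYPE('a norm_val))"

definition norm :: "nat monoid \<Rightarrow> nat set \<Rightarrow> 'a tambara_data \<Rightarrow> 'a norm_val tambara_data" where
  "norm G H R = fst (norm_pair G H R)"

definition norm_unit :: "nat monoid \<Rightarrow> nat set \<Rightarrow> 'a tambara_data \<Rightarrow> gset \<Rightarrow> 'a \<Rightarrow> 'a norm_val" where
  "norm_unit G H R = snd (norm_pair G H R)"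

text \<open>The map \<open>N\<^sub>H\<^sup>G R \<rightarrow> T\<close> adjoint to \<open>f : R \<rightarrow> i\<^sub>H\<^sup>G T\<close>.\<close>

definition adjoint_map ::
    "nat monoid \<Rightarrow> nat set \<Rightarrow> 'a tambara_data \<Rightarrow> 'b tambara_data \<Rightarrow> (gset \<Rightarrow> 'a \<Rightarrow> 'b)
      \<Rightarrow> gset \<Rightarrow> 'a norm_val \<Rightarrow> 'b" where
  "adjoint_map G H R T f = (SOME h. tambara_hom G (norm G H R) T h
     \<and> (\<forall>X. is_gset (subgrp G H) X \<longrightarrow>
          (\<forall>x\<in>carrier (tval R X). h (ind G H X) (norm_unit G H R X x) = f X x)))"

definition counit :: "nat monoid \<Rightarrow> nat set \<Rightarrow> 'a tambara_data \<Rightarrow> gset \<Rightarrow> 'a norm_val \<Rightarrow> 'a" where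
  "counit G H T = adjoint_map G H (restr G H T) T (\<lambda>X x. x)"

definition norm_map ::
    "nat monoid \<Rightarrow> nat set \<Rightarrow> 'a tambara_data \<Rightarrow> 'b tambara_data \<Rightarrow> (gset \<Rightarrow> 'a \<Rightarrow> 'b)
      \<Rightarrow> gset \<Rightarrow> 'a norm_val \<Rightarrow> 'b norm_val" where
  "norm_map G H R S f = adjoint_map G H R (norm G H S) (\<lambda>X x. norm_unit G H S X (f X x))"

text \<open>The isomorphism \<open>G \<times>\<^sub>L X \<rightarrow> G \<times>\<^sub>K (K \<times>\<^sub>L X)\<close> for \<open>L \<le> K \<le> G\<close>.\<close>

definition ind_assoc :: "nat monoid \<Rightarrow> nat set \<Rightarrow> nat set \<Rightarrow> gset \<Rightarrow> nat \<Rightarrow> nat" where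
  "ind_assoc G K L X c = (case prod_decode c of (t, x) \<Rightarrow>
     let u = coset_rep G K t; v = coset_rep (subgrp G K) L (inv\<^bsub>G\<^esub> u \<otimes>\<^bsub>G\<^esub> t)
     in prod_encode (u, prod_encode (v, act X (inv\<^bsub>G\<^esub> v \<otimes>\<^bsub>G\<^esub> inv\<^bsub>G\<^esub> u \<otimes>\<^bsub>G\<^esub> t) x)))"

text \<open>
  The canonical isomorphism \<open>N\<^sub>L\<^sup>G B \<rightarrow> N\<^sub>K\<^sup>G N\<^sub>L\<^sup>K B\<close> of the two left adjoints of
  \<open>i\<^sub>L\<^sup>G \<cong> i\<^sub>L\<^sup>K i\<^sub>K\<^sup>G\<close>.
\<close>

definition reorder ::
    "nat monoid \<Rightarrow> nat set \<Rightarrow> nat set \<Rightarrow> 'a tambara_data \<Rightarrow> gset \<Rightarrow> 'a norm_val \<Rightarrow> 'a norm_val norm_val"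
  where
  "reorder G K L B = (let M = norm (subgrp G K) L B; N = norm G K M in
     adjoint_map G L B N (\<lambda>X x.
       tres N (ind G L X) (ind G K (ind (subgrp G K) L X)) (ind_assoc G K L X)
         (norm_unit G K M (ind (subgrp G K) L X) (norm_unit (subgrp G K) L B X x))))"

section \<open>Box products\<close>

text \<open>
  The box product of a nonempty finite family of Tambara functors \<open>T i\<close>, \<open>i \<in> I\<close>.  Its value at \<open>X\<close>
  is Day convolution: it consists of the symbols \<open>[Y, f, m]\<close> with \<open>f : Y \<rightarrow> X\<close> and
  \<open>m i \<in> T i (Y)\<close>, thought of as the transfer along \<open>f\<close> of the external tensor product of the \<open>m i\<close>,
  modulo the Frobenius relations
  \<open>[Y', f', (.., m' i, .., ttr h a, ..)] = [Y, f' \<circ> h, (.., tres h (m' i), .., a, ..)]\<close>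
  for \<open>h : Y \<rightarrow> Y'\<close>.  Sums of symbols are given by disjoint unions; the Frobenius relation along
  fold maps gives multilinearity.  Since Tambara functors take values in rings, no group completion is
  needed.  The value of \<open>m\<close> outside \<open>I\<close> is irrelevant: the relation (with \<open>h\<close> an identity)
  identifies symbols that agree on \<open>I\<close>.
\<close>

type_synonym ('i, 'a) symbol = "gset \<times> (nat \<Rightarrow> nat) \<times> ('i \<Rightarrow> 'a)"

definition symbols ::
    "nat monoid \<Rightarrow> 'i set \<Rightarrow> ('i \<Rightarrow> 'a tambara_data) \<Rightarrow> gset \<Rightarrow> ('i, 'a) symbol set" where
  "symbols G I T X = {(Y, f, m). gmap G Y X f \<and> (\<forall>i\<in>I. m i \<in> carrier (tval (T i) Y))}"

definition frobenius ::
    "nat monoid \<Rightarrow> 'i set \<Rightarrow> ('i \<Rightarrow> 'a tambara_data) \<Rightarrow> gset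
      \<Rightarrow> ('i, 'a) symbol \<Rightarrow> ('i, 'a) symbol \<Rightarrow> bool" where
  "frobenius G I T X = (\<lambda>(Y, f, m) (Y', f', m').
     (Y, f, m) \<in> symbols G I T X \<and> (Y', f', m') \<in> symbols G I T X
     \<and> (\<exists>h. \<exists>j\<in>I. gmap G Y Y' h \<and> (\<forall>y\<in>pts Y. f y = f' (h y))
          \<and> m' j = ttr (T j) Y Y' h (m j)
          \<and> (\<forall>i\<in>I - {j}. m i = tres (T i) Y Y' h (m' i))))"

definition box_class ::
    "nat monoid \<Rightarrow> 'i set \<Rightarrow> ('i \<Rightarrow> 'a tambara_data) \<Rightarrow> gset
      \<Rightarrow> ('i, 'a) symbol set \<Rightarrow> ('i, 'a) symbol set" where
  "box_class G I T X S = {b. \<exists>a \<in> S \<inter> symbols G I T X. equivclp (frobenius G I T X) a b}"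

text \<open>
  The operations are given on symbols, where they are the formulas forced by the axioms for
  transfers of products: products by pullback, restrictions by base change, norms by the
  distributive law.
\<close>

definition box_ring ::
    "nat monoid \<Rightarrow> 'i set \<Rightarrow> ('i \<Rightarrow> 'a tambara_data) \<Rightarrow> gset \<Rightarrow> ('i, 'a) symbol set ring" where
  "box_ring G I T X = \<lparr>
     carrier = {box_class G I T X {a} | a. a \<in> symbols G I T X},
     monoid.mult = (\<lambda>c d. box_class G I T X {(W, k, m). \<exists>(Y, f, a)\<in>c. \<exists>(Y', f', a')\<in>d. \<exists>p q.
         is_pullback G W Y Y' X p q f f' \<and> (\<forall>w\<in>pts W. k w = f (p w))
         \<and> (\<forall>i\<in>I. m i = tres (T i) W Y p (a i) \<otimes>\<^bsub>tval (T i) W\<^esub> tres (T i) W Y' q (a' i))}),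
     one = box_class G I T X {(X, id, \<lambda>i. \<one>\<^bsub>tval (T i) X\<^esub>)},
     zero = box_class G I T X {(Y, f, m). pts Y = {}},
     add = (\<lambda>c d. box_class G I T X {(W, k, m). \<exists>(Y, f, a)\<in>c. \<exists>(Y', f', a')\<in>d. \<exists>i j.
         is_coproduct G Y Y' W i j
         \<and> (\<forall>y\<in>pts Y. k (i y) = f y) \<and> (\<forall>y\<in>pts Y'. k (j y) = f' y)
         \<and> (\<forall>l\<in>I. tres (T l) Y W i (m l) = a l \<and> tres (T l) Y' W j (m l) = a' l)}) \<rparr>"

definition box ::
    "nat monoid \<Rightarrow> 'i set \<Rightarrow> ('i \<Rightarrow> 'a tambara_data) \<Rightarrow> ('i, 'a) symbol set tambara_data" where
  "box G I T = \<lparr>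
     tval = box_ring G I T,
     tres = (\<lambda>X Z g c. box_class G I T X {(W, k, m). \<exists>(Y, f, a)\<in>c. \<exists>p.
         is_pullback G W Y X Z p k f g \<and> (\<forall>i\<in>I. m i = tres (T i) W Y p (a i))}),
     ttr = (\<lambda>X Z g c. box_class G I T Z {(Y, g \<circ> f, a) | Y f a. (Y, f, a) \<in> c}),
     tnm = (\<lambda>X Z g c. box_class G I T Z {(B, q, m). \<exists>(Y, f, a)\<in>c. \<exists>A e p w.
         is_exponential G Y X Z A B f g e p q w
         \<and> (\<forall>i\<in>I. m i = tnm (T i) A B p (tres (T i) A Y e (a i)))}) \<rparr>"

text \<open>
  The map of box products with \<open>[Y, f, m] \<mapsto> [Y, f, \<Phi> Y m]\<close>, for a natural transformation \<open>\<Phi>\<close> of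
  families.
\<close>

definition box_map ::
    "nat monoid \<Rightarrow> 'j set \<Rightarrow> ('j \<Rightarrow> 'b tambara_data) \<Rightarrow> (gset \<Rightarrow> ('i \<Rightarrow> 'a) \<Rightarrow> 'j \<Rightarrow> 'b)
      \<Rightarrow> gset \<Rightarrow> ('i, 'a) symbol set \<Rightarrow> ('j, 'b) symbol set" where
  "box_map G J T \<Phi> X c = box_class G J T X {(Y, f, \<Phi> Y m) | Y f m. (Y, f, m) \<in> c}"

section \<open>Simplicial Tambara functors\<close>

record 'a simplicial_data =
  level :: "nat \<Rightarrow> 'a tambara_data"
  face :: "nat \<Rightarrow> nat \<Rightarrow> gset \<Rightarrow> 'a \<Rightarrow> 'a"
  degen :: "nat \<Rightarrow> nat \<Rightarrow> gset \<Rightarrow> 'a \<Rightarrow> 'a"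

text \<open>
  \<^term>\<open>face S n i\<close> is \<open>d\<^sub>i\<close> from level \<open>n\<close> to level \<open>n - 1\<close> (for \<open>n \<ge> 1\<close>, \<open>i \<le> n\<close>), and
  \<^term>\<open>degen S n i\<close> is \<open>s\<^sub>i\<close> from level \<open>n\<close> to level \<open>n + 1\<close> (for \<open>i \<le> n\<close>).
\<close>

definition simplicial_tambara_iso ::
    "nat monoid \<Rightarrow> 'a simplicial_data \<Rightarrow> 'b simplicial_data \<Rightarrow> (nat \<Rightarrow> gset \<Rightarrow> 'a \<Rightarrow> 'b) \<Rightarrow> bool" where
  "simplicial_tambara_iso G S S' h \<longleftrightarrow>
     (\<forall>n. tambara_iso G (level S n) (level S' n) (h n))
     \<and> (\<forall>n i X. \<forall>c\<in>carrier (tval (level S n) X). is_gset G X \<and> i \<le> n \<longrightarrow>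
          (n \<ge> 1 \<longrightarrow> h (n - 1) X (face S n i X c) = face S' n i X (h n X c))
          \<and> h (n + 1) X (degen S n i X c) = degen S' n i X (h n X c))"

subsection \<open>The two-sided bar construction\<close>

text \<open>
  For \<open>\<alpha> : A \<rightarrow> M\<close> and \<open>\<beta> : A \<rightarrow> N\<close>.  In \<open>M \<box> A \<box> \<dots> \<box> A \<box> N\<close>
  the factor \<open>M\<close> has position \<open>0\<close>, the \<open>n\<close> factors \<open>A\<close> have positions \<open>1, \<dots>, n\<close>, and \<open>N\<close> has
  position \<open>n + 1\<close>.  The face maps multiply two neighbouring factors, and are numbered so that \<open>d\<^sub>0\<close> is
  the action on \<open>N\<close> and \<open>d\<^sub>n\<close> the action on \<open>M\<close>: \<open>d\<^sub>i\<close> multiplies the positions \<open>n - i\<close> and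
  \<open>n - i + 1\<close>.  This is the numbering that fits the simplicial set \<open>P\<close> below, in which \<open>d\<^sub>0\<close> of an
  edge lies in the orbit that corresponds to \<open>N\<close>, and \<open>d\<^sub>1\<close> in the one that corresponds to \<open>M\<close>.
\<close>

definition bar_family ::
    "'b tambara_data \<Rightarrow> 'b tambara_data \<Rightarrow> 'b tambara_data \<Rightarrow> nat \<Rightarrow> nat \<Rightarrow> 'b tambara_data" where
  "bar_family M A N n j = (if j = 0 then M else if j = n + 1 then N else A)"

definition bar_face ::
    "'b tambara_data \<Rightarrow> 'b tambara_data \<Rightarrow> 'b tambara_data \<Rightarrow> (gset \<Rightarrow> 'b \<Rightarrow> 'b) \<Rightarrow> (gset \<Rightarrow> 'b \<Rightarrow> 'b)
      \<Rightarrow> nat \<Rightarrow> nat \<Rightarrow> gset \<Rightarrow> (nat \<Rightarrow> 'b) \<Rightarrow> nat \<Rightarrow> 'b" where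
  "bar_face M A N \<alpha> \<beta> n i Y a j = (let k = n - i in
     if j < k then a j
     else if j > k then a (j + 1)
     else if k = 0 then a 0 \<otimes>\<^bsub>tval M Y\<^esub> \<alpha> Y (a 1)
     else if k = n then \<beta> Y (a n) \<otimes>\<^bsub>tval N Y\<^esub> a (n + 1)
     else a k \<otimes>\<^bsub>tval A Y\<^esub> a (k + 1))"

definition bar_degen :: "'b tambara_data \<Rightarrow> nat \<Rightarrow> nat \<Rightarrow> gset \<Rightarrow> (nat \<Rightarrow> 'b) \<Rightarrow> nat \<Rightarrow> 'b" where
  "bar_degen A n i Y a j = (let k = n - i in
     if j \<le> k then a j else if j = k + 1 then \<one>\<^bsub>tval A Y\<^esub> else a (j - 1))"

definition bar ::
    "nat monoid \<Rightarrow> 'b tambara_data \<Rightarrow> 'b tambara_data \<Rightarrow> 'b tambara_data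
      \<Rightarrow> (gset \<Rightarrow> 'b \<Rightarrow> 'b) \<Rightarrow> (gset \<Rightarrow> 'b \<Rightarrow> 'b) \<Rightarrow> (nat, 'b) symbol set simplicial_data" where
  "bar G M A N \<alpha> \<beta> = \<lparr>
     level = (\<lambda>n. box G {0..n + 1} (bar_family M A N n)),
     face = (\<lambda>n i. box_map G {0..n} (bar_family M A N (n - 1)) (bar_face M A N \<alpha> \<beta> n i)),
     degen = (\<lambda>n i. box_map G {0..n + 2} (bar_family M A N (n + 1)) (bar_degen A n i)) \<rparr>"

subsection \<open>Homotopy groups\<close>

record 'a mackey_data =
  mval :: "gset \<Rightarrow> 'a monoid"
  mres :: "gset \<Rightarrow> gset \<Rightarrow> (nat \<Rightarrow> nat) \<Rightarrow> 'a \<Rightarrow> 'a"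
  mtr :: "gset \<Rightarrow> gset \<Rightarrow> (nat \<Rightarrow> nat) \<Rightarrow> 'a \<Rightarrow> 'a"

definition mackey_iso ::
    "nat monoid \<Rightarrow> 'a mackey_data \<Rightarrow> 'b mackey_data \<Rightarrow> (gset \<Rightarrow> 'a \<Rightarrow> 'b) \<Rightarrow> bool" where
  "mackey_iso G M N h \<longleftrightarrow>
     (\<forall>X. is_gset G X \<longrightarrow> h X \<in> iso (mval M X) (mval N X))
     \<and> (\<forall>X Y f. gmap G X Y f \<longrightarrow>
          (\<forall>b\<in>carrier (mval M Y). h X (mres M X Y f b) = mres N X Y f (h Y b))
          \<and> (\<forall>a\<in>carrier (mval M X). h Y (mtr M X Y f a) = mtr N X Y f (h X a)))"

text \<open>
  The homotopy groups of the simplicial abelian groups of values: \<open>n\<close>-spheres based at \<open>0\<close> modulo those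
  that bound an \<open>(n+1)\<close>-simplex all of whose other faces are \<open>0\<close>.
\<close>

definition spheres :: "'a simplicial_data \<Rightarrow> nat \<Rightarrow> gset \<Rightarrow> 'a set" where
  "spheres S n X = {x \<in> carrier (tval (level S n) X).
     n \<ge> 1 \<longrightarrow> (\<forall>i\<le>n. face S n i X x = \<zero>\<^bsub>tval (level S (n - 1)) X\<^esub>)}"

definition boundaries :: "'a simplicial_data \<Rightarrow> nat \<Rightarrow> gset \<Rightarrow> 'a set" where
  "boundaries S n X = {face S (n + 1) (n + 1) X z | z. z \<in> carrier (tval (level S (n + 1)) X)
     \<and> (\<forall>i\<le>n. face S (n + 1) i X z = \<zero>\<^bsub>tval (level S n) X\<^esub>)}"

definition homotopy :: "'a simplicial_data \<Rightarrow> nat \<Rightarrow> 'a set mackey_data" where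
  "homotopy S n = \<lparr>
     mval = (\<lambda>X. ((add_monoid (tval (level S n) X) :: 'a monoid)\<lparr>carrier := spheres S n X\<rparr>)
              Mod boundaries S n X),
     mres = (\<lambda>X Y f C. \<Union>c\<in>C. boundaries S n X +>\<^bsub>tval (level S n) X\<^esub> tres (level S n) X Y f c),
     mtr = (\<lambda>X Y f C. \<Union>c\<in>C. boundaries S n Y +>\<^bsub>tval (level S n) Y\<^esub> ttr (level S n) X Y f c) \<rparr>"

section \<open>The dihedral group and the simplicial set \<open>P\<close>\<close>

text \<open>For \<open>k < m\<close>, the number \<open>k\<close> stands for \<open>r\<^sup>k\<close> and \<open>m + k\<close> for \<open>r\<^sup>k s\<close>.\<close>

definition dihedral :: "nat \<Rightarrow> nat monoid" where
  "dihedral m = \<lparr>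
     carrier = {0..<2 * m},
     monoid.mult = (\<lambda>x y.
       if x < m then (if y < m then (x + y) mod m else m + (x + (y - m)) mod m)
       else (if y < m then m + ((x - m) + (m - y)) mod m else ((x - m) + (m - (y - m))) mod m)),
     one = 0 \<rparr>"

definition rot :: "nat \<Rightarrow> nat" where
  "rot m = 1 mod m"

definition flip :: "nat \<Rightarrow> nat" where
  "flip m = m"

definition D2 :: "nat \<Rightarrow> nat set" where
  "D2 m = generate (dihedral m) {flip m}"

definition D2' :: "nat \<Rightarrow> nat set" where
  "D2' m = generate (dihedral m) {rot m \<otimes>\<^bsub>dihedral m\<^esub> flip m}"

abbreviation D1 :: "nat \<Rightarrow> nat set" where
  "D1 m \<equiv> {\<one>\<^bsub>dihedral m\<^esub>}"

text \<open>
  The simplices of degree \<open>n\<close>: \<open>Vx k\<close> and \<open>Vx' k\<close> are the degeneracies of \<open>x\<^sub>k\<close> and \<open>x\<^sub>k'\<close>, and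
  \<open>Ed g c\<close> with \<open>1 \<le> c \<le> n\<close> is the degeneracy of \<open>y\<^sub>g\<close> along the surjection from \<open>{0, \<dots>, n}\<close> to
  \<open>{0, 1}\<close> that is \<open>0\<close> exactly on \<open>{0, \<dots>, c - 1}\<close>.
\<close>

datatype psimplex = Vx nat | Vx' nat | Ed nat nat

definition P2m :: "nat \<Rightarrow> nat \<Rightarrow> psimplex set" where
  "P2m m n = Vx ` {0..<m} \<union> Vx' ` {0..<m} \<union> (\<lambda>(g, c). Ed g c) ` (carrier (dihedral m) \<times> {1..n})"

text \<open>\<open>x\<^sub>k = r\<^sup>k x\<^sub>0\<close> with \<open>s x\<^sub>0 = x\<^sub>0\<close>, and \<open>x\<^sub>k' = r\<^sup>k x\<^sub>0'\<close> with \<open>r s x\<^sub>0' = x\<^sub>0'\<close>.\<close>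

fun P_act :: "nat \<Rightarrow> nat \<Rightarrow> psimplex \<Rightarrow> psimplex" where
  "P_act m g (Vx k) = Vx (if g < m then (g + k) mod m else ((g - m) + (m - k)) mod m)"
| "P_act m g (Vx' k) = Vx' (if g < m then (g + k) mod m else ((g - m) + (m - k) + (m - 1)) mod m)"
| "P_act m g (Ed h c) = Ed (g \<otimes>\<^bsub>dihedral m\<^esub> h) c"

definition d0_edge :: "nat \<Rightarrow> nat \<Rightarrow> psimplex" where
  "d0_edge m g = Vx' (if g < m then g else ((g - m) + (m - 1)) mod m)"

definition d1_edge :: "nat \<Rightarrow> nat \<Rightarrow> psimplex" where
  "d1_edge m g = Vx (if g < m then g else g - m)"

text \<open>
  In \<open>d\<^sub>i (Ed g c)\<close> the surjection is restricted to \<open>{0, \<dots>, n} - {i}\<close>.  If it becomes constant with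
  value \<open>1\<close> or \<open>0\<close>, the result is the degeneracy of \<open>d\<^sub>0 y\<^sub>g\<close> or \<open>d\<^sub>1 y\<^sub>g\<close>.
\<close>

fun P_face :: "nat \<Rightarrow> nat \<Rightarrow> nat \<Rightarrow> psimplex \<Rightarrow> psimplex" where
  "P_face m n i (Vx k) = Vx k"
| "P_face m n i (Vx' k) = Vx' k"
| "P_face m n i (Ed g c) = (let c' = (if i < c then c - 1 else c) in
     if c' = 0 then d0_edge m g else if c' = n then d1_edge m g else Ed g c')"

fun P_degen :: "nat \<Rightarrow> psimplex \<Rightarrow> psimplex" where
  "P_degen i (Vx k) = Vx k"
| "P_degen i (Vx' k) = Vx' k"
| "P_degen i (Ed g c) = Ed g (if i < c then c + 1 else c)"

section \<open>The Loday construction\<close>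

text \<open>
  \<open>N\<^sub>e i\<^sub>e R\<close>, with \<open>i\<^sub>e R\<close> a Tambara functor for the trivial group, i.e. the commutative ring \<open>R(D\<^sub>2/e)\<close>.
\<close>

definition ring_e :: "nat \<Rightarrow> 'a tambara_data \<Rightarrow> 'a tambara_data" where
  "ring_e m R = restr (subgrp (dihedral m) (D2 m)) (D1 m) R"

definition act_M :: "nat \<Rightarrow> 'a tambara_data \<Rightarrow> gset \<Rightarrow> 'a norm_val \<Rightarrow> 'a norm_val" where
  "act_M m R X c =
     norm_map (dihedral m) (D2 m) (norm (subgrp (dihedral m) (D2 m)) (D1 m) (ring_e m R)) R
       (counit (subgrp (dihedral m) (D2 m)) (D1 m) R) X
       (reorder (dihedral m) (D2 m) (D1 m) (ring_e m R) X c)"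

text \<open>
  The map \<open>N\<^sub>e i\<^sub>e R \<rightarrow> \<phi>\<^sup>* R\<close> of D2'-Tambara functors that is adjoint to the identity of \<open>R(D\<^sub>2/e)\<close>, under
  the identification of the D2-sets \<open>D\<^sub>2' \<times> X\<close> (via \<open>\<phi>\<close>) and \<open>D\<^sub>2 \<times> X\<close> for a set \<open>X\<close>.
\<close>

definition twisted_counit ::
    "nat \<Rightarrow> (nat \<Rightarrow> nat) \<Rightarrow> 'a tambara_data \<Rightarrow> gset \<Rightarrow> 'a norm_val \<Rightarrow> 'a" where
  "twisted_counit m \<phi> R =
     adjoint_map (subgrp (dihedral m) (D2' m)) (D1 m) (ring_e m R) (pull (D2' m) \<phi> R)
       (\<lambda>X. tres R (push_gset (D2' m) \<phi> (ind (subgrp (dihedral m) (D2' m)) (D1 m) X))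
                    (ind (subgrp (dihedral m) (D2 m)) (D1 m) X)
              (\<lambda>c. case prod_decode c of (t, x) \<Rightarrow> prod_encode (\<phi> t, x)))"

definition act_N :: "nat \<Rightarrow> (nat \<Rightarrow> nat) \<Rightarrow> 'a tambara_data \<Rightarrow> gset \<Rightarrow> 'a norm_val \<Rightarrow> 'a norm_val" where
  "act_N m \<phi> R X c =
     norm_map (dihedral m) (D2' m) (norm (subgrp (dihedral m) (D2' m)) (D1 m) (ring_e m R))
       (pull (D2' m) \<phi> R) (twisted_counit m \<phi> R) X
       (reorder (dihedral m) (D2' m) (D1 m) (ring_e m R) X c)"

text \<open>
  The orbits of \<open>P2m m n\<close> are identified with \<open>D/D\<^sub>2\<close>, \<open>D/D\<^sub>2'\<close> and \<open>D/e\<close> by the representatives \<open>Vx 0\<close>,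
  \<open>Vx' 0\<close> and \<open>Ed 0 c\<close>.  Faces and degeneracies preserve these representatives (see
  \<open>P_face_base\<close> below), so on each orbit they are an identity or one of the standard projections from \<open>D/e\<close>.
\<close>

datatype orbit_type = OD2 | Oe | OD2'

fun simplex_type :: "psimplex \<Rightarrow> orbit_type" where
  "simplex_type (Vx k) = OD2"
| "simplex_type (Vx' k) = OD2'"
| "simplex_type (Ed g c) = Oe"

definition orbit_kind :: "psimplex set \<Rightarrow> orbit_type" where
  "orbit_kind Q = (THE t. \<exists>x\<in>Q. t = simplex_type x)"

fun loday_coeff ::
    "nat \<Rightarrow> (nat \<Rightarrow> nat) \<Rightarrow> 'a tambara_data \<Rightarrow> orbit_type \<Rightarrow> 'a norm_val tambara_data" where
  "loday_coeff m \<phi> R OD2 = norm (dihedral m) (D2 m) R"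
| "loday_coeff m \<phi> R Oe = norm (dihedral m) (D1 m) (ring_e m R)"
| "loday_coeff m \<phi> R OD2' = norm (dihedral m) (D2' m) (pull (D2' m) \<phi> R)"

text \<open>The maps induced by identities and by the standard projections; there are no others in \<open>P\<close>.\<close>

fun loday_proj ::
    "nat \<Rightarrow> (nat \<Rightarrow> nat) \<Rightarrow> 'a tambara_data \<Rightarrow> orbit_type \<Rightarrow> orbit_type
      \<Rightarrow> gset \<Rightarrow> 'a norm_val \<Rightarrow> 'a norm_val" where
  "loday_proj m \<phi> R Oe OD2 X c = act_M m R X c"
| "loday_proj m \<phi> R Oe OD2' X c = act_N m \<phi> R X c"
| "loday_proj m \<phi> R t t' X c = (if t = t' then c else undefined)"

abbreviation P_orbits :: "nat \<Rightarrow> nat \<Rightarrow> psimplex set set" where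
  "P_orbits m n \<equiv> orbits (dihedral m) (P2m m n) (P_act m)"

text \<open>
  The map induced by a map \<open>d\<close> of D-sets (with values in degree \<open>n\<close>): the factor at an orbit \<open>Q'\<close> of the
  target is the product over all orbits \<open>Q\<close> that \<open>d\<close> maps to \<open>Q'\<close>; an empty product is the unit.
\<close>

definition loday_map ::
    "nat \<Rightarrow> (nat \<Rightarrow> nat) \<Rightarrow> 'a tambara_data \<Rightarrow> psimplex set set \<Rightarrow> (psimplex \<Rightarrow> psimplex)
      \<Rightarrow> gset \<Rightarrow> (psimplex set \<Rightarrow> 'a norm_val) \<Rightarrow> psimplex set \<Rightarrow> 'a norm_val" where
  "loday_map m \<phi> R Os d Y a Q' =
     (\<Otimes>\<^bsub>tval (loday_coeff m \<phi> R (orbit_kind Q')) Y\<^esub> Q \<in> {Q \<in> Os. d ` Q = Q'}.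
        loday_proj m \<phi> R (orbit_kind Q) (orbit_kind Q') Y (a Q))"

definition loday ::
    "nat \<Rightarrow> (nat \<Rightarrow> nat) \<Rightarrow> 'a tambara_data \<Rightarrow> (psimplex set, 'a norm_val) symbol set simplicial_data"
  where
  "loday m \<phi> R = \<lparr>
     level = (\<lambda>n. box (dihedral m) (P_orbits m n) (\<lambda>Q. loday_coeff m \<phi> R (orbit_kind Q))),
     face = (\<lambda>n i. box_map (dihedral m) (P_orbits m (n - 1)) (\<lambda>Q. loday_coeff m \<phi> R (orbit_kind Q))
              (loday_map m \<phi> R (P_orbits m n) (P_face m n i))),
     degen = (\<lambda>n i. box_map (dihedral m) (P_orbits m (n + 1)) (\<lambda>Q. loday_coeff m \<phi> R (orbit_kind Q))
              (loday_map m \<phi> R (P_orbits m n) (P_degen i))) \<rparr>"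

section \<open>Real Hochschild homology\<close>

definition real_bar ::
    "nat \<Rightarrow> (nat \<Rightarrow> nat) \<Rightarrow> 'a tambara_data \<Rightarrow> (nat, 'a norm_val) symbol set simplicial_data" where
  "real_bar m \<phi> R =
     bar (dihedral m)
       (norm (dihedral m) (D2 m) R)
       (norm (dihedral m) (D1 m) (ring_e m R))
       (norm (dihedral m) (D2' m) (pull (D2' m) \<phi> R))
       (act_M m R) (act_N m \<phi> R)"

text \<open>The isomorphism from \<open>D\<^sub>2'\<close> to \<open>D\<^sub>2\<close>.\<close>

definition c_zeta :: "nat \<Rightarrow> nat \<Rightarrow> nat" where
  "c_zeta m g = (if g = rot m \<otimes>\<^bsub>dihedral m\<^esub> flip m then flip m else \<one>\<^bsub>dihedral m\<^esub>)"

definition HR ::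
    "nat \<Rightarrow> 'a tambara_data \<Rightarrow> nat \<Rightarrow> (nat, 'a norm_val) symbol set set mackey_data" where
  "HR m R n = homotopy (real_bar m (c_zeta m) R) n"

section \<open>Existence and universal property of norms\<close>

lemma prod_encode_inj [simp]: "prod_encode (a, b) = prod_encode (c, d) \<longleftrightarrow> a = c \<and> b = d"
  by (metis prod.inject prod_encode_inverse)

lemma coset_rep_in:
  assumes "group G" "subgroup H G" "g \<in> carrier G"
  shows "coset_rep G H g \<in> g <#\<^bsub>G\<^esub> H"
proof -
  interpret group G by fact
  have "g \<in> g <#\<^bsub>G\<^esub> H"
    using assms subgroup.one_closed[OF assms(2)] by (auto simp: l_coset_def intro!: bexI[of _ "\<one>\<^bsub>G\<^esub>"])
  then show ?thesis unfolding coset_rep_def by (rule LeastI)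
qed

lemma coset_rep_facts:
  assumes "group G" "subgroup H G" "g \<in> carrier G"
  shows "coset_rep G H g \<in> carrier G"
    and "inv\<^bsub>G\<^esub> (coset_rep G H g) \<otimes>\<^bsub>G\<^esub> g \<in> H"
    and "h \<in> H \<Longrightarrow> coset_rep G H (g \<otimes>\<^bsub>G\<^esub> h) = coset_rep G H g"
proof -
  interpret group G by fact
  interpret H: subgroup H G by fact
  obtain k where k: "k \<in> H" "coset_rep G H g = g \<otimes>\<^bsub>G\<^esub> k"
    using coset_rep_in[OF assms] by (auto simp: l_coset_def)
  show 1: "coset_rep G H g \<in> carrier G" using k assms by simp
  have "inv\<^bsub>G\<^esub> (coset_rep G H g) \<otimes>\<^bsub>G\<^esub> g = inv\<^bsub>G\<^esub> k"
    using k assms by (simp add: inv_mult_group m_assoc)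
  then show "inv\<^bsub>G\<^esub> (coset_rep G H g) \<otimes>\<^bsub>G\<^esub> g \<in> H" using k by simp
  show "coset_rep G H (g \<otimes>\<^bsub>G\<^esub> h) = coset_rep G H g" if "h \<in> H"
  proof -
    have "(g \<otimes>\<^bsub>G\<^esub> h) <#\<^bsub>G\<^esub> H = g <#\<^bsub>G\<^esub> H"
    proof (intro equalityI subsetI)
      fix x assume "x \<in> (g \<otimes>\<^bsub>G\<^esub> h) <#\<^bsub>G\<^esub> H"
      then show "x \<in> g <#\<^bsub>G\<^esub> H"
        using that assms by (auto simp: l_coset_def m_assoc intro!: bexI[of _ "h \<otimes>\<^bsub>G\<^esub> _"])
    next
      fix x assume "x \<in> g <#\<^bsub>G\<^esub> H"
      then obtain k where k: "k \<in> H" "x = g \<otimes>\<^bsub>G\<^esub> k" by (auto simp: l_coset_def)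
      have "x = (g \<otimes>\<^bsub>G\<^esub> h) \<otimes>\<^bsub>G\<^esub> (inv\<^bsub>G\<^esub> h \<otimes>\<^bsub>G\<^esub> k)"
      proof -
        have c: "h \<in> carrier G" "k \<in> carrier G" using k that by auto
        then have "h \<otimes>\<^bsub>G\<^esub> (inv\<^bsub>G\<^esub> h \<otimes>\<^bsub>G\<^esub> k) = k" by (simp add: m_assoc[symmetric])
        then show ?thesis using k c assms by (simp add: m_assoc)
      qed
      then show "x \<in> (g \<otimes>\<^bsub>G\<^esub> h) <#\<^bsub>G\<^esub> H" using k that by (auto simp: l_coset_def)
    qed
    then show ?thesis by (simp add: coset_rep_def)
  qed
qed

lemma coset_rep_idem:
  assumes "group G" "subgroup H G" "g \<in> carrier G"
  shows "coset_rep G H (coset_rep G H g) = coset_rep G H g"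
proof -
  obtain h where h: "h \<in> H" "coset_rep G H g = g \<otimes>\<^bsub>G\<^esub> h"
    using coset_rep_in[OF assms] by (auto simp: l_coset_def)
  then show ?thesis using coset_rep_facts(3)[OF assms h(1)] by simp
qed

lemma is_gset_ind:
  assumes G: "group G" "finite (carrier G)" and H: "subgroup H G" and X: "is_gset (subgrp G H) X"
  shows "is_gset G (ind G H X)"
proof -
  interpret group G by fact
  interpret H: subgroup H G by fact
  note rep = coset_rep_facts[OF G(1) H]
  have tc: "t \<in> carrier G" if "t \<in> coset_rep G H ` carrier G" for t
    using that rep(1) by auto
  have ti: "coset_rep G H t = t" if "t \<in> coset_rep G H ` carrier G" for t
    using that coset_rep_idem[OF G(1) H] by auto
  have Xc: "act X h x \<in> pts X" if "h \<in> H" "x \<in> pts X" for h x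
    using X that by (simp add: is_gset_def)
  have Xm: "act X (h \<otimes>\<^bsub>G\<^esub> k) x = act X h (act X k x)" if "h \<in> H" "k \<in> H" "x \<in> pts X" for h k x
    using X that by (simp add: is_gset_def)
  have X1: "act X \<one>\<^bsub>G\<^esub> x = x" if "x \<in> pts X" for x
    using X that by (simp add: is_gset_def)
  have el: "inv\<^bsub>G\<^esub> (coset_rep G H (g \<otimes>\<^bsub>G\<^esub> t)) \<otimes>\<^bsub>G\<^esub> g \<otimes>\<^bsub>G\<^esub> t \<in> H"
    if "g \<in> carrier G" "t \<in> carrier G" for g t
    using rep(1,2)[of "g \<otimes>\<^bsub>G\<^esub> t"] that by (simp add: m_assoc)
  have "pts (ind G H X) = prod_encode ` ((coset_rep G H ` carrier G) \<times> pts X)"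
    by (auto simp: ind_def)
  then have fin: "finite (pts (ind G H X))"
    using G(2) X by (simp add: is_gset_def)
  have act: "act (ind G H X) g (prod_encode (t, x)) = prod_encode (coset_rep G H (g \<otimes>\<^bsub>G\<^esub> t),
      act X (inv\<^bsub>G\<^esub> (coset_rep G H (g \<otimes>\<^bsub>G\<^esub> t)) \<otimes>\<^bsub>G\<^esub> g \<otimes>\<^bsub>G\<^esub> t) x)" for g t x
    by (simp add: ind_def Let_def)
  have pt: "c \<in> pts (ind G H X) \<longleftrightarrow>
      (\<exists>t x. c = prod_encode (t, x) \<and> t \<in> coset_rep G H ` carrier G \<and> x \<in> pts X)" for c
    by (simp add: ind_def)
  have mult: "act (ind G H X) (g \<otimes>\<^bsub>G\<^esub> k) (prod_encode (t, x))
       = act (ind G H X) g (act (ind G H X) k (prod_encode (t, x)))"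
    if g: "g \<in> carrier G" "k \<in> carrier G" and t: "t \<in> carrier G" and x: "x \<in> pts X" for g k t x
  proof -
    define u where "u = coset_rep G H (k \<otimes>\<^bsub>G\<^esub> t)"
    have u: "u \<in> carrier G" and uH: "inv\<^bsub>G\<^esub> u \<otimes>\<^bsub>G\<^esub> k \<otimes>\<^bsub>G\<^esub> t \<in> H"
      using rep(1)[of "k \<otimes>\<^bsub>G\<^esub> t"] el[of k t] g t by (simp_all add: u_def)
    have e: "(g \<otimes>\<^bsub>G\<^esub> u) \<otimes>\<^bsub>G\<^esub> (inv\<^bsub>G\<^esub> u \<otimes>\<^bsub>G\<^esub> k \<otimes>\<^bsub>G\<^esub> t) = g \<otimes>\<^bsub>G\<^esub> k \<otimes>\<^bsub>G\<^esub> t"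
    proof -
      have "(g \<otimes>\<^bsub>G\<^esub> u) \<otimes>\<^bsub>G\<^esub> (inv\<^bsub>G\<^esub> u \<otimes>\<^bsub>G\<^esub> k \<otimes>\<^bsub>G\<^esub> t) = g \<otimes>\<^bsub>G\<^esub> (u \<otimes>\<^bsub>G\<^esub> inv\<^bsub>G\<^esub> u) \<otimes>\<^bsub>G\<^esub> (k \<otimes>\<^bsub>G\<^esub> t)"
        using g t u by (simp only: m_assoc m_closed inv_closed)
      then show ?thesis using g t u by (simp add: m_assoc)
    qed
    define v where "v = coset_rep G H (g \<otimes>\<^bsub>G\<^esub> u)"
    have v: "v \<in> carrier G" and vH: "inv\<^bsub>G\<^esub> v \<otimes>\<^bsub>G\<^esub> g \<otimes>\<^bsub>G\<^esub> u \<in> H"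
      using rep(1)[of "g \<otimes>\<^bsub>G\<^esub> u"] el[of g u] g u by (simp_all add: v_def)
    have v': "coset_rep G H (g \<otimes>\<^bsub>G\<^esub> k \<otimes>\<^bsub>G\<^esub> t) = v"
      using rep(3)[of "g \<otimes>\<^bsub>G\<^esub> u", OF _ uH] g u e by (simp add: v_def)
    have "(inv\<^bsub>G\<^esub> v \<otimes>\<^bsub>G\<^esub> g \<otimes>\<^bsub>G\<^esub> u) \<otimes>\<^bsub>G\<^esub> (inv\<^bsub>G\<^esub> u \<otimes>\<^bsub>G\<^esub> k \<otimes>\<^bsub>G\<^esub> t) = inv\<^bsub>G\<^esub> v \<otimes>\<^bsub>G\<^esub> (g \<otimes>\<^bsub>G\<^esub> k \<otimes>\<^bsub>G\<^esub> t)"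
      using g t u v e by (simp add: m_assoc)
    then have "act X (inv\<^bsub>G\<^esub> v \<otimes>\<^bsub>G\<^esub> (g \<otimes>\<^bsub>G\<^esub> k \<otimes>\<^bsub>G\<^esub> t)) x
      = act X (inv\<^bsub>G\<^esub> v \<otimes>\<^bsub>G\<^esub> g \<otimes>\<^bsub>G\<^esub> u) (act X (inv\<^bsub>G\<^esub> u \<otimes>\<^bsub>G\<^esub> k \<otimes>\<^bsub>G\<^esub> t) x)"
      using Xm[OF vH uH x] by simp
    moreover have "inv\<^bsub>G\<^esub> v \<otimes>\<^bsub>G\<^esub> (g \<otimes>\<^bsub>G\<^esub> k) \<otimes>\<^bsub>G\<^esub> t = inv\<^bsub>G\<^esub> v \<otimes>\<^bsub>G\<^esub> (g \<otimes>\<^bsub>G\<^esub> k \<otimes>\<^bsub>G\<^esub> t)"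
      using g t v by (simp add: m_assoc)
    ultimately show ?thesis
      unfolding act v' by (fold u_def) (simp add: act v_def[symmetric])
  qed
  show ?thesis
    unfolding is_gset_def
  proof (intro conjI ballI fin)
    fix g c assume g: "g \<in> carrier G" and "c \<in> pts (ind G H X)"
    then obtain t x where c: "c = prod_encode (t, x)" "t \<in> coset_rep G H ` carrier G" "x \<in> pts X"
      by (auto simp: pt)
    then show "act (ind G H X) g c \<in> pts (ind G H X)"
      using el[OF g tc[OF c(2)]] Xc g tc by (auto simp: act pt)
  next
    fix c assume "c \<in> pts (ind G H X)"
    then obtain t x where c: "c = prod_encode (t, x)" "t \<in> coset_rep G H ` carrier G" "x \<in> pts X"
      by (auto simp: pt)
    then show "act (ind G H X) \<one>\<^bsub>G\<^esub> c = c"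
      using tc[OF c(2)] ti[OF c(2)] X1 by (simp add: act)
  next
    fix g k c assume g: "g \<in> carrier G" "k \<in> carrier G" and "c \<in> pts (ind G H X)"
    then obtain t x where c: "c = prod_encode (t, x)" "t \<in> coset_rep G H ` carrier G" "x \<in> pts X"
      by (auto simp: pt)
    show "act (ind G H X) (g \<otimes>\<^bsub>G\<^esub> k) c = act (ind G H X) g (act (ind G H X) k c)"
      unfolding c(1) by (rule mult[OF g tc[OF c(2)] c(3)])
  qed
qed

lemma gmap_ind:
  assumes G: "group G" "finite (carrier G)" and H: "subgroup H G" and f: "gmap (subgrp G H) X Y f"
  shows "gmap G (ind G H X) (ind G H Y) (ind_map f)"
proof -
  interpret group G by fact
  note rep = coset_rep_facts[OF G(1) H]
  have f': "f x \<in> pts Y" if "x \<in> pts X" for x using f that by (auto simp: gmap_def)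
  have fe: "f (act X h x) = act Y h (f x)" if "x \<in> pts X" "h \<in> H" for h x
    using f that by (auto simp: gmap_def)
  show ?thesis
    unfolding gmap_def
  proof (intro conjI ballI)
    show "is_gset G (ind G H X)" "is_gset G (ind G H Y)"
      using f is_gset_ind[OF G H] by (auto simp: gmap_def)
    show "ind_map f \<in> pts (ind G H X) \<rightarrow> pts (ind G H Y)"
      using f' by (auto simp: ind_def ind_map_def)
    fix g c assume g: "g \<in> carrier G" "c \<in> pts (ind G H X)"
    then obtain t x where c: "c = prod_encode (t, x)" "t \<in> coset_rep G H ` carrier G" "x \<in> pts X"
      by (auto simp: ind_def)
    have t: "t \<in> carrier G" using c(2) rep(1) by auto
    then have "inv\<^bsub>G\<^esub> (coset_rep G H (g \<otimes>\<^bsub>G\<^esub> t)) \<otimes>\<^bsub>G\<^esub> g \<otimes>\<^bsub>G\<^esub> t \<in> H"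
      using rep(1,2)[of "g \<otimes>\<^bsub>G\<^esub> t"] g by (simp add: m_assoc)
    then show "ind_map f (act (ind G H X) g c) = act (ind G H Y) g (ind_map f c)"
      using fe[OF c(3)] by (simp add: c(1) ind_def ind_map_def Let_def)
  qed
qed

lemma is_gset_empty: "is_gset G \<lparr>pts = {}, act = a\<rparr>"
  by (simp add: is_gset_def)

context tambara
begin

lemma map_closed:
  assumes "gmap G X Y f"
  shows "b \<in> carrier (tval T Y) \<Longrightarrow> tres T X Y f b \<in> carrier (tval T X)"
    and "a \<in> carrier (tval T X) \<Longrightarrow> ttr T X Y f a \<in> carrier (tval T Y)"
    and "a \<in> carrier (tval T X) \<Longrightarrow> tnm T X Y f a \<in> carrier (tval T Y)"
  using res_hom[OF assms] tr_hom[OF assms] nm_hom[OF assms]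
  by (auto simp: ring_hom_def hom_def)

lemma tr_zero:
  assumes f: "gmap G X Y f"
  shows "ttr T X Y f \<zero>\<^bsub>tval T X\<^esub> = \<zero>\<^bsub>tval T Y\<^esub>"
proof -
  have X: "cring (tval T X)" and Y: "cring (tval T Y)" using f val_cring by (auto simp: gmap_def)
  interpret X: cring "tval T X" by fact
  interpret Y: cring "tval T Y" by fact
  show ?thesis
    using hom_one[OF tr_hom[OF f] X.add.is_group Y.add.is_group] by simp
qed

lemma coproduct_transfers:
  assumes W: "is_coproduct G X Y W i j" and a: "a \<in> carrier (tval T X)" and b: "b \<in> carrier (tval T Y)"
  shows "tres T X W i (ttr T X W i a \<oplus>\<^bsub>tval T W\<^esub> ttr T Y W j b) = a"
    and "tres T Y W j (ttr T X W i a \<oplus>\<^bsub>tval T W\<^esub> ttr T Y W j b) = b"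
proof -
  have i: "gmap G X W i" and j: "gmap G Y W j" using W by (auto simp: is_coproduct_def)
  have X: "is_gset G X" and Y: "is_gset G Y" and Wg: "is_gset G W" using i j by (auto simp: gmap_def)
  interpret RX: cring "tval T X" by (rule val_cring[OF X])
  interpret RY: cring "tval T Y" by (rule val_cring[OF Y])
  interpret RW: cring "tval T W" by (rule val_cring[OF Wg])
  let ?E = "\<lparr>pts = {}, act = \<lambda>_ x. x\<rparr>"
  have E: "is_gset G ?E" by (rule is_gset_empty)
  have self: "is_pullback G Z Z Z W id id k k" if "gmap G Z W k" "inj_on k (pts Z)" for Z k
    using that by (auto simp: is_pullback_def gmap_def inj_on_def)
  have disj: "is_pullback G ?E Z Z' W id id k k'"
    if "gmap G Z W k" "gmap G Z' W k'" "k ` pts Z \<inter> k' ` pts Z' = {}" for Z Z' k k'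
    using that E by (fastforce simp: is_pullback_def gmap_def)
  have same: "tres T Z W k (ttr T Z W k x) = x"
    if "gmap G Z W k" "inj_on k (pts Z)" "x \<in> carrier (tval T Z)" for Z k x
    using tr_base_change[OF self[OF that(1,2)] that(3)] map_id that by (auto simp: gmap_def)
  have other: "tres T Z' W k' (ttr T Z W k x) = \<zero>\<^bsub>tval T Z'\<^esub>"
    if k: "gmap G Z W k" "gmap G Z' W k'" "k ` pts Z \<inter> k' ` pts Z' = {}" and x: "x \<in> carrier (tval T Z)"
    for Z Z' k k' x
  proof -
    note pb = disj[OF k]
    then have m: "gmap G ?E Z id" "gmap G ?E Z' id" by (auto simp: is_pullback_def)
    have "tres T ?E Z id x \<in> carrier (tval T ?E)" using map_closed(1)[OF m(1) x] .
    then have "tres T ?E Z id x = \<zero>\<^bsub>tval T ?E\<^esub>" using val_empty[OF E] by simp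
    then show ?thesis using tr_base_change[OF pb x] tr_zero[OF m(2)] by simp
  qed
  have inj: "inj_on i (pts X)" "inj_on j (pts Y)" and dis: "i ` pts X \<inter> j ` pts Y = {}" "j ` pts Y \<inter> i ` pts X = {}"
    using W by (auto simp: is_coproduct_def)
  note tc = map_closed(2)[OF i a] map_closed(2)[OF j b]
  show "tres T X W i (ttr T X W i a \<oplus>\<^bsub>tval T W\<^esub> ttr T Y W j b) = a"
    using ring_hom_add[OF res_hom[OF i] tc] same[OF i inj(1) a] other[OF j i dis(2) b] a by simp
  show "tres T Y W j (ttr T X W i a \<oplus>\<^bsub>tval T W\<^esub> ttr T Y W j b) = b"
    using ring_hom_add[OF res_hom[OF j] tc] same[OF j inj(2) b] other[OF i j dis(1) a] b by simp
qed

lemma coproduct_ext: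
  assumes "is_coproduct G X Y W i j" "c \<in> carrier (tval T W)" "d \<in> carrier (tval T W)"
    "tres T X W i c = tres T X W i d" "tres T Y W j c = tres T Y W j d"
  shows "c = d"
  using bij_betw_imp_inj_on[OF val_coproduct[OF assms(1)]] assms(2-5) by (auto dest: inj_onD)

end

text \<open>
  The norm is constructed as the set of all formal expressions modulo the relation of having the same
  value in all tests \<open>(T, f) \<in> K\<close>.
\<close>

primrec term_wf :: "nat monoid \<Rightarrow> nat set \<Rightarrow> 'a tambara_data \<Rightarrow> gset \<Rightarrow> 'a tambara_term \<Rightarrow> bool" where
  "term_wf G H R Z (Gen X a) \<longleftrightarrow> Z = ind G H X \<and> is_gset (subgrp G H) X \<and> a \<in> carrier (tval R X)"
| "term_wf G H R Z (Zero X) \<longleftrightarrow> Z = X \<and> is_gset G X"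
| "term_wf G H R Z (One X) \<longleftrightarrow> Z = X \<and> is_gset G X"
| "term_wf G H R Z (Neg X t) \<longleftrightarrow> Z = X \<and> is_gset G X \<and> term_wf G H R X t"
| "term_wf G H R Z (Add X t u) \<longleftrightarrow> Z = X \<and> is_gset G X \<and> term_wf G H R X t \<and> term_wf G H R X u"
| "term_wf G H R Z (Mul X t u) \<longleftrightarrow> Z = X \<and> is_gset G X \<and> term_wf G H R X t \<and> term_wf G H R X u"
| "term_wf G H R Z (Res X Y g t) \<longleftrightarrow> Z = X \<and> gmap G X Y g \<and> term_wf G H R Y t"
| "term_wf G H R Z (Tr X Y g t) \<longleftrightarrow> Z = Y \<and> gmap G X Y g \<and> term_wf G H R X t"
| "term_wf G H R Z (Nm X Y g t) \<longleftrightarrow> Z = Y \<and> gmap G X Y g \<and> term_wf G H R X t"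

primrec term_val :: "'b tambara_data \<Rightarrow> (gset \<Rightarrow> 'a \<Rightarrow> 'b) \<Rightarrow> 'a tambara_term \<Rightarrow> 'b" where
  "term_val T f (Gen X a) = f X a"
| "term_val T f (Zero X) = \<zero>\<^bsub>tval T X\<^esub>"
| "term_val T f (One X) = \<one>\<^bsub>tval T X\<^esub>"
| "term_val T f (Neg X t) = \<ominus>\<^bsub>tval T X\<^esub> term_val T f t"
| "term_val T f (Add X t u) = term_val T f t \<oplus>\<^bsub>tval T X\<^esub> term_val T f u"
| "term_val T f (Mul X t u) = term_val T f t \<otimes>\<^bsub>tval T X\<^esub> term_val T f u"
| "term_val T f (Res X Y g t) = tres T X Y g (term_val T f t)"
| "term_val T f (Tr X Y g t) = ttr T X Y g (term_val T f t)"
| "term_val T f (Nm X Y g t) = tnm T X Y g (term_val T f t)"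

definition term_class ::
    "nat monoid \<Rightarrow> nat set \<Rightarrow> 'a tambara_data \<Rightarrow> ('b tambara_data \<times> (gset \<Rightarrow> 'a \<Rightarrow> 'b)) set
      \<Rightarrow> gset \<Rightarrow> 'a tambara_term \<Rightarrow> 'a tambara_term set" where
  "term_class G H R K X t =
     {u. term_wf G H R X u \<and> (\<forall>(T, f)\<in>K. term_val T f u = term_val T f t)}"

abbreviation term_rep :: "'a tambara_term set \<Rightarrow> 'a tambara_term" where
  "term_rep c \<equiv> (SOME t. t \<in> c)"

definition term_quotient ::
    "nat monoid \<Rightarrow> nat set \<Rightarrow> 'a tambara_data \<Rightarrow> ('b tambara_data \<times> (gset \<Rightarrow> 'a \<Rightarrow> 'b)) set
      \<Rightarrow> 'a norm_val tambara_data" where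
  "term_quotient G H R K = \<lparr>
     tval = (\<lambda>X. \<lparr>
       carrier = {term_class G H R K X t | t. term_wf G H R X t},
       monoid.mult = (\<lambda>c d. term_class G H R K X (Mul X (term_rep c) (term_rep d))),
       one = term_class G H R K X (One X),
       zero = term_class G H R K X (Zero X),
       add = (\<lambda>c d. term_class G H R K X (Add X (term_rep c) (term_rep d))) \<rparr>),
     tres = (\<lambda>X Y g c. term_class G H R K X (Res X Y g (term_rep c))),
     ttr = (\<lambda>X Y g c. term_class G H R K Y (Tr X Y g (term_rep c))),
     tnm = (\<lambda>X Y g c. term_class G H R K Y (Nm X Y g (term_rep c))) \<rparr>"

text \<open>Of \<open>R\<close> we only need that it is closed under its operations.\<close>

locale norm_tests =
  fixes G :: "nat monoid" and H :: "nat set" and R :: "'a tambara_data"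
    and K :: "('b tambara_data \<times> (gset \<Rightarrow> 'a \<Rightarrow> 'b)) set"
  assumes G: "group G" "finite (carrier G)" and H: "subgroup H G"
    and ring_closed: "is_gset (subgrp G H) X \<Longrightarrow> \<one>\<^bsub>tval R X\<^esub> \<in> carrier (tval R X)
        \<and> (\<forall>a\<in>carrier (tval R X). \<forall>b\<in>carrier (tval R X).
             a \<oplus>\<^bsub>tval R X\<^esub> b \<in> carrier (tval R X) \<and> a \<otimes>\<^bsub>tval R X\<^esub> b \<in> carrier (tval R X))"
    and maps_closed: "gmap (subgrp G H) X Y g
        \<Longrightarrow> (\<forall>b\<in>carrier (tval R Y). tres R X Y g b \<in> carrier (tval R X))
          \<and> (\<forall>a\<in>carrier (tval R X). ttr R X Y g a \<in> carrier (tval R Y) \<and> tnm R X Y g a \<in> carrier (tval R Y))"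
    and test: "(T, f) \<in> K \<Longrightarrow> tambara G T \<and> tambara_hom (subgrp G H) R (restr G H T) f"
begin

abbreviation "twf \<equiv> term_wf G H R"
abbreviation "cls \<equiv> term_class G H R K"
abbreviation "Q \<equiv> term_quotient G H R K"
abbreviation "cval T f c \<equiv> term_val T f (term_rep c)"

lemma wf_gset: "twf X t \<Longrightarrow> is_gset G X"
  using is_gset_ind[OF G H] by (cases t) (auto simp: gmap_def)

lemma val_closed:
  assumes "(T, f) \<in> K" "twf X t"
  shows "term_val T f t \<in> carrier (tval T X)"
proof -
  interpret tambara G T using test[OF assms(1)] by simp
  have f: "f X a \<in> carrier (tval T (ind G H X))"
    if "is_gset (subgrp G H) X" "a \<in> carrier (tval R X)" for X a
    using test[OF assms(1)] that by (auto simp: tambara_hom_def restr_def ring_hom_def)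
  have r: "ring (tval T X)" if "is_gset G X" for X using val_cring[OF that] by (simp add: cring_def)
  show ?thesis
    using assms(2)
    by (induction t arbitrary: X)
      (auto simp: f map_closed
        intro!: ring.ring_simprules(1,4,5,6) ring.ring_simprules(2) ring.ring_simprules(3) r)
qed

lemma rep_class:
  assumes "twf X t"
  shows "twf X (term_rep (cls X t))" and "(T, f) \<in> K \<Longrightarrow> cval T f (cls X t) = term_val T f t"
proof -
  have "t \<in> cls X t" using assms by (simp add: term_class_def)
  then have "term_rep (cls X t) \<in> cls X t" by (rule someI[where P = "\<lambda>u. u \<in> cls X t"])
  then show "twf X (term_rep (cls X t))" and "(T, f) \<in> K \<Longrightarrow> cval T f (cls X t) = term_val T f t"
    by (auto simp: term_class_def)
qed

lemma class_eqI: "(\<And>T f. (T, f) \<in> K \<Longrightarrow> term_val T f t = term_val T f u) \<Longrightarrow> cls X t = cls X u"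
  by (auto simp: term_class_def)

lemma carrier_Q: "carrier (tval Q X) = {cls X t | t. twf X t}"
  by (simp add: term_quotient_def)

lemma classI: "twf X t \<Longrightarrow> cls X t \<in> carrier (tval Q X)"
  by (auto simp: carrier_Q)

lemma repQ:
  assumes "c \<in> carrier (tval Q X)"
  shows "twf X (term_rep c)" and "cls X (term_rep c) = c" and "is_gset G X"
proof -
  obtain t where t: "twf X t" "c = cls X t" using assms by (auto simp: carrier_Q)
  show "twf X (term_rep c)" using rep_class(1)[OF t(1)] t(2) by simp
  show "cls X (term_rep c) = c" unfolding t(2) by (rule class_eqI) (rule rep_class(2)[OF t(1)])
  show "is_gset G X" by (rule wf_gset[OF t(1)])
qed

lemma Q_ext:
  assumes "c \<in> carrier (tval Q X)" "d \<in> carrier (tval Q X)"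
    and "\<And>T f. (T, f) \<in> K \<Longrightarrow> cval T f c = cval T f d"
  shows "c = d"
  using class_eqI[of "term_rep c" "term_rep d" X, OF assms(3)] repQ(2)[OF assms(1)] repQ(2)[OF assms(2)]
  by simp

lemma Q_ops:
  shows "\<one>\<^bsub>tval Q X\<^esub> = cls X (One X)" and "\<zero>\<^bsub>tval Q X\<^esub> = cls X (Zero X)"
    and "c \<oplus>\<^bsub>tval Q X\<^esub> d = cls X (Add X (term_rep c) (term_rep d))"
    and "c \<otimes>\<^bsub>tval Q X\<^esub> d = cls X (Mul X (term_rep c) (term_rep d))"
    and "tres Q X Y g c = cls X (Res X Y g (term_rep c))"
    and "ttr Q X Y g c = cls Y (Tr X Y g (term_rep c))"
    and "tnm Q X Y g c = cls Y (Nm X Y g (term_rep c))"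
  by (simp_all add: term_quotient_def)

lemma Q_closed:
  shows "is_gset G X \<Longrightarrow> \<one>\<^bsub>tval Q X\<^esub> \<in> carrier (tval Q X)"
    and "is_gset G X \<Longrightarrow> \<zero>\<^bsub>tval Q X\<^esub> \<in> carrier (tval Q X)"
    and "\<lbrakk>c \<in> carrier (tval Q X); d \<in> carrier (tval Q X)\<rbrakk> \<Longrightarrow> c \<oplus>\<^bsub>tval Q X\<^esub> d \<in> carrier (tval Q X)"
    and "\<lbrakk>c \<in> carrier (tval Q X); d \<in> carrier (tval Q X)\<rbrakk> \<Longrightarrow> c \<otimes>\<^bsub>tval Q X\<^esub> d \<in> carrier (tval Q X)"
    and "\<lbrakk>gmap G X Y g; b \<in> carrier (tval Q Y)\<rbrakk> \<Longrightarrow> tres Q X Y g b \<in> carrier (tval Q X)"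
    and "\<lbrakk>gmap G X Y g; c \<in> carrier (tval Q X)\<rbrakk> \<Longrightarrow> ttr Q X Y g c \<in> carrier (tval Q Y)"
    and "\<lbrakk>gmap G X Y g; c \<in> carrier (tval Q X)\<rbrakk> \<Longrightarrow> tnm Q X Y g c \<in> carrier (tval Q Y)"
  unfolding Q_ops using repQ(1,3)[of c X] repQ(1)[of d X] repQ(1)[of b Y] by (auto intro!: classI)

lemma cval_ops:
  assumes k: "(T, f) \<in> K"
  shows "is_gset G X \<Longrightarrow> cval T f \<one>\<^bsub>tval Q X\<^esub> = \<one>\<^bsub>tval T X\<^esub>"
    and "is_gset G X \<Longrightarrow> cval T f \<zero>\<^bsub>tval Q X\<^esub> = \<zero>\<^bsub>tval T X\<^esub>"
    and "\<lbrakk>c \<in> carrier (tval Q X); d \<in> carrier (tval Q X)\<rbrakk>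
       \<Longrightarrow> cval T f (c \<oplus>\<^bsub>tval Q X\<^esub> d) = cval T f c \<oplus>\<^bsub>tval T X\<^esub> cval T f d"
    and "\<lbrakk>c \<in> carrier (tval Q X); d \<in> carrier (tval Q X)\<rbrakk>
       \<Longrightarrow> cval T f (c \<otimes>\<^bsub>tval Q X\<^esub> d) = cval T f c \<otimes>\<^bsub>tval T X\<^esub> cval T f d"
    and "\<lbrakk>gmap G X Y g; b \<in> carrier (tval Q Y)\<rbrakk> \<Longrightarrow> cval T f (tres Q X Y g b) = tres T X Y g (cval T f b)"
    and "\<lbrakk>gmap G X Y g; c \<in> carrier (tval Q X)\<rbrakk> \<Longrightarrow> cval T f (ttr Q X Y g c) = ttr T X Y g (cval T f c)"
    and "\<lbrakk>gmap G X Y g; c \<in> carrier (tval Q X)\<rbrakk> \<Longrightarrow> cval T f (tnm Q X Y g c) = tnm T X Y g (cval T f c)"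
  unfolding Q_ops using repQ(1,3)[of c X] repQ(1)[of d X] repQ(1)[of b Y]
  by (simp_all add: rep_class(2)[OF _ k])

lemma cval_closed: "\<lbrakk>(T, f) \<in> K; c \<in> carrier (tval Q X)\<rbrakk> \<Longrightarrow> cval T f c \<in> carrier (tval T X)"
  using val_closed repQ(1) by blast

lemma cring_Q:
  assumes X: "is_gset G X"
  shows "cring (tval Q X)"
proof -
  have r: "cring (tval T X)" if "(T, f) \<in> K" for T f
    using tambara.val_cring[OF conjunct1[OF test[OF that]] X] .
  have ar: "abelian_monoid (tval T X)" "abelian_group (tval T X)" "comm_monoid (tval T X)" "ring (tval T X)"
    "monoid (tval T X)"
    if "(T, f) \<in> K" for T f
    using r[OF that] by (auto simp: cring_def ring_def abelian_group_def)
  note ops = cval_ops cval_closed X Q_closed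
  have neg: "\<exists>d\<in>carrier (tval Q X). d \<oplus>\<^bsub>tval Q X\<^esub> c = \<zero>\<^bsub>tval Q X\<^esub>" if c: "c \<in> carrier (tval Q X)" for c
  proof -
    let ?d = "cls X (Neg X (term_rep c))"
    have w: "twf X (Neg X (term_rep c))" using repQ[OF c] by simp
    have d: "?d \<in> carrier (tval Q X)" using classI[OF w] .
    have "?d \<oplus>\<^bsub>tval Q X\<^esub> c = \<zero>\<^bsub>tval Q X\<^esub>"
      by (rule Q_ext[of _ X])
        (simp_all add: ops c d rep_class(2)[OF w] abelian_group.l_neg[OF ar(2)] val_closed repQ[OF c])
    then show ?thesis using d by blast
  qed
  show ?thesis
  proof (intro cringI abelian_groupI comm_monoidI)
    show "\<exists>d\<in>carrier (tval Q X). d \<oplus>\<^bsub>tval Q X\<^esub> c = \<zero>\<^bsub>tval Q X\<^esub>" if "c \<in> carrier (tval Q X)" for c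
      by (rule neg[OF that])
  next
    fix a b c assume abc: "a \<in> carrier (tval Q X)" "b \<in> carrier (tval Q X)" "c \<in> carrier (tval Q X)"
    show "a \<oplus>\<^bsub>tval Q X\<^esub> b \<oplus>\<^bsub>tval Q X\<^esub> c = a \<oplus>\<^bsub>tval Q X\<^esub> (b \<oplus>\<^bsub>tval Q X\<^esub> c)"
      by (rule Q_ext[of _ X]) (simp_all add: ops abc abelian_monoid.a_assoc[OF ar(1)])
    show "a \<otimes>\<^bsub>tval Q X\<^esub> b \<otimes>\<^bsub>tval Q X\<^esub> c = a \<otimes>\<^bsub>tval Q X\<^esub> (b \<otimes>\<^bsub>tval Q X\<^esub> c)"
      by (rule Q_ext[of _ X]) (simp_all add: ops abc monoid.m_assoc[OF ar(5)])
    show "(a \<oplus>\<^bsub>tval Q X\<^esub> b) \<otimes>\<^bsub>tval Q X\<^esub> c = a \<otimes>\<^bsub>tval Q X\<^esub> c \<oplus>\<^bsub>tval Q X\<^esub> b \<otimes>\<^bsub>tval Q X\<^esub> c"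
      by (rule Q_ext[of _ X]) (simp_all add: ops abc ring.ring_simprules(13)[OF ar(4)])
  next
    fix a b assume ab: "a \<in> carrier (tval Q X)" "b \<in> carrier (tval Q X)"
    show "a \<oplus>\<^bsub>tval Q X\<^esub> b = b \<oplus>\<^bsub>tval Q X\<^esub> a"
      by (rule Q_ext[of _ X]) (simp_all add: ops ab abelian_monoid.a_comm[OF ar(1)])
    show "a \<otimes>\<^bsub>tval Q X\<^esub> b = b \<otimes>\<^bsub>tval Q X\<^esub> a"
      by (rule Q_ext[of _ X]) (simp_all add: ops ab comm_monoid.m_comm[OF ar(3)])
  next
    fix a assume a: "a \<in> carrier (tval Q X)"
    show "\<zero>\<^bsub>tval Q X\<^esub> \<oplus>\<^bsub>tval Q X\<^esub> a = a"
      by (rule Q_ext[of _ X]) (simp_all add: ops a abelian_monoid.l_zero[OF ar(1)])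
    show "\<one>\<^bsub>tval Q X\<^esub> \<otimes>\<^bsub>tval Q X\<^esub> a = a"
      by (rule Q_ext[of _ X]) (simp_all add: ops a monoid.l_one[OF ar(5)])
  qed (simp_all add: X Q_closed)
qed

lemma tambara_Q: "tambara G Q"
proof (rule tambara.intro)
  note tam = conjunct1[OF test]
  note ops = cval_ops cval_closed Q_closed
  show "cring (tval Q X)" if "is_gset G X" for X by (rule cring_Q[OF that])
  show "tres Q X Y g \<in> ring_hom (tval Q Y) (tval Q X)" if g: "gmap G X Y g" for X Y g
  proof -
    have XY: "is_gset G X" "is_gset G Y" using g by (auto simp: gmap_def)
    have h: "tres T X Y g \<in> ring_hom (tval T Y) (tval T X)" if "(T, f) \<in> K" for T f
      using tambara.res_hom[OF tam[OF that] g] .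
    show ?thesis
    proof (rule ring_hom_memI)
      fix x y assume xy: "x \<in> carrier (tval Q Y)" "y \<in> carrier (tval Q Y)"
      show "tres Q X Y g (x \<otimes>\<^bsub>tval Q Y\<^esub> y) = tres Q X Y g x \<otimes>\<^bsub>tval Q X\<^esub> tres Q X Y g y"
        by (rule Q_ext[of _ X]) (simp_all add: ops xy g ring_hom_mult[OF h])
      show "tres Q X Y g (x \<oplus>\<^bsub>tval Q Y\<^esub> y) = tres Q X Y g x \<oplus>\<^bsub>tval Q X\<^esub> tres Q X Y g y"
        by (rule Q_ext[of _ X]) (simp_all add: ops xy g ring_hom_add[OF h])
    next
      show "tres Q X Y g \<one>\<^bsub>tval Q Y\<^esub> = \<one>\<^bsub>tval Q X\<^esub>"
        by (rule Q_ext[of _ X]) (simp_all add: ops XY g ring_hom_one[OF h])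
    qed (simp add: ops g)
  qed
  show "ttr Q X Y g \<in> hom (add_monoid (tval Q X)) (add_monoid (tval Q Y))" if g: "gmap G X Y g" for X Y g
  proof -
    have h: "ttr T X Y g \<in> hom (add_monoid (tval T X)) (add_monoid (tval T Y))" if "(T, f) \<in> K" for T f
      using tambara.tr_hom[OF tam[OF that] g] .
    have h': "ttr T X Y g (x \<oplus>\<^bsub>tval T X\<^esub> y) = ttr T X Y g x \<oplus>\<^bsub>tval T Y\<^esub> ttr T X Y g y"
      if "(T, f) \<in> K" "x \<in> carrier (tval T X)" "y \<in> carrier (tval T X)" for T f x y
      using hom_mult[OF h[OF that(1)], of x y] that by simp
    have "ttr Q X Y g (x \<oplus>\<^bsub>tval Q X\<^esub> y) = ttr Q X Y g x \<oplus>\<^bsub>tval Q Y\<^esub> ttr Q X Y g y"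
      if xy: "x \<in> carrier (tval Q X)" "y \<in> carrier (tval Q X)" for x y
      by (rule Q_ext[of _ Y]) (simp_all add: ops xy g h')
    then show ?thesis by (auto simp: hom_def Q_closed g)
  qed
  show "tnm Q X Y g \<in> hom (tval Q X) (tval Q Y)" if g: "gmap G X Y g" for X Y g
  proof -
    have h: "tnm T X Y g \<in> hom (tval T X) (tval T Y)" if "(T, f) \<in> K" for T f
      using tambara.nm_hom[OF tam[OF that] g] .
    have "tnm Q X Y g (x \<otimes>\<^bsub>tval Q X\<^esub> y) = tnm Q X Y g x \<otimes>\<^bsub>tval Q Y\<^esub> tnm Q X Y g y"
      if xy: "x \<in> carrier (tval Q X)" "y \<in> carrier (tval Q X)" for x y
      by (rule Q_ext[of _ Y]) (simp_all add: ops xy g hom_mult[OF h])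
    then show ?thesis by (auto simp: hom_def Q_closed g)
  qed
  show "tnm Q X Y g \<one>\<^bsub>tval Q X\<^esub> = \<one>\<^bsub>tval Q Y\<^esub>" if g: "gmap G X Y g" for X Y g
  proof -
    have XY: "is_gset G X" "is_gset G Y" using g by (auto simp: gmap_def)
    show ?thesis by (rule Q_ext[of _ Y]) (simp_all add: ops XY g tambara.nm_one[OF tam])
  qed
  show "(\<forall>b\<in>carrier (tval Q Y). tres Q X Y g b = tres Q X Y g' b)
      \<and> (\<forall>a\<in>carrier (tval Q X). ttr Q X Y g a = ttr Q X Y g' a \<and> tnm Q X Y g a = tnm Q X Y g' a)"
    if g: "gmap G X Y g" and e: "\<And>x. x \<in> pts X \<Longrightarrow> g x = g' x" for X Y g g'
  proof -
    have g': "gmap G X Y g'" using g e by (auto simp: gmap_def Pi_iff is_gset_def)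
    have c: "tres T X Y g (cval T f b) = tres T X Y g' (cval T f b)"
      if "(T, f) \<in> K" "b \<in> carrier (tval Q Y)" for T f b
      using tambara.map_cong[OF tam[OF that(1)] g e] cval_closed[OF that] by blast
    have c': "ttr T X Y g (cval T f a) = ttr T X Y g' (cval T f a)"
      "tnm T X Y g (cval T f a) = tnm T X Y g' (cval T f a)"
      if "(T, f) \<in> K" "a \<in> carrier (tval Q X)" for T f a
      using tambara.map_cong[OF tam[OF that(1)] g e] cval_closed[OF that] by blast+
    show ?thesis
    proof (intro conjI ballI)
      fix b assume b: "b \<in> carrier (tval Q Y)"
      show "tres Q X Y g b = tres Q X Y g' b"
        by (rule Q_ext[of _ X]) (simp_all add: ops b g g' c)
    next
      fix a assume a: "a \<in> carrier (tval Q X)"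
      show "ttr Q X Y g a = ttr Q X Y g' a"
        by (rule Q_ext[of _ Y]) (simp_all add: ops a g g' c')
      show "tnm Q X Y g a = tnm Q X Y g' a"
        by (rule Q_ext[of _ Y]) (simp_all add: ops a g g' c')
    qed
  qed
  show "tres Q X X id a = a \<and> ttr Q X X id a = a \<and> tnm Q X X id a = a"
    if X: "is_gset G X" and a: "a \<in> carrier (tval Q X)" for X a
  proof -
    have g: "gmap G X X id" using X by (auto simp: gmap_def)
    have i: "tres T X X id x = x" "ttr T X X id x = x" "tnm T X X id x = x"
      if "(T, f) \<in> K" "x \<in> carrier (tval T X)" for T f x
      using tambara.map_id[OF tam[OF that(1)] X that(2)] by auto
    show ?thesis
      by (intro conjI; rule Q_ext[of _ X]) (simp_all add: ops a g i)
  qed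
  show "tres Q X Z (g \<circ> f) c = tres Q X Y f (tres Q Y Z g c)"
    if f: "gmap G X Y f" and g: "gmap G Y Z g" and c: "c \<in> carrier (tval Q Z)" for X Y Z f g c
  proof -
    have gf: "gmap G X Z (g \<circ> f)" using f g by (auto simp: gmap_def Pi_iff)
    show ?thesis
      by (rule Q_ext[of _ X]) (simp_all add: ops f g c gf tambara.res_comp[OF tam f g])
  qed
  show "ttr Q X Z (g \<circ> f) c = ttr Q Y Z g (ttr Q X Y f c)"
    if f: "gmap G X Y f" and g: "gmap G Y Z g" and c: "c \<in> carrier (tval Q X)" for X Y Z f g c
  proof -
    have gf: "gmap G X Z (g \<circ> f)" using f g by (auto simp: gmap_def Pi_iff)
    show ?thesis
      by (rule Q_ext[of _ Z]) (simp_all add: ops f g c gf tambara.tr_comp[OF tam f g])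
  qed
  show "tnm Q X Z (g \<circ> f) c = tnm Q Y Z g (tnm Q X Y f c)"
    if f: "gmap G X Y f" and g: "gmap G Y Z g" and c: "c \<in> carrier (tval Q X)" for X Y Z f g c
  proof -
    have gf: "gmap G X Z (g \<circ> f)" using f g by (auto simp: gmap_def Pi_iff)
    show ?thesis
      by (rule Q_ext[of _ Z]) (simp_all add: ops f g c gf tambara.nm_comp[OF tam f g])
  qed
  show "tres Q Y Z g (ttr Q X Z f a) = ttr Q W Y q (tres Q W X p a)"
    and "tres Q Y Z g (tnm Q X Z f a) = tnm Q W Y q (tres Q W X p a)"
    if pb: "is_pullback G W X Y Z p q f g" and a: "a \<in> carrier (tval Q X)" for W X Y Z p q f g a
  proof -
    have m: "gmap G W X p" "gmap G W Y q" "gmap G X Z f" "gmap G Y Z g"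
      using pb by (auto simp: is_pullback_def)
    show "tres Q Y Z g (ttr Q X Z f a) = ttr Q W Y q (tres Q W X p a)"
      by (rule Q_ext[of _ Y]) (simp_all add: ops m a tambara.tr_base_change[OF tam pb])
    show "tres Q Y Z g (tnm Q X Z f a) = tnm Q W Y q (tres Q W X p a)"
      by (rule Q_ext[of _ Y]) (simp_all add: ops m a tambara.nm_base_change[OF tam pb])
  qed
  show "tnm Q Y Z g (ttr Q X Y f a) = ttr Q B Z q (tnm Q A B p (tres Q A X e a))"
    if ex: "is_exponential G X Y Z A B f g e p q w" and a: "a \<in> carrier (tval Q X)"
    for X Y Z A B f g e p q w a
  proof -
    have m: "gmap G X Y f" "gmap G Y Z g" "gmap G A X e" "gmap G A B p" "gmap G B Z q"
      using ex by (auto simp: is_exponential_def is_pullback_def)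
    show ?thesis
      by (rule Q_ext[of _ Z]) (simp_all add: ops m a tambara.distributive[OF tam ex])
  qed
  show "bij_betw (\<lambda>c. (tres Q X W i c, tres Q Y W j c)) (carrier (tval Q W))
      (carrier (tval Q X) \<times> carrier (tval Q Y))"
    if W: "is_coproduct G X Y W i j" for X Y W i j
  proof -
    have m: "gmap G X W i" "gmap G Y W j" using W by (auto simp: is_coproduct_def)
    show ?thesis
      unfolding bij_betw_def
    proof (intro conjI equalityI subsetI)
      show "inj_on (\<lambda>c. (tres Q X W i c, tres Q Y W j c)) (carrier (tval Q W))"
      proof (rule inj_onI)
        fix c d assume cd: "c \<in> carrier (tval Q W)" "d \<in> carrier (tval Q W)"
          and e: "(tres Q X W i c, tres Q Y W j c) = (tres Q X W i d, tres Q Y W j d)"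
        show "c = d"
        proof (rule Q_ext[OF cd])
          fix T f assume k: "(T, f) \<in> K"
          have "cval T f (tres Q X W i c) = cval T f (tres Q X W i d)"
            and "cval T f (tres Q Y W j c) = cval T f (tres Q Y W j d)" using e by simp_all
          then have "tres T X W i (cval T f c) = tres T X W i (cval T f d)"
            and "tres T Y W j (cval T f c) = tres T Y W j (cval T f d)"
            by (simp_all add: cval_ops[OF k] m cd)
          then show "cval T f c = cval T f d"
            using tambara.coproduct_ext[OF tam[OF k] W] cval_closed[OF k] cd by blast
        qed
      qed
    next
      fix z assume "z \<in> (\<lambda>c. (tres Q X W i c, tres Q Y W j c)) ` carrier (tval Q W)"
      then show "z \<in> carrier (tval Q X) \<times> carrier (tval Q Y)" using Q_closed m by auto
    next
      fix z assume "z \<in> carrier (tval Q X) \<times> carrier (tval Q Y)"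
      then obtain a b where z: "z = (a, b)" and a: "a \<in> carrier (tval Q X)" and b: "b \<in> carrier (tval Q Y)"
        by auto
      define c where "c = ttr Q X W i a \<oplus>\<^bsub>tval Q W\<^esub> ttr Q Y W j b"
      have c: "c \<in> carrier (tval Q W)" unfolding c_def by (simp add: ops m a b)
      have "tres Q X W i c = a"
      proof (rule Q_ext[of _ X])
        fix T f assume k: "(T, f) \<in> K"
        then show "cval T f (tres Q X W i c) = cval T f a"
          using tambara.coproduct_transfers(1)[OF tam[OF k] W] by (simp add: c_def ops m a b)
      qed (simp_all add: ops m a c)
      moreover have "tres Q Y W j c = b"
      proof (rule Q_ext[of _ Y])
        fix T f assume k: "(T, f) \<in> K"
        then show "cval T f (tres Q Y W j c) = cval T f b"
          using tambara.coproduct_transfers(2)[OF tam[OF k] W] by (simp add: c_def ops m a b)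
      qed (simp_all add: ops m b c)
      ultimately show "z \<in> (\<lambda>c. (tres Q X W i c, tres Q Y W j c)) ` carrier (tval Q W)"
        using c z by force
    qed
  qed
  show "carrier (tval Q X) = {\<zero>\<^bsub>tval Q X\<^esub>}" if X: "is_gset G X" and e: "pts X = {}" for X
  proof -
    have "c = \<zero>\<^bsub>tval Q X\<^esub>" if c: "c \<in> carrier (tval Q X)" for c
    proof (rule Q_ext[OF c])
      fix T f assume k: "(T, f) \<in> K"
      then show "cval T f c = cval T f \<zero>\<^bsub>tval Q X\<^esub>"
        using tambara.val_empty[OF tam[OF k] X e] cval_closed[OF k c] by (simp add: ops X)
    qed (simp add: ops X)
    then show ?thesis using Q_closed(2)[OF X] by blast
  qed
qed

lemma wf_Gen: "\<lbrakk>is_gset (subgrp G H) X; a \<in> carrier (tval R X)\<rbrakk> \<Longrightarrow> twf (ind G H X) (Gen X a)"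
  by simp

lemma unit_Q: "tambara_hom (subgrp G H) R (restr G H Q) (\<lambda>X a. cls (ind G H X) (Gen X a))"
proof -
  let ?u = "\<lambda>X a. cls (ind G H X) (Gen X a)"
  note ind = is_gset_ind[OF G H] gmap_ind[OF G H]
  have f: "f X \<in> ring_hom (tval R X) (tval T (ind G H X))"
    if "(T, f) \<in> K" "is_gset (subgrp G H) X" for T f X
    using test[OF that(1)] that(2) by (simp add: tambara_hom_def restr_def)
  have fm: "f X (tres R X Y g b) = tres T (ind G H X) (ind G H Y) (ind_map g) (f Y b)"
    if "(T, f) \<in> K" "gmap (subgrp G H) X Y g" "b \<in> carrier (tval R Y)" for T f X Y g b
    using test[OF that(1)] that(2,3) by (simp add: tambara_hom_def restr_def)
  have fm': "f Y (ttr R X Y g a) = ttr T (ind G H X) (ind G H Y) (ind_map g) (f X a)"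
    "f Y (tnm R X Y g a) = tnm T (ind G H X) (ind G H Y) (ind_map g) (f X a)"
    if "(T, f) \<in> K" "gmap (subgrp G H) X Y g" "a \<in> carrier (tval R X)" for T f X Y g a
    using test[OF that(1)] that(2,3) by (simp_all add: tambara_hom_def restr_def)
  have u: "?u X a \<in> carrier (tval Q (ind G H X))" if "is_gset (subgrp G H) X" "a \<in> carrier (tval R X)" for X a
    using classI wf_Gen that by blast
  have ev: "cval T f (?u X a) = f X a"
    if "(T, f) \<in> K" "is_gset (subgrp G H) X" "a \<in> carrier (tval R X)" for T f X a
    using rep_class(2)[OF wf_Gen[OF that(2,3)] that(1)] by simp
  note ops = cval_ops cval_closed Q_closed ind u ev
  have "?u X \<in> ring_hom (tval R X) (tval Q (ind G H X))" if X: "is_gset (subgrp G H) X" for X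
  proof (rule ring_hom_memI)
    fix a b assume ab: "a \<in> carrier (tval R X)" "b \<in> carrier (tval R X)"
    then have ab': "a \<oplus>\<^bsub>tval R X\<^esub> b \<in> carrier (tval R X)" "a \<otimes>\<^bsub>tval R X\<^esub> b \<in> carrier (tval R X)"
      using ring_closed[OF X] by auto
    show "?u X (a \<otimes>\<^bsub>tval R X\<^esub> b) = ?u X a \<otimes>\<^bsub>tval Q (ind G H X)\<^esub> ?u X b"
      by (rule Q_ext[of _ "ind G H X"]) (simp_all add: ops X ab ab' ring_hom_mult[OF f])
    show "?u X (a \<oplus>\<^bsub>tval R X\<^esub> b) = ?u X a \<oplus>\<^bsub>tval Q (ind G H X)\<^esub> ?u X b"
      by (rule Q_ext[of _ "ind G H X"]) (simp_all add: ops X ab ab' ring_hom_add[OF f])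
  next
    have "\<one>\<^bsub>tval R X\<^esub> \<in> carrier (tval R X)" using ring_closed[OF X] by simp
    then show "?u X \<one>\<^bsub>tval R X\<^esub> = \<one>\<^bsub>tval Q (ind G H X)\<^esub>"
      by (intro Q_ext[of _ "ind G H X"]) (simp_all add: ops X ring_hom_one[OF f])
  qed (simp add: u X)
  moreover have "?u X (tres R X Y g b) = tres Q (ind G H X) (ind G H Y) (ind_map g) (?u Y b)"
    if g: "gmap (subgrp G H) X Y g" and b: "b \<in> carrier (tval R Y)" for X Y g b
  proof -
    have XY: "is_gset (subgrp G H) X" "is_gset (subgrp G H) Y" using g by (auto simp: gmap_def)
    have "tres R X Y g b \<in> carrier (tval R X)" using maps_closed[OF g] b by blast
    then show ?thesis
      by (intro Q_ext[of _ "ind G H X"]) (simp_all add: ops XY g b fm)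
  qed
  moreover have "?u Y (ttr R X Y g a) = ttr Q (ind G H X) (ind G H Y) (ind_map g) (?u X a)"
    "?u Y (tnm R X Y g a) = tnm Q (ind G H X) (ind G H Y) (ind_map g) (?u X a)"
    if g: "gmap (subgrp G H) X Y g" and a: "a \<in> carrier (tval R X)" for X Y g a
  proof -
    have XY: "is_gset (subgrp G H) X" "is_gset (subgrp G H) Y" using g by (auto simp: gmap_def)
    have "ttr R X Y g a \<in> carrier (tval R Y)" "tnm R X Y g a \<in> carrier (tval R Y)"
      using maps_closed[OF g] a by blast+
    then show "?u Y (ttr R X Y g a) = ttr Q (ind G H X) (ind G H Y) (ind_map g) (?u X a)"
      "?u Y (tnm R X Y g a) = tnm Q (ind G H X) (ind G H Y) (ind_map g) (?u X a)"
      by (intro Q_ext[of _ "ind G H Y"]; simp add: ops XY g a fm')+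
  qed
  ultimately show ?thesis by (simp add: tambara_hom_def restr_def)
qed

lemma cval_hom:
  assumes "(T, f) \<in> K"
  shows "tambara_hom G Q T (\<lambda>X. cval T f)"
  using assms unfolding tambara_hom_def
  by (auto simp: cval_ops cval_closed Q_closed intro!: ring_hom_memI)

lemma hom_on_classes:
  assumes T: "tambara G T" and h: "tambara_hom G Q T h"
    and u: "\<And>X a. \<lbrakk>is_gset (subgrp G H) X; a \<in> carrier (tval R X)\<rbrakk>
              \<Longrightarrow> h (ind G H X) (cls (ind G H X) (Gen X a)) = f X a"
    and t: "twf X t"
  shows "h X (cls X t) = term_val T f t"
proof -
  have hr: "h X \<in> ring_hom (tval Q X) (tval T X)" if "is_gset G X" for X
    using h that by (simp add: tambara_hom_def)
  have opc: "cls X (Add X t u) = cls X t \<oplus>\<^bsub>tval Q X\<^esub> cls X u"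
      "cls X (Mul X t u) = cls X t \<otimes>\<^bsub>tval Q X\<^esub> cls X u" if "twf X t" "twf X u" for X t u
    unfolding term_quotient_def
    by (auto intro!: class_eqI simp: rep_class(2)[OF that(1)] rep_class(2)[OF that(2)])
  have opm: "cls X (Res X Y g t) = tres Q X Y g (cls Y t)" if "twf Y t" for X Y g t
    unfolding term_quotient_def by (auto intro!: class_eqI simp: rep_class(2)[OF that])
  have opm': "cls Y (Tr X Y g t) = ttr Q X Y g (cls X t)" "cls Y (Nm X Y g t) = tnm Q X Y g (cls X t)"
    if "twf X t" for X Y g t
    unfolding term_quotient_def by (auto intro!: class_eqI simp: rep_class(2)[OF that])
  have hm: "h X (tres Q X Y g b) = tres T X Y g (h Y b)" if "gmap G X Y g" "b \<in> carrier (tval Q Y)" for X Y g b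
    using h that by (simp add: tambara_hom_def)
  have hm': "h Y (ttr Q X Y g a) = ttr T X Y g (h X a)" "h Y (tnm Q X Y g a) = tnm T X Y g (h X a)"
    if "gmap G X Y g" "a \<in> carrier (tval Q X)" for X Y g a
    using h that by (simp_all add: tambara_hom_def)
  show ?thesis
    using t
  proof (induction t arbitrary: X)
    case (Zero Y)
    then have X: "is_gset G X" "Y = X" by auto
    show ?case using X ring_hom_zero[OF hr[OF X(1)]] cring_Q[OF X(1)] tambara.val_cring[OF T X(1)]
      by (simp add: cring_def term_quotient_def)
  next
    case (One Y)
    then show ?case using ring_hom_one[OF hr[of X]] by (simp add: term_quotient_def)
  next
    case (Neg Y t)
    then have X: "is_gset G X" "Y = X" and t: "twf X t" by auto
    interpret Q: cring "tval Q X" by (rule cring_Q[OF X(1)])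
    interpret T: cring "tval T X" by (rule tambara.val_cring[OF T X(1)])
    have w: "twf X (Neg X t)" using t X by simp
    have "cls X (Neg X t) \<oplus>\<^bsub>tval Q X\<^esub> cls X t = \<zero>\<^bsub>tval Q X\<^esub>"
    proof -
      have "cls X (Add X (Neg X t) t) = cls X (Zero X)"
      proof (rule class_eqI)
        fix T' f' assume k: "(T', f') \<in> K"
        interpret T': cring "tval T' X" using tambara.val_cring[of G T'] test[OF k] X by simp
        show "term_val T' f' (Add X (Neg X t) t) = term_val T' f' (Zero X)"
          using val_closed[OF k t] by (simp add: T'.l_neg)
      qed
      then show ?thesis using opc(1)[OF w t] by (simp add: term_quotient_def)
    qed
    then have "cls X (Neg X t) = \<ominus>\<^bsub>tval Q X\<^esub> cls X t"
      using classI[OF w] classI[OF t] by (simp add: Q.minus_equality)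
    moreover have "h X (\<ominus>\<^bsub>tval Q X\<^esub> cls X t) = \<ominus>\<^bsub>tval T X\<^esub> h X (cls X t)"
    proof -
      interpret ring_hom_ring "tval Q X" "tval T X" "h X"
        using hr[OF X(1)] Q.ring_axioms T.ring_axioms by (intro ring_hom_ringI2)
      show ?thesis using classI[OF t] by simp
    qed
    ultimately show ?case using Neg.IH[OF t] X by simp
  next
    case (Add Y t u)
    then show ?case using ring_hom_add[OF hr[of X] classI classI] by (simp add: opc)
  next
    case (Mul Y t u)
    then show ?case using ring_hom_mult[OF hr[of X] classI classI] by (simp add: opc)
  next
    case (Res X' Y g t)
    then show ?case by (simp add: opm hm classI)
  next
    case (Tr X' Y g t)
    then show ?case by (simp add: opm' hm' classI)
  next
    case (Nm X' Y g t)
    then show ?case by (simp add: opm' hm' classI)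
  qed (use u in simp)
qed

end

text \<open>Tests with values in the type of the norm itself suffice for existence.\<close>

lemma norm_pair_exists:
  fixes R :: "'a tambara_data"
  assumes G: "group G" "finite (carrier G)" and H: "subgroup H G" and R: "norm_tests G H R ({} :: ('a norm_val tambara_data \<times> _) set)"
  shows "universal_arrow G H R (norm G H R) (norm_unit G H R) TYPE('a norm_val)"
proof -
  define K where "K = {(T :: 'a norm_val tambara_data, f). tambara G T \<and> tambara_hom (subgrp G H) R (restr G H T) f}"
  interpret norm_tests G H R K
    using R by (auto simp: norm_tests_def K_def)
  have "universal_arrow G H R Q (\<lambda>X a. cls (ind G H X) (Gen X a)) TYPE('a norm_val)"
    unfolding universal_arrow_def
  proof (intro conjI allI impI tambara_Q unit_Q)
    fix T :: "'a norm_val tambara_data" and f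
    assume Tf: "tambara G T \<and> tambara_hom (subgrp G H) R (restr G H T) f"
    then have k: "(T, f) \<in> K" by (simp add: K_def)
    show "\<exists>h. tambara_hom G Q T h \<and> (\<forall>X. is_gset (subgrp G H) X \<longrightarrow>
        (\<forall>x\<in>carrier (tval R X). h (ind G H X) (cls (ind G H X) (Gen X x)) = f X x))"
      using cval_hom[OF k] rep_class(2)[OF wf_Gen k] by (auto intro!: exI[of _ "\<lambda>X. cval T f"])
    fix h h' X c
    assume hh: "tambara_hom G Q T h \<and> tambara_hom G Q T h' \<and> (\<forall>X. is_gset (subgrp G H) X \<longrightarrow>
        (\<forall>x\<in>carrier (tval R X). h (ind G H X) (cls (ind G H X) (Gen X x)) = f X x
           \<and> h' (ind G H X) (cls (ind G H X) (Gen X x)) = f X x))"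
      and X: "is_gset G X"
    show "\<forall>c\<in>carrier (tval Q X). h X c = h' X c"
    proof
      fix c assume "c \<in> carrier (tval Q X)"
      then obtain t where t: "twf X t" "c = cls X t" by (auto simp: carrier_Q)
      show "h X c = h' X c"
        using hom_on_classes[of T h f X t] hom_on_classes[of T h' f X t] Tf hh t by simp
    qed
  qed
  then have "case norm_pair G H R of (N, \<eta>) \<Rightarrow> universal_arrow G H R N \<eta> TYPE('a norm_val)"
    unfolding norm_pair_def by (intro someI[where P = "\<lambda>(N, \<eta>). universal_arrow G H R N \<eta> TYPE('a norm_val)"]) auto
  then show ?thesis by (simp add: norm_def norm_unit_def case_prod_beta)
qed

lemma tambara_hom_comp:
  assumes "tambara_hom G S T h" "tambara_hom G T U k"
  shows "tambara_hom G S U (\<lambda>X x. k X (h X x))"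
proof -
  have h: "h X \<in> ring_hom (tval S X) (tval T X)" and k: "k X \<in> ring_hom (tval T X) (tval U X)"
    if "is_gset G X" for X using assms that by (auto simp: tambara_hom_def)
  have "(\<lambda>x. k X (h X x)) \<in> ring_hom (tval S X) (tval U X)" if "is_gset G X" for X
    using ring_hom_trans[OF h[OF that] k[OF that]] by (simp add: comp_def)
  moreover have "h X x \<in> carrier (tval T X)" if "is_gset G X" "x \<in> carrier (tval S X)" for X x
    using ring_hom_closed[OF h that(2)] that(1) by simp
  ultimately show ?thesis using assms by (auto simp: tambara_hom_def gmap_def)
qed

lemma norm_tests_empty:
  assumes "group G" "finite (carrier G)" "subgroup H G" "tambara (subgrp G H) R"
  shows "norm_tests G H R {}"
proof -
  have r: "ring (tval R X)" if "is_gset (subgrp G H) X" for X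
    using tambara.val_cring[OF assms(4) that] by (simp add: cring_def)
  show ?thesis
    using assms(1-3) tambara.map_closed[OF assms(4)]
    by (intro norm_tests.intro) (simp_all add: ring.ring_simprules(1,5,6)[OF r])
qed

lemma norm_universal_closed:
  fixes R :: "'a tambara_data"
  assumes "group G" "finite (carrier G)" "subgroup H G" and R: "norm_tests G H R ({} :: ('a norm_val tambara_data \<times> _) set)"
  shows "universal_arrow G H R (norm G H R) (norm_unit G H R) TYPE('c)"
proof -
  let ?N = "norm G H R" and ?\<eta> = "norm_unit G H R"
  have U: "universal_arrow G H R ?N ?\<eta> TYPE('a norm_val)" by (rule norm_pair_exists[OF assms])
  then have N: "tambara G ?N" and \<eta>: "tambara_hom (subgrp G H) R (restr G H ?N) ?\<eta>"
    by (simp_all add: universal_arrow_def)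
  have ex: "\<exists>h. tambara_hom G ?N T h \<and> (\<forall>X. is_gset (subgrp G H) X \<longrightarrow>
      (\<forall>x\<in>carrier (tval R X). h (ind G H X) (?\<eta> X x) = f X x))"
    if "tambara G T" "tambara_hom (subgrp G H) R (restr G H T) f" for T :: "'a norm_val tambara_data" and f
    using U that unfolding universal_arrow_def by blast
  have uniq: "h X c = h' X c"
    if "tambara G T" "tambara_hom (subgrp G H) R (restr G H T) f" "tambara_hom G ?N T h" "tambara_hom G ?N T h'"
      "\<And>X x. \<lbrakk>is_gset (subgrp G H) X; x \<in> carrier (tval R X)\<rbrakk> \<Longrightarrow> h (ind G H X) (?\<eta> X x) = f X x"
      "\<And>X x. \<lbrakk>is_gset (subgrp G H) X; x \<in> carrier (tval R X)\<rbrakk> \<Longrightarrow> h' (ind G H X) (?\<eta> X x) = f X x"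
      "is_gset G X" "c \<in> carrier (tval ?N X)"
    for T :: "'a norm_val tambara_data" and f h h' X c
    using U that unfolding universal_arrow_def by blast
  text \<open>Every element of the norm is the value of an expression.\<close>
  have gen: "\<exists>t. term_wf G H R X t \<and> c = term_val ?N ?\<eta> t"
    if X: "is_gset G X" and c: "c \<in> carrier (tval ?N X)" for X c
  proof -
    interpret E: norm_tests G H R "{(?N, ?\<eta>)}"
      using R N \<eta> by (auto simp: norm_tests_def)
    obtain h where h: "tambara_hom G ?N E.Q h" and hu: "\<And>X x. \<lbrakk>is_gset (subgrp G H) X; x \<in> carrier (tval R X)\<rbrakk>
        \<Longrightarrow> h (ind G H X) (?\<eta> X x) = E.cls (ind G H X) (Gen X x)"
      using ex[OF E.tambara_Q E.unit_Q] by blast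
    have k: "tambara_hom G ?N ?N (\<lambda>X x. E.cval ?N ?\<eta> (h X x))"
      using tambara_hom_comp[OF h E.cval_hom] by simp
    have "E.cval ?N ?\<eta> (h (ind G H X) (?\<eta> X x)) = ?\<eta> X x"
      if "is_gset (subgrp G H) X" "x \<in> carrier (tval R X)" for X x
      unfolding hu[OF that] using E.rep_class(2)[OF E.wf_Gen[OF that], of ?N ?\<eta>] by simp
    moreover have "tambara_hom G ?N ?N (\<lambda>X x. x)"
      by (auto simp: tambara_hom_def ring_hom_def)
    ultimately have "E.cval ?N ?\<eta> (h X c) = c"
      using uniq[OF N \<eta> k _ _ _ X c] by blast
    moreover have "h X c \<in> carrier (tval E.Q X)"
      using h X c by (auto simp: tambara_hom_def ring_hom_def)
    ultimately show ?thesis using E.repQ(1) by metis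
  qed
  have val: "h X (term_val ?N ?\<eta> t) = term_val T f t"
    if T: "tambara G T" and h: "tambara_hom G ?N T h"
      and u: "\<And>X x. \<lbrakk>is_gset (subgrp G H) X; x \<in> carrier (tval R X)\<rbrakk> \<Longrightarrow> h (ind G H X) (?\<eta> X x) = f X x"
      and t: "term_wf G H R X t"
    for T :: "'c tambara_data" and h f X t
  proof -
    interpret E: norm_tests G H R "{(?N, ?\<eta>)}"
      using R N \<eta> by (auto simp: norm_tests_def)
    have "tambara_hom G E.Q T (\<lambda>X c. h X (E.cval ?N ?\<eta> c))"
      by (rule tambara_hom_comp[OF E.cval_hom h]) simp
    from E.hom_on_classes[OF T this _ t, of f] show ?thesis
      using u E.rep_class(2)[OF E.wf_Gen, of _ _ ?N ?\<eta>] E.rep_class(2)[OF t, of ?N ?\<eta>] by simp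
  qed
  show ?thesis
    unfolding universal_arrow_def
  proof (intro conjI allI impI N \<eta>)
    fix T :: "'c tambara_data" and f
    assume Tf: "tambara G T \<and> tambara_hom (subgrp G H) R (restr G H T) f"
    interpret E: norm_tests G H R "{(T, f)}"
      using R Tf by (auto simp: norm_tests_def)
    obtain h where h: "tambara_hom G ?N E.Q h" and hu: "\<And>X x. \<lbrakk>is_gset (subgrp G H) X; x \<in> carrier (tval R X)\<rbrakk>
        \<Longrightarrow> h (ind G H X) (?\<eta> X x) = E.cls (ind G H X) (Gen X x)"
      using ex[OF E.tambara_Q E.unit_Q] by blast
    have "tambara_hom G ?N T (\<lambda>X x. E.cval T f (h X x))"
      using tambara_hom_comp[OF h E.cval_hom] by simp
    moreover have "E.cval T f (h (ind G H X) (?\<eta> X x)) = f X x"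
      if "is_gset (subgrp G H) X" "x \<in> carrier (tval R X)" for X x
      unfolding hu[OF that] using E.rep_class(2)[OF E.wf_Gen[OF that], of T f] by simp
    ultimately show "\<exists>h. tambara_hom G ?N T h \<and> (\<forall>X. is_gset (subgrp G H) X \<longrightarrow>
        (\<forall>x\<in>carrier (tval R X). h (ind G H X) (?\<eta> X x) = f X x))" by blast
    fix h h' X
    assume hh: "tambara_hom G ?N T h \<and> tambara_hom G ?N T h' \<and> (\<forall>X. is_gset (subgrp G H) X \<longrightarrow>
        (\<forall>x\<in>carrier (tval R X). h (ind G H X) (?\<eta> X x) = f X x \<and> h' (ind G H X) (?\<eta> X x) = f X x))"
      and X: "is_gset G X"
    show "\<forall>c\<in>carrier (tval ?N X). h X c = h' X c"
    proof
      fix c assume "c \<in> carrier (tval ?N X)"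
      then obtain t where t: "term_wf G H R X t" "c = term_val ?N ?\<eta> t" using gen[OF X] by blast
      show "h X c = h' X c"
        using val[of T h f X t] val[of T h' f X t] Tf hh t by simp
    qed
  qed
qed

theorem norm_universal:
  fixes R :: "'a tambara_data"
  assumes "group G" "finite (carrier G)" "subgroup H G" "tambara (subgrp G H) R"
  shows "universal_arrow G H R (norm G H R) (norm_unit G H R) TYPE('c)"
  by (rule norm_universal_closed[OF assms(1-3) norm_tests_empty[OF assms]])

section \<open>The dihedral groups and the simplicial sets \<open>P\<close>\<close>

definition addm :: "nat \<Rightarrow> nat \<Rightarrow> nat \<Rightarrow> nat" where
  "addm m i j = (i + j) mod m"

definition subm :: "nat \<Rightarrow> nat \<Rightarrow> nat \<Rightarrow> nat" where
  "subm m i j = (i + (m - j)) mod m"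

lemma int_addm: "int (addm m i j) = (int i + int j) mod int m"
  by (simp add: addm_def zmod_int)

lemma int_subm: "j \<le> m \<Longrightarrow> int (subm m i j) = (int i - int j) mod int m"
proof -
  assume "j \<le> m"
  then have "int (subm m i j) = (int i - int j + int m) mod int m"
    unfolding subm_def zmod_int by (simp add: of_nat_diff add_diff_eq diff_add_eq)
  then show ?thesis by simp
qed

lemma addm_less: "0 < m \<Longrightarrow> addm m i j < m" and subm_less: "0 < m \<Longrightarrow> subm m i j < m"
  by (simp_all add: addm_def subm_def)

lemma dihedral_sel [simp]:
  "carrier (dihedral m) = {0..<2 * m}" "\<one>\<^bsub>dihedral m\<^esub> = 0"
  by (simp_all add: dihedral_def)

lemma dihedral_mult:
  assumes "i < m" "j < m"
  shows "i \<otimes>\<^bsub>dihedral m\<^esub> j = addm m i j"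
    and "i \<otimes>\<^bsub>dihedral m\<^esub> (m + j) = m + addm m i j"
    and "(m + i) \<otimes>\<^bsub>dihedral m\<^esub> j = m + subm m i j"
    and "(m + i) \<otimes>\<^bsub>dihedral m\<^esub> (m + j) = subm m i j"
  using assms by (simp_all add: dihedral_def addm_def subm_def)

lemma dihedral_elem_cases:
  fixes x m :: nat
  assumes "x < 2 * m"
  obtains k where "k < m" "x = k" | k where "k < m" "x = m + k"
proof (cases "x < m")
  case False
  then have "x - m < m" "x = m + (x - m)" using assms by auto
  then show ?thesis using that(2) by blast
qed (use that(1) in blast)

lemma group_dihedral:
  assumes "m \<ge> 1"
  shows "group (dihedral m)"
proof (rule groupI)
  have m: "0 < m" using assms by simp
  note less = addm_less[OF m] subm_less[OF m]
  fix x y assume "x \<in> carrier (dihedral m)" "y \<in> carrier (dihedral m)"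
  then have x: "x < 2 * m" and y: "y < 2 * m" by auto
  have l2: "addm m i j < 2 * m" "subm m i j < 2 * m" for i j
    using less[of i j] by auto
  show "x \<otimes>\<^bsub>dihedral m\<^esub> y \<in> carrier (dihedral m)"
    by (rule dihedral_elem_cases[OF x]; rule dihedral_elem_cases[OF y])
      (simp_all add: dihedral_mult less l2)
  fix z assume "z \<in> carrier (dihedral m)"
  then have z: "z < 2 * m" by auto
  show "(x \<otimes>\<^bsub>dihedral m\<^esub> y) \<otimes>\<^bsub>dihedral m\<^esub> z = x \<otimes>\<^bsub>dihedral m\<^esub> (y \<otimes>\<^bsub>dihedral m\<^esub> z)"
    by (rule dihedral_elem_cases[OF x]; rule dihedral_elem_cases[OF y]; rule dihedral_elem_cases[OF z];
        hypsubst; simp only: dihedral_mult less add_left_cancel;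
        simp only: of_nat_eq_iff[where 'a = int, symmetric] int_addm int_subm less less_imp_le
          mod_simps algebra_simps)
next
  have m: "0 < m" using assms by simp
  show "\<one>\<^bsub>dihedral m\<^esub> \<in> carrier (dihedral m)" using m by simp
  fix x assume "x \<in> carrier (dihedral m)"
  then have x: "x < 2 * m" by simp
  show "\<one>\<^bsub>dihedral m\<^esub> \<otimes>\<^bsub>dihedral m\<^esub> x = x"
    using m by (rule_tac dihedral_elem_cases[OF x]) (simp_all add: dihedral_mult addm_def)
  show "\<exists>y\<in>carrier (dihedral m). y \<otimes>\<^bsub>dihedral m\<^esub> x = \<one>\<^bsub>dihedral m\<^esub>"
  proof (rule dihedral_elem_cases[OF x])
    fix k assume k: "k < m" "x = k"
    have q: "(m - k) mod m < m" using m by simp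
    then have "((m - k) mod m) \<otimes>\<^bsub>dihedral m\<^esub> x = 0"
      using k by (simp add: dihedral_mult addm_def mod_simps)
    then show ?thesis using q by (auto intro!: bexI[of _ "(m - k) mod m"])
  next
    fix k assume k: "k < m" "x = m + k"
    then have "x \<otimes>\<^bsub>dihedral m\<^esub> x = 0" by (simp add: dihedral_mult subm_def)
    then show ?thesis using x by auto
  qed
qed

lemma dihedral_presentation:
  assumes "m \<ge> 1"
  shows "order (dihedral m) = 2 * m"
    and "generate (dihedral m) {rot m, flip m} = carrier (dihedral m)"
    and "flip m \<otimes>\<^bsub>dihedral m\<^esub> flip m = \<one>\<^bsub>dihedral m\<^esub>"
    and "rot m [^]\<^bsub>dihedral m\<^esub> m = \<one>\<^bsub>dihedral m\<^esub>"
    and "flip m \<otimes>\<^bsub>dihedral m\<^esub> rot m \<otimes>\<^bsub>dihedral m\<^esub> flip m = inv\<^bsub>dihedral m\<^esub> rot m"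
proof -
  interpret D: group "dihedral m" by (rule group_dihedral[OF assms])
  have m: "0 < m" using assms by simp
  have r: "rot m < m" using m by (simp add: rot_def)
  have fr: "flip m = m + 0" by (simp add: flip_def)
  have f: "flip m \<otimes>\<^bsub>dihedral m\<^esub> flip m = 0"
    unfolding fr using m by (simp only: dihedral_mult) (simp add: subm_def)
  have pow: "rot m [^]\<^bsub>dihedral m\<^esub> k = k mod m" for k :: nat
  proof (induction k)
    case (Suc k)
    have "k mod m < m" using m by simp
    then show ?case using Suc r by (simp add: dihedral_mult addm_def rot_def mod_simps)
  qed simp
  show "order (dihedral m) = 2 * m" by (simp add: order_def)
  show "flip m \<otimes>\<^bsub>dihedral m\<^esub> flip m = \<one>\<^bsub>dihedral m\<^esub>" using f by simp
  show "rot m [^]\<^bsub>dihedral m\<^esub> m = \<one>\<^bsub>dihedral m\<^esub>" using pow by simp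
  have q: "(m - rot m) mod m < m" using m by simp
  have "flip m \<otimes>\<^bsub>dihedral m\<^esub> rot m \<otimes>\<^bsub>dihedral m\<^esub> flip m = subm m (subm m 0 (rot m)) 0"
    using m r subm_less[OF m] by (simp only: fr dihedral_mult)
  also have "\<dots> = (m - rot m) mod m" by (simp add: subm_def)
  moreover have "(m - rot m) mod m \<otimes>\<^bsub>dihedral m\<^esub> rot m = 0"
    using m r q by (simp add: dihedral_mult addm_def mod_simps)
  then have "inv\<^bsub>dihedral m\<^esub> rot m = (m - rot m) mod m"
    using r q by (intro D.inv_equality) (simp_all add: less_imp_le trans_less_add1 mult_2)
  ultimately show "flip m \<otimes>\<^bsub>dihedral m\<^esub> rot m \<otimes>\<^bsub>dihedral m\<^esub> flip m = inv\<^bsub>dihedral m\<^esub> rot m"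
    by simp
  show "generate (dihedral m) {rot m, flip m} = carrier (dihedral m)" (is "?S = _")
  proof
    have sub: "{rot m, flip m} \<subseteq> carrier (dihedral m)" using r m by (auto simp: flip_def)
    then show "?S \<subseteq> carrier (dihedral m)" by (rule D.generate_incl)
    interpret S: subgroup ?S "dihedral m" by (rule D.generate_is_subgroup[OF sub])
    have "rot m [^]\<^bsub>dihedral m\<^esub> k \<in> ?S" for k :: nat
      by (induction k) (simp_all only: nat_pow_0 nat_pow_Suc S.one_closed S.m_closed generate.incl insertI1)
    then have R: "k \<in> ?S" if "k < m" for k using that pow[of k] by (metis mod_less)
    show "carrier (dihedral m) \<subseteq> ?S"
    proof
      fix x assume "x \<in> carrier (dihedral m)"
      then have "x < 2 * m" by simp
      then show "x \<in> ?S"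
      proof (rule dihedral_elem_cases)
        fix k assume k: "k < m" "x = m + k"
        have "k \<otimes>\<^bsub>dihedral m\<^esub> flip m \<in> ?S" using R[OF k(1)] by (intro S.m_closed) (auto intro: generate.incl)
        moreover have "k \<otimes>\<^bsub>dihedral m\<^esub> flip m = x"
          using k m by (simp only: fr dihedral_mult) (simp add: addm_def)
        ultimately show ?thesis by simp
      qed (use R in auto)
    qed
  qed
qed

lemma P_act_vertices:
  assumes "k < m"
  shows "i < m \<Longrightarrow> P_act m i (Vx k) = Vx (addm m i k)"
    and "i < m \<Longrightarrow> P_act m (m + i) (Vx k) = Vx (subm m i k)"
    and "i < m \<Longrightarrow> P_act m i (Vx' k) = Vx' (addm m i k)"
    and "i < m \<Longrightarrow> P_act m (m + i) (Vx' k) = Vx' (subm m (subm m i k) 1)"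
  using assms by (simp_all only: addm_def subm_def P_act.simps mod_add_left_eq) simp_all

lemma P2m_cases:
  assumes "x \<in> P2m m n"
  obtains k where "k < m" "x = Vx k" | k where "k < m" "x = Vx' k"
    | g c where "g \<in> carrier (dihedral m)" "1 \<le> c" "c \<le> n" "x = Ed g c"
  using assms by (auto simp: P2m_def)

lemma P_act_action:
  assumes m1: "m \<ge> 1" and x: "x \<in> P2m m n"
  shows "g \<in> carrier (dihedral m) \<Longrightarrow> P_act m g x \<in> P2m m n"
    and "P_act m \<one>\<^bsub>dihedral m\<^esub> x = x"
    and "\<lbrakk>g \<in> carrier (dihedral m); h \<in> carrier (dihedral m)\<rbrakk>
       \<Longrightarrow> P_act m (g \<otimes>\<^bsub>dihedral m\<^esub> h) x = P_act m g (P_act m h x)"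
proof -
  interpret D: group "dihedral m" by (rule group_dihedral[OF m1])
  have m: "0 < m" "1 \<le> m" using m1 by simp_all
  show "P_act m \<one>\<^bsub>dihedral m\<^esub> x = x"
    using x m D.l_one by (cases rule: P2m_cases) auto
  note less = addm_less[OF m(1)] subm_less[OF m(1)]
  {
    assume gc: "g \<in> carrier (dihedral m)"
    show "P_act m g x \<in> P2m m n"
      using x
    proof (cases rule: P2m_cases)
      case (3 h c)
      then show ?thesis using D.m_closed[OF gc 3(1)] by (auto simp: P2m_def simp del: dihedral_sel)
    qed (use m in \<open>auto simp: P2m_def\<close>)
    assume hc: "h \<in> carrier (dihedral m)"
    from gc hc have g: "g < 2 * m" and h: "h < 2 * m" by auto
    note arith = of_nat_eq_iff[where 'a = int, symmetric] int_addm int_subm less less_imp_le m(2)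
      of_nat_1 mod_simps algebra_simps
    show "P_act m (g \<otimes>\<^bsub>dihedral m\<^esub> h) x = P_act m g (P_act m h x)"
      using x
    proof (cases rule: P2m_cases)
      case (1 k)
      show ?thesis unfolding 1(2) using 1(1)
        by (rule_tac dihedral_elem_cases[OF g]; rule_tac dihedral_elem_cases[OF h];
            hypsubst; simp only: dihedral_mult P_act_vertices less psimplex.inject; simp only: arith; simp)
    next
      case (2 k)
      show ?thesis unfolding 2(2) using 2(1)
        by (rule_tac dihedral_elem_cases[OF g]; rule_tac dihedral_elem_cases[OF h];
            hypsubst; simp only: dihedral_mult P_act_vertices less psimplex.inject; simp only: arith; simp)
    next
      case (3 l c)
      then show ?thesis using gc hc D.m_assoc by (simp del: dihedral_sel)
    qed
  }
qed

text \<open>The faces are equivariant, and faces and degeneracies preserve the orbit representatives.\<close>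

lemma P_face_act:
  assumes m1: "m \<ge> 1" and x: "x \<in> P2m m n" and gc: "g \<in> carrier (dihedral m)"
  shows "P_face m n i (P_act m g x) = P_act m g (P_face m n i x)"
proof -
  have m: "0 < m" "1 \<le> m" using m1 by simp_all
  note less = addm_less[OF m(1)] subm_less[OF m(1)]
  note arith = of_nat_eq_iff[where 'a = int, symmetric] int_addm int_subm less less_imp_le m(2)
      of_nat_1 mod_simps algebra_simps
  have g: "g < 2 * m" using gc by simp
  have d0: "d0_edge m k = Vx' k" "d0_edge m (m + k) = Vx' (subm m k 1)"
    and d1: "d1_edge m k = Vx k" "d1_edge m (m + k) = Vx k" if "k < m" for k
    using that by (simp_all add: d0_edge_def d1_edge_def subm_def)
  have e0: "d0_edge m (g \<otimes>\<^bsub>dihedral m\<^esub> h) = P_act m g (d0_edge m h)"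
    and e1: "d1_edge m (g \<otimes>\<^bsub>dihedral m\<^esub> h) = P_act m g (d1_edge m h)" if h: "h < 2 * m" for h
    by (rule_tac [!] dihedral_elem_cases[OF g]; rule_tac dihedral_elem_cases[OF h];
        hypsubst; simp only: dihedral_mult d0 d1 P_act_vertices less psimplex.inject; simp only: arith; simp)+
  show ?thesis
    using x by (cases rule: P2m_cases) (auto simp: e0 e1 Let_def)
qed

lemma P2m_iff:
  "Vx k \<in> P2m m n \<longleftrightarrow> k < m" "Vx' k \<in> P2m m n \<longleftrightarrow> k < m"
  "Ed g c \<in> P2m m n \<longleftrightarrow> g < 2 * m \<and> 1 \<le> c \<and> c \<le> n"
  by (auto simp: P2m_def)

lemma P_simplicial:
  assumes "m \<ge> 1" and x: "x \<in> P2m m n"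
  shows "\<lbrakk>n \<ge> 1; i \<le> n\<rbrakk> \<Longrightarrow> P_face m n i x \<in> P2m m (n - 1)"
    and "i \<le> n \<Longrightarrow> P_degen i x \<in> P2m m (n + 1)"
    and "\<lbrakk>n \<ge> 2; i < j; j \<le> n\<rbrakk>
       \<Longrightarrow> P_face m (n - 1) i (P_face m n j x) = P_face m (n - 1) (j - 1) (P_face m n i x)"
    and "\<lbrakk>i \<le> j; j \<le> n\<rbrakk> \<Longrightarrow> P_degen i (P_degen j x) = P_degen (j + 1) (P_degen i x)"
    and "i \<le> n \<Longrightarrow> P_face m (n + 1) i (P_degen i x) = x"
    and "i \<le> n \<Longrightarrow> P_face m (n + 1) (i + 1) (P_degen i x) = x"
    and "\<lbrakk>i < j; j \<le> n\<rbrakk> \<Longrightarrow> P_face m (n + 1) i (P_degen j x) = P_degen (j - 1) (P_face m n i x)"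
    and "\<lbrakk>j + 1 < i; i \<le> n + 1\<rbrakk> \<Longrightarrow> P_face m (n + 1) i (P_degen j x) = P_degen j (P_face m n (i - 1) x)"
proof -
  have m: "0 < m" using assms by simp
  show "\<lbrakk>n \<ge> 1; i \<le> n\<rbrakk> \<Longrightarrow> P_face m n i x \<in> P2m m (n - 1)"
    using x m by (cases rule: P2m_cases) (auto simp: P2m_iff Let_def d0_edge_def d1_edge_def)
  show "i \<le> n \<Longrightarrow> P_degen i x \<in> P2m m (n + 1)"
    using x m by (cases rule: P2m_cases) (auto simp: P2m_iff)
  have v: "P_face m k l (d0_edge m g) = d0_edge m g" "P_face m k l (d1_edge m g) = d1_edge m g"
    "P_degen l (d0_edge m g) = d0_edge m g" "P_degen l (d1_edge m g) = d1_edge m g" for k l g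
    by (simp_all add: d0_edge_def d1_edge_def)
  define cut where "cut i c = (if i < c then c - 1 else c)" for i c :: nat
  define dup where "dup i c = (if i < c then c + 1 else c)" for i c :: nat
  define mk where "mk n g c = (if c = 0 then d0_edge m g else if c = n then d1_edge m g else Ed g c)" for n g c
  have face: "P_face m n i (Ed g c) = mk n g (cut i c)" and degen: "P_degen i (Ed g c) = Ed g (dup i c)"
    for n i g c by (simp_all add: cut_def dup_def mk_def Let_def)
  have face_mk: "P_face m (n - 1) i (mk n g c) = mk (n - 1) g (cut i c)"
    if "i \<le> n - 1" "c \<le> n" "2 \<le> n" for n i g c
  proof -
    consider "c = 0" | "c = n" | "0 < c" "c < n" using \<open>c \<le> n\<close> by linarith
    then show ?thesis
    proof cases
      case 1
      then show ?thesis by (simp add: mk_def v cut_def)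
    next
      case 2
      then have "cut i c = n - 1" using that by (simp add: cut_def)
      then show ?thesis using 2 that by (simp add: mk_def v)
    next
      case 3
      then have "mk n g c = Ed g c" by (simp add: mk_def)
      then show ?thesis by (simp only: face)
    qed
  qed
  have degen_mk: "P_degen i (mk n g c) = mk (n + 1) g (dup i c)" if "i < n" "c \<le> n" for n i g c
  proof -
    consider "c = 0" | "c = n" | "0 < c" "c < n" using \<open>c \<le> n\<close> by linarith
    then show ?thesis
    proof cases
      case 1
      then show ?thesis by (simp add: mk_def v dup_def)
    next
      case 2
      then have "dup i c = n + 1" using that by (simp add: dup_def)
      then show ?thesis using 2 that by (simp add: mk_def v)
    next
      case 3
      then have "dup i c \<noteq> 0" "dup i c \<noteq> n + 1" "mk n g c = Ed g c" by (simp_all add: mk_def dup_def)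
      then show ?thesis by (simp only: degen) (simp add: mk_def)
    qed
  qed
  have cut_le': "cut i c \<le> n" if "c \<le> n" for i c n using that by (auto simp: cut_def)
  show "\<lbrakk>n \<ge> 2; i < j; j \<le> n\<rbrakk>
      \<Longrightarrow> P_face m (n - 1) i (P_face m n j x) = P_face m (n - 1) (j - 1) (P_face m n i x)"
    using x
  proof (cases rule: P2m_cases)
    case (3 g c)
    assume a: "n \<ge> 2" "i < j" "j \<le> n"
    have "cut i (cut j c) = cut (j - 1) (cut i c)" using a by (auto simp: cut_def)
    moreover have "P_face m (n - 1) i (mk n g (cut j c)) = mk (n - 1) g (cut i (cut j c))"
      "P_face m (n - 1) (j - 1) (mk n g (cut i c)) = mk (n - 1) g (cut (j - 1) (cut i c))"
      using a cut_le'[OF 3(3)] by (intro face_mk; simp; fail)+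
    ultimately show ?thesis unfolding 3(4) face by (simp only:)
  qed simp_all
  show "\<lbrakk>i \<le> j; j \<le> n\<rbrakk> \<Longrightarrow> P_degen i (P_degen j x) = P_degen (j + 1) (P_degen i x)"
    using x by (cases rule: P2m_cases) auto
  show "i \<le> n \<Longrightarrow> P_face m (n + 1) i (P_degen i x) = x"
    using x by (cases rule: P2m_cases) (auto simp: Let_def)
  show "i \<le> n \<Longrightarrow> P_face m (n + 1) (i + 1) (P_degen i x) = x"
    using x by (cases rule: P2m_cases) (auto simp: Let_def)
  show "\<lbrakk>i < j; j \<le> n\<rbrakk> \<Longrightarrow> P_face m (n + 1) i (P_degen j x) = P_degen (j - 1) (P_face m n i x)"
    using x
  proof (cases rule: P2m_cases)
    case (3 g c)
    assume a: "i < j" "j \<le> n"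
    have "cut i (dup j c) = dup (j - 1) (cut i c)" using a 3 by (auto simp: cut_def dup_def)
    moreover have "P_degen (j - 1) (mk n g (cut i c)) = mk (n + 1) g (dup (j - 1) (cut i c))"
      using a cut_le'[OF 3(3)] by (intro degen_mk) auto
    ultimately show ?thesis unfolding 3(4) face degen by (simp only:)
  qed simp_all
  show "\<lbrakk>j + 1 < i; i \<le> n + 1\<rbrakk> \<Longrightarrow> P_face m (n + 1) i (P_degen j x) = P_degen j (P_face m n (i - 1) x)"
    using x
  proof (cases rule: P2m_cases)
    case (3 g c)
    assume a: "j + 1 < i" "i \<le> n + 1"
    have "cut i (dup j c) = dup j (cut (i - 1) c)" using a 3 by (auto simp: cut_def dup_def)
    moreover have "P_degen j (mk n g (cut (i - 1) c)) = mk (n + 1) g (dup j (cut (i - 1) c))"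
      using a cut_le'[OF 3(3)] by (intro degen_mk) auto
    ultimately show ?thesis unfolding 3(4) face degen by (simp only:)
  qed simp_all
qed

lemma P_face_base:
  assumes "m \<ge> 1"
  shows "P_face m n i (Vx 0) = Vx 0" and "P_face m n i (Vx' 0) = Vx' 0"
    and "P_face m n i (Ed 0 c) \<in> {Vx 0, Vx' 0} \<union> range (Ed 0)"
    and "P_degen i (Vx 0) = Vx 0" and "P_degen i (Vx' 0) = Vx' 0"
    and "P_degen i (Ed 0 c) \<in> range (Ed 0)"
  using assms by (auto simp: Let_def d0_edge_def d1_edge_def)


lemma subgroup_pair:
  assumes "group G" "a \<in> carrier G" "a \<otimes>\<^bsub>G\<^esub> a = \<one>\<^bsub>G\<^esub>"
  shows "generate G {a} = {\<one>\<^bsub>G\<^esub>, a}"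
proof -
  interpret group G by fact
  have "inv\<^bsub>G\<^esub> a = a" using assms by (intro inv_equality) auto
  then have "subgroup {\<one>\<^bsub>G\<^esub>, a} G"
    using assms by (intro subgroupI) auto
  then have "generate G {a} \<subseteq> {\<one>\<^bsub>G\<^esub>, a}" by (intro generate_subgroup_incl) auto
  then show ?thesis by (auto intro: generate.one generate.incl)
qed

lemma D2_eq:
  assumes "m \<ge> 1"
  shows "D2 m = {0, m}" and "D2' m = {0, m + rot m}"
    and "rot m \<otimes>\<^bsub>dihedral m\<^esub> flip m = m + rot m"
proof -
  have r: "rot m < m" "0 < m" using assms by (simp_all add: rot_def)
  have "rot m \<otimes>\<^bsub>dihedral m\<^esub> (m + 0) = m + addm m (rot m) 0" using r by (simp only: dihedral_mult)
  then show e: "rot m \<otimes>\<^bsub>dihedral m\<^esub> flip m = m + rot m" using r by (simp add: flip_def addm_def)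
  show "D2 m = {0, m}"
    unfolding D2_def using subgroup_pair[OF group_dihedral[OF assms], of "flip m"]
      dihedral_presentation(3)[OF assms] r by (simp add: flip_def)
  have "(m + rot m) \<otimes>\<^bsub>dihedral m\<^esub> (m + rot m) = subm m (rot m) (rot m)"
    using r by (simp only: dihedral_mult)
  then show "D2' m = {0, m + rot m}"
    unfolding D2'_def e using subgroup_pair[OF group_dihedral[OF assms], of "m + rot m"] r
    by (simp add: subm_def)
qed

lemma P_stabilizers:
  assumes "m \<ge> 1"
  shows "stabilizer (dihedral m) (P_act m) (Vx 0) = D2 m"
    and "stabilizer (dihedral m) (P_act m) (Vx' 0) = D2' m"
    and "stabilizer (dihedral m) (P_act m) (Ed 0 c) = D1 m"
proof -
  interpret D: group "dihedral m" by (rule group_dihedral[OF assms])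
  have m: "0 < m" using assms by simp
  have s: "subm m i 1 = 0 \<longleftrightarrow> i = rot m" if "i < m" for i
  proof (cases "i = 0")
    case True
    then have "subm m i 1 = m - 1" using m by (simp add: subm_def)
    moreover have "rot m = 0 \<longleftrightarrow> m = 1" using m by (cases "m = 1") (simp_all add: rot_def)
    ultimately show ?thesis using m True by auto
  next
    case False
    then have 1: "1 < m" and e: "i + (m - 1) = (i - 1) + m" using that by auto
    have "subm m i 1 = (i + (m - 1)) mod m" using that by (simp add: subm_def)
    also have "\<dots> = i - 1" unfolding e mod_add_self2 using that by (intro mod_less) simp
    finally show ?thesis using False 1 by (auto simp: rot_def)
  qed
  have r: "rot m < m" using m by (simp add: rot_def)
  have z: "subm m i 0 = i" "addm m i 0 = i" if "i < m" for i using that by (simp_all add: subm_def addm_def)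
  have "P_act m g (Vx 0) = Vx 0 \<longleftrightarrow> g \<in> {0, m}"
    and "P_act m g (Vx' 0) = Vx' 0 \<longleftrightarrow> g \<in> {0, m + rot m}" if "g < 2 * m" for g
    using that
    by (rule_tac [!] dihedral_elem_cases[OF that])
      (simp_all only: P_act_vertices[OF m] psimplex.inject s z, use m r in auto)
  then show "stabilizer (dihedral m) (P_act m) (Vx 0) = D2 m"
    and "stabilizer (dihedral m) (P_act m) (Vx' 0) = D2' m"
    unfolding D2_eq[OF assms] stabilizer_def using m r by (auto simp del: P_act.simps)
  show "stabilizer (dihedral m) (P_act m) (Ed 0 c) = D1 m"
    using D.r_one m by (auto simp: stabilizer_def)
qed

end

theory Submission
  imports Defs
begin

text \<open>
  The simplices of degree \<open>n\<close> form \<open>n + 2\<close> orbits: those of \<open>x\<^sub>0\<close> and \<open>x\<^sub>0'\<close>, and \<open>n\<close> free orbits of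
  degenerate edges.  Placing the orbit of \<open>x\<^sub>0\<close> at position \<open>0\<close>, that of \<open>x\<^sub>0'\<close> at position \<open>n + 1\<close> and the
  edges between them turns the box product over the orbits into the \<open>n\<close>-th level of the bar construction,
  and a fold of two neighbouring orbits into the multiplication of two neighbouring factors.  So the
  isomorphism only renames the indices of box products.  The maps that a fold applies to the factors have
  values in the carriers because they are composed of adjoints of Tambara maps.  Finally \<open>\<phi>\<close> and
  \<open>c\<^sub>\<zeta>\<close> agree on \<open>D\<^sub>2'\<close>, and the bar construction only depends on \<open>\<phi>\<close> there.
\<close>

section \<open>Renaming the factors of a box product\<close>

text \<open>Two obstacles shape the argument. The operations of a box product are given on symbols
  and are not known to send classes to single classes, so everything is proved for arbitrary unions
  of Frobenius classes. Moreover a family \<open>m\<close> has arbitrary values off its index set,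
  so renaming the indices is invertible on symbols only up to the Frobenius relation along an
  identity map. The norms come from \<open>SOME\<close>, but different choices never have to be
  compared: both simplicial objects use literally the same coefficient functors and actions, and
  \<open>\<phi>\<close> is traded for \<open>c_zeta\<close> by an equality of the arguments of the
  choice.\<close>

lemma equivclp_map:
  assumes "equivclp r a b" "\<And>x y. r x y \<Longrightarrow> r' (f x) (f y)"
  shows "equivclp r' (f a) (f b)"
  using assms(1)
proof (induction rule: equivclp_induct)
  case (step y z)
  then show ?case
    using assms(2) by (meson equivclp_sym equivclp_trans r_into_equivclp)
qed simp

lemma equivclp_frobenius_symbols:
  assumes "equivclp (frobenius G I T X) a b"
  shows "a \<in> symbols G I T X \<longleftrightarrow> b \<in> symbols G I T X"
  using assms by (induction rule: equivclp_induct) (auto simp: frobenius_def)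

lemma box_class_iff:
  "b \<in> box_class G I T X S \<longleftrightarrow>
     (\<exists>a\<in>S. a \<in> symbols G I T X \<and> b \<in> symbols G I T X \<and> equivclp (frobenius G I T X) a b)"
  unfolding box_class_def using equivclp_frobenius_symbols[of G I T X _ b] by blast

lemma box_classI:
  "\<lbrakk>a \<in> S; b \<in> symbols G I T X; equivclp (frobenius G I T X) b a\<rbrakk> \<Longrightarrow> b \<in> box_class G I T X S"
  unfolding box_class_iff using equivclp_frobenius_symbols[of G I T X b a] equivclp_sym[of _ b a] by blast

lemma carrier_box: "carrier (tval (box G I T) X) = {box_class G I T X {a} | a. a \<in> symbols G I T X}"
  by (simp add: box_def box_ring_def)

text \<open>Families are contravariant in the index, so \<open>p\<close> runs from the new indices
  to the old ones and \<open>m\<close> becomes \<open>m \<circ> p\<close>. The coefficients are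
  required to be equal, not merely isomorphic, because the Loday and bar families coincide on the
  nose.\<close>

locale relabelling =
  fixes G :: "nat monoid" and I :: "'i set" and J :: "'j set"
    and T :: "'i \<Rightarrow> 'a tambara_data" and U :: "'j \<Rightarrow> 'a tambara_data"
    and p :: "'j \<Rightarrow> 'i" and q :: "'i \<Rightarrow> 'j"
  assumes p: "j \<in> J \<Longrightarrow> p j \<in> I" and q: "i \<in> I \<Longrightarrow> q i \<in> J"
    and qp: "j \<in> J \<Longrightarrow> q (p j) = j" and pq: "i \<in> I \<Longrightarrow> p (q i) = i"
    and family: "j \<in> J \<Longrightarrow> U j = T (p j)"
    and nonempty: "I \<noteq> {}"
    and tambara: "i \<in> I \<Longrightarrow> tambara G (T i)"
begin

text \<open>The data are symmetric, so each result below can also be used in the opposite direction,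
  through the interpretation \<open>inv\<close>.\<close>

lemma inverse: "relabelling G J I U T q p"
  by (rule relabelling.intro) (use p q qp pq nonempty in \<open>auto simp: family intro: tambara\<close>)

abbreviation rename :: "('i, 'a) symbol \<Rightarrow> ('j, 'a) symbol" where
  "rename \<equiv> \<lambda>(Y, f, m). (Y, f, m \<circ> p)"

abbreviation unname :: "('j, 'a) symbol \<Rightarrow> ('i, 'a) symbol" where
  "unname \<equiv> \<lambda>(Y, f, m). (Y, f, m \<circ> q)"

lemma rename_symbols: "a \<in> symbols G I T X \<Longrightarrow> rename a \<in> symbols G J U X"
  by (auto simp: symbols_def p family)

text \<open>The relation singles out one factor, where a transfer is taken; the bijection moves this
  factor from \<open>i\<close> to \<open>q i\<close> and keeps the map \<open>h\<close> of
  G-sets.\<close>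

lemma rename_frobenius:
  assumes "frobenius G I T X a b"
  shows "frobenius G J U X (rename a) (rename b)"
proof -
  obtain Y f m Y' f' m' where ab: "a = (Y, f, m)" "b = (Y', f', m')" by (metis prod_cases3)
  obtain h i where i: "i \<in> I" "gmap G Y Y' h" "\<forall>y\<in>pts Y. f y = f' (h y)"
      "m' i = ttr (T i) Y Y' h (m i)" "\<forall>l\<in>I - {i}. m l = tres (T l) Y Y' h (m' l)"
    using assms by (auto simp: ab frobenius_def)
  have "p l \<noteq> i" if "l \<in> J - {q i}" for l using that qp by auto
  then show ?thesis
    using assms i q[OF i(1)] p rename_symbols
    by (auto simp: ab frobenius_def family pq intro!: exI[of _ h] bexI[of _ "q i"])
qed

lemma rename_equiv:
  "equivclp (frobenius G I T X) a b \<Longrightarrow> equivclp (frobenius G J U X) (rename a) (rename b)"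
  using equivclp_map[of "frobenius G I T X" a b "frobenius G J U X" rename] rename_frobenius by blast

text \<open>This is the Frobenius relation along \<open>id\<close>, where restriction and transfer
  are identities. Some index has to play the role of the transferred factor, hence
  \<open>nonempty\<close>. The lemma absorbs the difference between \<open>m\<close> and
  \<open>m \<circ> p \<circ> q\<close>, which agree only on \<open>I\<close>.\<close>

lemma agree_equiv:
  assumes "(Y, f, m) \<in> symbols G I T X" "\<And>i. i \<in> I \<Longrightarrow> m i = m' i"
  shows "equivclp (frobenius G I T X) (Y, f, m) (Y, f, m')"
proof (rule r_into_equivclp)
  have Y: "is_gset G Y" using assms by (auto simp: symbols_def gmap_def)
  then have Yid: "gmap G Y Y id" by (auto simp: gmap_def)
  obtain j where j: "j \<in> I" using nonempty by auto
  have "tres (T i) Y Y id (m i) = m i \<and> ttr (T i) Y Y id (m i) = m i" if "i \<in> I" for i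
    using tambara.map_id[OF tambara[OF that] Y, of "m i"] assms(1) that by (auto simp: symbols_def)
  then show "frobenius G I T X (Y, f, m) (Y, f, m')"
    using assms j Yid by (auto simp: frobenius_def symbols_def intro!: exI[of _ id] bexI[of _ j])
qed

lemma agree_class:
  assumes "(Y, f, m) \<in> box_class G I T X S" "\<And>i. i \<in> I \<Longrightarrow> m i = m' i"
  shows "(Y, f, m') \<in> box_class G I T X S"
  using assms agree_equiv[of Y f m X m'] equivclp_frobenius_symbols[of G I T X "(Y, f, m)" "(Y, f, m')"]
  by (meson box_class_iff equivclp_trans)

lemma class_self: "a \<in> symbols G I T X \<Longrightarrow> a \<in> box_class G I T X {a}"
  by (simp add: box_class_iff)

lemma one_symbol:
  assumes X: "is_gset G X"
  shows "(X, id, \<lambda>i. \<one>\<^bsub>tval (T i) X\<^esub>) \<in> symbols G I T X"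
proof -
  have "\<one>\<^bsub>tval (T i) X\<^esub> \<in> carrier (tval (T i) X)" if "i \<in> I" for i
  proof -
    interpret cring "tval (T i) X" by (rule tambara.val_cring[OF tambara[OF that] X])
    show ?thesis by simp
  qed
  then show ?thesis using X by (auto simp: symbols_def gmap_def)
qed

text \<open>
  The box operations always yield saturated sets, even without knowing that they are well defined on
  classes.  It is never needed that such a set is a single class.
\<close>

definition saturated :: "gset \<Rightarrow> ('i, 'a) symbol set set" where
  "saturated X = range (box_class G I T X)"

lemma saturated_symbols: "\<lbrakk>c \<in> saturated X; a \<in> c\<rbrakk> \<Longrightarrow> a \<in> symbols G I T X"
  by (auto simp: saturated_def box_class_iff)

lemma saturated_agree:
  "\<lbrakk>c \<in> saturated X; (Y, f, m) \<in> c; \<And>i. i \<in> I \<Longrightarrow> m i = m' i\<rbrakk> \<Longrightarrow> (Y, f, m') \<in> c"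
  using agree_class[of Y f m X _ m'] by (auto simp: saturated_def)

text \<open>A preimage under \<open>unname\<close> rather than the image under
  \<open>rename\<close>: the image contains only families of the form \<open>m \<circ> p\<close>, so
  it can miss symbols that differ off \<open>J\<close> and fail to be a union of classes.\<close>

definition relabel :: "gset \<Rightarrow> ('i, 'a) symbol set \<Rightarrow> ('j, 'a) symbol set" where
  "relabel X c = {b \<in> symbols G J U X. unname b \<in> c}"

lemma relabel_memD: "(Y, f, m) \<in> relabel X c \<Longrightarrow> (Y, f, m \<circ> q) \<in> c"
  by (simp add: relabel_def)

lemma relabel_memI: "\<lbrakk>c \<in> saturated X; (Y, f, m) \<in> c\<rbrakk> \<Longrightarrow> (Y, f, m \<circ> p) \<in> relabel X c"
  using saturated_agree[of c X Y f m "m \<circ> p \<circ> q"] saturated_symbols[of c X "(Y, f, m)"]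
    rename_symbols[of "(Y, f, m)" X] pq
  by (auto simp: relabel_def)

interpretation inv: relabelling G J I U T q p by (rule inverse)

text \<open>Every box operation is the saturation of a set of generating symbols. Since renaming
  preserves the equivalence, it suffices to match generators up to equivalence, in both
  directions.\<close>

lemma relabel_box_class:
  assumes 1: "\<And>a. \<lbrakk>a \<in> S; a \<in> symbols G I T X\<rbrakk> \<Longrightarrow> rename a \<in> box_class G J U X S'"
    and 2: "\<And>b. \<lbrakk>b \<in> S'; b \<in> symbols G J U X\<rbrakk> \<Longrightarrow> unname b \<in> box_class G I T X S"
  shows "relabel X (box_class G I T X S) = box_class G J U X S'"
proof (intro equalityI subsetI)
  fix b assume b: "b \<in> relabel X (box_class G I T X S)"
  then have bs: "b \<in> symbols G J U X" by (simp add: relabel_def)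
  from b obtain a where a: "a \<in> S" "a \<in> symbols G I T X" "equivclp (frobenius G I T X) a (unname b)"
    unfolding relabel_def by (auto simp: box_class_iff)
  \<comment> \<open>The round trip changes the family of \<open>b\<close> only off
    \<open>J\<close>.\<close>
  have "equivclp (frobenius G J U X) (rename (unname b)) b"
  proof -
    obtain Y f m where "b = (Y, f, m)" by (metis prod_cases3)
    then show ?thesis using inv.agree_equiv[of Y f m X "m \<circ> q \<circ> p"] bs qp by (auto intro: equivclp_sym)
  qed
  then have "equivclp (frobenius G J U X) (rename a) b"
    using rename_equiv[OF a(3)] by (meson equivclp_trans)
  then show "b \<in> box_class G J U X S'"
    using 1[OF a(1,2)] bs by (meson box_class_iff equivclp_trans)
next
  fix b assume "b \<in> box_class G J U X S'"
  then obtain a where a: "a \<in> S'" "a \<in> symbols G J U X" "b \<in> symbols G J U X"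
    "equivclp (frobenius G J U X) a b"
    by (auto simp: box_class_iff)
  show "b \<in> relabel X (box_class G I T X S)"
    using 2[OF a(1,2)] a(3) inv.rename_symbols[OF a(3)] inv.rename_equiv[OF a(4)]
    unfolding relabel_def by (simp add: box_class_iff) (meson equivclp_trans)
qed

text \<open>Most operations constrain the family of a generator only at indices in \<open>I\<close>,
  or take it from a saturated set, so their generators correspond exactly. The unit is generated by
  one particular symbol and needs the weaker criterion above.\<close>

lemma relabel_box_class_strict:
  assumes "\<And>Y f m. \<lbrakk>(Y, f, m) \<in> S; (Y, f, m) \<in> symbols G I T X\<rbrakk> \<Longrightarrow> (Y, f, m \<circ> p) \<in> S'"
    and "\<And>Y f m. \<lbrakk>(Y, f, m) \<in> S'; (Y, f, m) \<in> symbols G J U X\<rbrakk> \<Longrightarrow> (Y, f, m \<circ> q) \<in> S"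
  shows "relabel X (box_class G I T X S) = box_class G J U X S'"
proof (rule relabel_box_class)
  fix a assume "a \<in> S" "a \<in> symbols G I T X"
  then show "rename a \<in> box_class G J U X S'"
    using rename_symbols[of a X] assms(1) by (cases a) (fastforce simp: box_class_iff)
next
  fix b assume "b \<in> S'" "b \<in> symbols G J U X"
  then show "unname b \<in> box_class G I T X S"
    using inv.rename_symbols[of b X] assms(2) by (cases b) (fastforce simp: box_class_iff)
qed

lemma relabel_ops:
  assumes c: "c \<in> saturated X" "d \<in> saturated X"
  shows "relabel X (c \<otimes>\<^bsub>box_ring G I T X\<^esub> d) = relabel X c \<otimes>\<^bsub>box_ring G J U X\<^esub> relabel X d"
    and "relabel X (c \<oplus>\<^bsub>box_ring G I T X\<^esub> d) = relabel X c \<oplus>\<^bsub>box_ring G J U X\<^esub> relabel X d"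
proof -
  note I = relabel_memI[OF c(1)] relabel_memI[OF c(2)] and D = relabel_memD
  \<comment> \<open>These supply the members of \<open>c\<close>, \<open>d\<close> and of their
    relabellings as witnesses. The pullbacks and coproducts involve only the G-sets and maps of the
    symbols, so the same ones serve on both sides.\<close>
  note I1 = bexI[rotated, OF I(1)] bexI[rotated, OF I(2)] and D1 = bexI[rotated, OF D]
  show "relabel X (c \<otimes>\<^bsub>box_ring G I T X\<^esub> d) = relabel X c \<otimes>\<^bsub>box_ring G J U X\<^esub> relabel X d"
    unfolding box_ring_def monoid.simps
    apply (rule relabel_box_class_strict; clarsimp)
    subgoal
      apply (rule I1(1), assumption, simp)
      apply (rule I1(2), assumption, simp add: family p)
      apply blast
      done
    subgoal
      apply (rule D1, assumption, simp)
      apply (rule D1, assumption, simp add: family q pq)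
      apply (blast intro: p q)
      done
    done
  show "relabel X (c \<oplus>\<^bsub>box_ring G I T X\<^esub> d) = relabel X c \<oplus>\<^bsub>box_ring G J U X\<^esub> relabel X d"
    unfolding box_ring_def ring.simps
    apply (rule relabel_box_class_strict; clarsimp)
    subgoal
      apply (rule I1(1), assumption, simp)
      apply (rule I1(2), assumption, simp add: family)
      apply ((rule exI)+, intro conjI, assumption+, simp add: p)
      done
    subgoal
      apply (rule D1, assumption, simp)
      apply (rule D1, assumption, simp add: family)
      apply ((rule exI)+, intro conjI, assumption+)
      apply (intro ballI, drule (1) bspec[OF _ q], simp add: pq)
      done
    done
qed

lemma relabel_zero: "relabel X \<zero>\<^bsub>box_ring G I T X\<^esub> = \<zero>\<^bsub>box_ring G J U X\<^esub>"
  unfolding box_ring_def ring.simps by (rule relabel_box_class_strict) auto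

lemma relabel_one:
  assumes X: "is_gset G X"
  shows "relabel X \<one>\<^bsub>box_ring G I T X\<^esub> = \<one>\<^bsub>box_ring G J U X\<^esub>"
  unfolding box_ring_def monoid.simps
proof (rule relabel_box_class; clarsimp simp: comp_def)
  show "(X, id, \<lambda>j. \<one>\<^bsub>tval (T (p j)) X\<^esub>) \<in> box_class G J U X {(X, id, \<lambda>j. \<one>\<^bsub>tval (U j) X\<^esub>)}"
    and "(X, id, \<lambda>i. \<one>\<^bsub>tval (U (q i)) X\<^esub>) \<in> box_class G I T X {(X, id, \<lambda>i. \<one>\<^bsub>tval (T i) X\<^esub>)}"
    using inv.agree_class[OF inv.class_self[OF inv.one_symbol[OF X]]]
      agree_class[OF class_self[OF one_symbol[OF X]]] by (auto simp: family q pq)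
qed

lemma relabel_maps:
  assumes c: "c \<in> saturated X"
  shows "relabel Z (tres (box G I T) Z X g c) = tres (box G J U) Z X g (relabel X c)"
    and "relabel Z (ttr (box G I T) X Z g c) = ttr (box G J U) X Z g (relabel X c)"
    and "relabel Z (tnm (box G I T) X Z g c) = tnm (box G J U) X Z g (relabel X c)"
proof -
  note I = relabel_memI[OF c] and D = relabel_memD
  note I1 = bexI[rotated, OF I] and D1 = bexI[rotated, OF D]
  show "relabel Z (tres (box G I T) Z X g c) = tres (box G J U) Z X g (relabel X c)"
    unfolding box_def tambara_data.simps
    apply (rule relabel_box_class_strict; clarsimp)
    subgoal
      apply (rule I1, assumption, simp add: family p)
      apply blast
      done
    subgoal
      apply (rule D1, assumption, simp add: family q pq)
      apply (blast intro: p q)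
      done
    done
  show "relabel Z (ttr (box G I T) X Z g c) = ttr (box G J U) X Z g (relabel X c)"
    unfolding box_def tambara_data.simps
    apply (rule relabel_box_class_strict)
     apply (auto dest: I D)
    done
  show "relabel Z (tnm (box G I T) X Z g c) = tnm (box G J U) X Z g (relabel X c)"
    unfolding box_def tambara_data.simps
    apply (rule relabel_box_class_strict; clarsimp)
    subgoal
      apply (rule I1, assumption, simp add: family p)
      apply blast
      done
    subgoal
      apply (rule D1, assumption, simp add: family q pq)
      apply (blast intro: p q)
      done
    done
qed

lemma saturated_class: "box_class G I T X S \<in> saturated X"
  by (simp add: saturated_def)

lemma saturated_ops:
  "c \<otimes>\<^bsub>box_ring G I T X\<^esub> d \<in> saturated X" "c \<oplus>\<^bsub>box_ring G I T X\<^esub> d \<in> saturated X"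
  "\<zero>\<^bsub>box_ring G I T X\<^esub> \<in> saturated X"
  "tres (box G I T) X Y g c \<in> saturated X" "ttr (box G I T) Y X g c \<in> saturated X"
  "tnm (box G I T) Y X g c \<in> saturated X" "box_map G I T \<Phi> X c \<in> saturated X"
  by (simp_all add: box_ring_def box_def box_map_def saturated_class)

lemma carrier_saturated: "c \<in> carrier (tval (box G I T) X) \<Longrightarrow> c \<in> saturated X"
  by (auto simp: box_def box_ring_def saturated_class)

text \<open>Holding on all saturated sets, this also gives the injectivity needed for faces and
  sums, which may lie outside the carriers as far as is known.\<close>

lemma relabel_inverse:
  assumes c: "c \<in> saturated X"
  shows "inv.relabel X (relabel X c) = c"
proof (intro equalityI subsetI)
  fix a assume a: "a \<in> inv.relabel X (relabel X c)"
  obtain Y f m where "a = (Y, f, m)" by (metis prod_cases3)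
  then show "a \<in> c"
    using a saturated_agree[OF c, of Y f "m \<circ> p \<circ> q" m] pq by (auto simp: inv.relabel_def relabel_def)
next
  fix a assume a: "a \<in> c"
  obtain Y f m where "a = (Y, f, m)" by (metis prod_cases3)
  then show "a \<in> inv.relabel X (relabel X c)"
    using a relabel_memI[OF c] saturated_symbols[OF c] by (auto simp: inv.relabel_def)
qed

lemma relabel_carrier:
  assumes "c \<in> carrier (tval (box G I T) X)"
  shows "relabel X c \<in> carrier (tval (box G J U) X)"
proof -
  obtain a where a: "a \<in> symbols G I T X" "c = box_class G I T X {a}"
    using assms unfolding carrier_box by blast
  have "relabel X c = box_class G J U X {rename a}"
    unfolding a(2)
  proof (rule relabel_box_class)
    fix b assume "b \<in> {rename a}" "b \<in> symbols G J U X"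
    then show "unname b \<in> box_class G I T X {a}"
      using agree_class[OF class_self, of _ _ _ X] a(1) pq by (cases a) auto
  next
    show "rename b \<in> box_class G J U X {rename a}" if "b \<in> {a}" "b \<in> symbols G I T X" for b
      using inv.class_self[OF rename_symbols[OF that(2)]] that(1) by (simp only: singleton_iff)
  qed
  then show ?thesis using rename_symbols[OF a(1)] unfolding carrier_box by blast
qed

text \<open>The ambient relabelling is that of the target; the source has its own, \<open>p'\<close>
  and \<open>q'\<close>. The two transformations are compared only on families of carrier elements
  and only at indices in \<open>J\<close>, since the products over fibres can be computed only
  there. Hence generators match up to equivalence, by \<open>agree_equiv\<close>.\<close>

lemma relabel_box_map:
  assumes "relabelling G I' J' T' U' p' q'" "c \<in> relabelling.saturated G I' T' X"
    and \<Phi>: "\<And>Y m m' j. \<lbrakk>is_gset G Y; \<And>i. i \<in> I' \<Longrightarrow> m i \<in> carrier (tval (T' i) Y);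
        \<And>j. j \<in> J' \<Longrightarrow> m' j = m (p' j); j \<in> J\<rbrakk> \<Longrightarrow> \<Psi> Y m' j = \<Phi> Y m (p j)"
  shows "relabel X (box_map G I T \<Phi> X c)
    = box_map G J U \<Psi> X (relabelling.relabel G J' U' q' X c)"
proof -
  interpret src: relabelling G I' J' T' U' p' q' by fact
  have c: "c \<in> src.saturated X" by fact
  show ?thesis
    unfolding box_map_def
  proof (rule relabel_box_class)
    fix a assume "a \<in> {(Y, f, \<Phi> Y m) |Y f m. (Y, f, m) \<in> c}" and as: "a \<in> symbols G I T X"
    then obtain Y f m where a: "a = (Y, f, \<Phi> Y m)" and m: "(Y, f, m) \<in> c" by auto
    have ms: "is_gset G Y" "\<And>i. i \<in> I' \<Longrightarrow> m i \<in> carrier (tval (T' i) Y)"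
      using src.saturated_symbols[OF c m] by (auto simp: symbols_def gmap_def)
    have "equivclp (frobenius G J U X) (Y, f, \<Phi> Y m \<circ> p) (Y, f, \<Psi> Y (m \<circ> p'))"
      using rename_symbols[OF as] \<Phi>[OF ms, where m' = "m \<circ> p'"] by (intro inv.agree_equiv) (auto simp: a)
    moreover have "(Y, f, \<Psi> Y (m \<circ> p')) \<in> {(Y, f, \<Psi> Y m) |Y f m. (Y, f, m) \<in> src.relabel X c}"
      using src.relabel_memI[OF c m] by auto
    moreover have "(Y, f, \<Phi> Y m \<circ> p) \<in> symbols G J U X"
      using rename_symbols[OF as] by (simp add: a)
    ultimately show "rename a \<in> box_class G J U X {(Y, f, \<Psi> Y m) |Y f m. (Y, f, m) \<in> src.relabel X c}"
      unfolding a prod.case by (rule box_classI[rotated 2])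
  next
    fix b assume "b \<in> {(Y, f, \<Psi> Y m) |Y f m. (Y, f, m) \<in> src.relabel X c}" and bs: "b \<in> symbols G J U X"
    then obtain Y f m where b: "b = (Y, f, \<Psi> Y m)" and mr: "(Y, f, m) \<in> src.relabel X c" by auto
    have m: "(Y, f, m \<circ> q') \<in> c" using mr by (rule src.relabel_memD)
    have ms: "is_gset G Y" "\<And>i. i \<in> I' \<Longrightarrow> (m \<circ> q') i \<in> carrier (tval (T' i) Y)"
      using src.saturated_symbols[OF c m] by (auto simp: symbols_def gmap_def)
    have "(\<Psi> Y m \<circ> q) i = \<Phi> Y (m \<circ> q') i" if "i \<in> I" for i
      using \<Phi>[OF ms, of m "q i"] that by (simp add: q pq src.qp comp_def)
    then have "equivclp (frobenius G I T X) (Y, f, \<Psi> Y m \<circ> q) (Y, f, \<Phi> Y (m \<circ> q'))"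
      using inv.rename_symbols[OF bs] by (intro agree_equiv) (auto simp: b)
    moreover have "(Y, f, \<Phi> Y (m \<circ> q')) \<in> {(Y, f, \<Phi> Y m) |Y f m. (Y, f, m) \<in> c}"
      using m by auto
    moreover have "(Y, f, \<Psi> Y m \<circ> q) \<in> symbols G I T X"
      using inv.rename_symbols[OF bs] by (simp add: b)
    ultimately show "unname b \<in> box_class G I T X {(Y, f, \<Phi> Y m) |Y f m. (Y, f, m) \<in> c}"
      unfolding b prod.case by (rule box_classI[rotated 2])
  qed
qed

lemma relabel_tambara_iso: "tambara_iso G (box G I T) (box G J U) relabel"
  unfolding tambara_iso_def tambara_hom_def
proof (intro conjI allI impI ballI)
  fix X assume X: "is_gset G X"
  have v: "tval (box G I T) X = box_ring G I T X" "tval (box G J U) X = box_ring G J U X" by (simp_all add: box_def)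
  show "relabel X \<in> ring_hom (tval (box G I T) X) (tval (box G J U) X)"
  proof (rule ring_hom_memI)
    show "relabel X c \<in> carrier (tval (box G J U) X)" if "c \<in> carrier (tval (box G I T) X)" for c
      using that by (rule relabel_carrier)
    show "relabel X (c \<otimes>\<^bsub>tval (box G I T) X\<^esub> d) = relabel X c \<otimes>\<^bsub>tval (box G J U) X\<^esub> relabel X d"
      and "relabel X (c \<oplus>\<^bsub>tval (box G I T) X\<^esub> d) = relabel X c \<oplus>\<^bsub>tval (box G J U) X\<^esub> relabel X d"
      if "c \<in> carrier (tval (box G I T) X)" "d \<in> carrier (tval (box G I T) X)" for c d
      using relabel_ops[OF carrier_saturated[OF that(1)] carrier_saturated[OF that(2)]] by (simp_all only: v)
    show "relabel X \<one>\<^bsub>tval (box G I T) X\<^esub> = \<one>\<^bsub>tval (box G J U) X\<^esub>"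
      unfolding v by (rule relabel_one[OF X])
  qed
  have "relabel X ` carrier (tval (box G I T) X) \<subseteq> carrier (tval (box G J U) X)"
    by (rule image_subsetI) (rule relabel_carrier)
  moreover have "inv.relabel X ` carrier (tval (box G J U) X) \<subseteq> carrier (tval (box G I T) X)"
    by (rule image_subsetI) (rule relabelling.relabel_carrier[OF inverse])
  ultimately show "bij_betw (relabel X) (carrier (tval (box G I T) X)) (carrier (tval (box G J U) X))"
    using relabel_inverse[OF carrier_saturated] relabelling.relabel_inverse[OF inverse relabelling.carrier_saturated[OF inverse]]
    by (intro bij_betw_byWitness[where f' = "inv.relabel X"] ballI)
next
  fix X Y f assume "gmap G X Y f"
  show "relabel X (tres (box G I T) X Y f c) = tres (box G J U) X Y f (relabel Y c)"
    if "c \<in> carrier (tval (box G I T) Y)" for c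
    by (rule relabel_maps(1)[OF carrier_saturated[OF that]])
  show "relabel Y (ttr (box G I T) X Y f c) = ttr (box G J U) X Y f (relabel X c)"
    and "relabel Y (tnm (box G I T) X Y f c) = tnm (box G J U) X Y f (relabel X c)"
    if "c \<in> carrier (tval (box G I T) X)" for c
    by (rule relabel_maps(2,3)[OF carrier_saturated[OF that]])+
qed

end

section \<open>Isomorphisms of homotopy groups\<close>

text \<open>
  \<open>U\<close> contains the carriers and is closed under the operations, which the carriers of box products are
  not known to be.
\<close>

lemma mackey_iso_homotopy:
  fixes S :: "'a simplicial_data" and S' :: "'b simplicial_data" and U :: "nat \<Rightarrow> gset \<Rightarrow> 'a set"
  assumes iso: "simplicial_tambara_iso G S S' h"
    and carrier: "\<And>n X. is_gset G X \<Longrightarrow> carrier (tval (level S n) X) \<subseteq> U n X"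
    and inj: "\<And>n X. is_gset G X \<Longrightarrow> inj_on (h n X) (U n X)"
    and face: "\<And>n i X c. \<lbrakk>is_gset G X; c \<in> U (Suc n) X\<rbrakk> \<Longrightarrow> face S (Suc n) i X c \<in> U n X"
    and zero: "\<And>n X. is_gset G X \<Longrightarrow> \<zero>\<^bsub>tval (level S n) X\<^esub> \<in> U n X
          \<and> h n X \<zero>\<^bsub>tval (level S n) X\<^esub> = \<zero>\<^bsub>tval (level S' n) X\<^esub>"
    and add: "\<And>n X c d. \<lbrakk>is_gset G X; c \<in> U n X; d \<in> U n X\<rbrakk> \<Longrightarrow> c \<oplus>\<^bsub>tval (level S n) X\<^esub> d \<in> U n X
          \<and> h n X (c \<oplus>\<^bsub>tval (level S n) X\<^esub> d) = h n X c \<oplus>\<^bsub>tval (level S' n) X\<^esub> h n X d"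
    and res: "\<And>n X Y f c. \<lbrakk>gmap G X Y f; c \<in> U n Y\<rbrakk> \<Longrightarrow> tres (level S n) X Y f c \<in> U n X
          \<and> h n X (tres (level S n) X Y f c) = tres (level S' n) X Y f (h n Y c)"
    and tr: "\<And>n X Y f c. \<lbrakk>gmap G X Y f; c \<in> U n X\<rbrakk> \<Longrightarrow> ttr (level S n) X Y f c \<in> U n Y
          \<and> h n Y (ttr (level S n) X Y f c) = ttr (level S' n) X Y f (h n X c)"
  shows "mackey_iso G (homotopy S n) (homotopy S' n) (\<lambda>X C. h n X ` C)"
proof -
  have bij: "bij_betw (h n X) (carrier (tval (level S n) X)) (carrier (tval (level S' n) X))"
    if "is_gset G X" for n X
    using iso that by (simp add: simplicial_tambara_iso_def tambara_iso_def)
  have face_h: "h n X (face S (Suc n) i X c) = face S' (Suc n) i X (h (Suc n) X c)"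
    if "is_gset G X" "c \<in> carrier (tval (level S (Suc n)) X)" "i \<le> Suc n" for n X i c
  proof -
    have "Suc n \<ge> 1 \<longrightarrow> h (Suc n - 1) X (face S (Suc n) i X c) = face S' (Suc n) i X (h (Suc n) X c)"
      using iso that unfolding simplicial_tambara_iso_def by blast
    then show ?thesis by simp
  qed
  \<comment> \<open>The face is known to lie in \<open>U\<close> but not in the carrier, so it is
    injectivity on \<open>U\<close> that reflects its vanishing.\<close>
  have face_zero: "face S' (Suc n) i X (h (Suc n) X c) = \<zero>\<^bsub>tval (level S' n) X\<^esub>
      \<longleftrightarrow> face S (Suc n) i X c = \<zero>\<^bsub>tval (level S n) X\<^esub>"
    if X: "is_gset G X" and c: "c \<in> carrier (tval (level S (Suc n)) X)" and i: "i \<le> Suc n" for n X i c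
    using inj_onD[OF inj[OF X] _ face[OF X] conjunct1[OF zero[OF X]]] zero[OF X] carrier[OF X] c
      face_h[OF X c i] by force
  have img: "carrier (tval (level S' n) X) = h n X ` carrier (tval (level S n) X)"
    if "is_gset G X" for n X using bij_betw_imp_surj_on[OF bij[OF that]] by simp
  have sph: "spheres S' n X = h n X ` spheres S n X" if X: "is_gset G X" for n X
  proof (cases n)
    case 0
    then show ?thesis using img[OF X] by (simp add: spheres_def)
  next
    case (Suc k)
    then show ?thesis
      using img[OF X] face_zero[OF X] by (auto simp: spheres_def)
  qed
  have bnd: "boundaries S' n X = h n X ` boundaries S n X" if X: "is_gset G X" for n X
  proof -
    let ?Z = "{z \<in> carrier (tval (level S (Suc n)) X). \<forall>i\<le>n. face S (Suc n) i X z = \<zero>\<^bsub>tval (level S n) X\<^esub>}"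
    have "{z \<in> carrier (tval (level S' (Suc n)) X). \<forall>i\<le>n. face S' (Suc n) i X z = \<zero>\<^bsub>tval (level S' n) X\<^esub>}
        = h (Suc n) X ` ?Z"
      using img[OF X] face_zero[OF X] by auto
    moreover have "boundaries S n X = face S (Suc n) (Suc n) X ` ?Z"
      "boundaries S' n X = face S' (Suc n) (Suc n) X `
        {z \<in> carrier (tval (level S' (Suc n)) X). \<forall>i\<le>n. face S' (Suc n) i X z = \<zero>\<^bsub>tval (level S' n) X\<^esub>}"
      by (auto simp: boundaries_def)
    ultimately show ?thesis using face_h[OF X] by (simp add: image_image)
  qed
  have bndU: "boundaries S n X \<subseteq> U n X" if X: "is_gset G X" for n X
    using face[OF X subsetD[OF carrier[OF X]]] by (auto simp: boundaries_def)
  have sphU: "spheres S n X \<subseteq> U n X" if X: "is_gset G X" for n X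
    using carrier[OF X] by (auto simp: spheres_def)
  \<comment> \<open>Cosets, their products and the unions defining \<open>mres\<close> and
    \<open>mtr\<close> are all formed elementwise, so taking images under \<open>h\<close> commutes
    with them once \<open>h\<close> respects the operations on \<open>U\<close>.\<close>
  have coset: "boundaries S n X +>\<^bsub>tval (level S n) X\<^esub> c \<subseteq> U n X"
    "h n X ` (boundaries S n X +>\<^bsub>tval (level S n) X\<^esub> c)
       = boundaries S' n X +>\<^bsub>tval (level S' n) X\<^esub> h n X c"
    if X: "is_gset G X" and c: "c \<in> U n X" for X c
    using add[OF X] bndU[OF X] c unfolding bnd[OF X] a_r_coset_def' by (auto simp: image_UN) force+
  have mval: "carrier (mval (homotopy Q k) X)
      = (\<lambda>c. boundaries Q k X +>\<^bsub>tval (level Q k) X\<^esub> c) ` spheres Q k X"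
    for Q :: "'c simplicial_data" and k X
    by (auto simp: homotopy_def FactGroup_def RCOSETS_def a_r_coset_def r_coset_def)
  have mult: "A \<otimes>\<^bsub>mval (homotopy Q k) X\<^esub> B = (\<Union>a\<in>A. \<Union>b\<in>B. {a \<oplus>\<^bsub>tval (level Q k) X\<^esub> b})"
    for Q :: "'c simplicial_data" and k X A B
    by (simp add: homotopy_def FactGroup_def set_mult_def)
  have mvalU: "C \<subseteq> U n X" if X: "is_gset G X" and C: "C \<in> carrier (mval (homotopy S n) X)" for C X
  proof -
    obtain c where c: "c \<in> spheres S n X" "C = boundaries S n X +>\<^bsub>tval (level S n) X\<^esub> c"
      using C unfolding mval by (elim imageE) simp
    show ?thesis unfolding c(2) by (rule coset(1)[OF X subsetD[OF sphU[OF X] c(1)]])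
  qed
  show ?thesis
    unfolding mackey_iso_def
  proof (intro conjI allI impI ballI)
    fix X assume X: "is_gset G X"
    have im: "(`) (h n X) ` carrier (mval (homotopy S n) X) = carrier (mval (homotopy S' n) X)"
      unfolding mval sph[OF X] image_image
      by (rule image_cong[OF refl]) (use coset(2)[OF X] sphU[OF X] in auto)
    have "(`) (h n X) \<in> hom (mval (homotopy S n) X) (mval (homotopy S' n) X)"
    proof (rule homI)
      show "h n X ` C \<in> carrier (mval (homotopy S' n) X)" if "C \<in> carrier (mval (homotopy S n) X)" for C
        using im that by blast
      show "h n X ` (A \<otimes>\<^bsub>mval (homotopy S n) X\<^esub> B)
          = h n X ` A \<otimes>\<^bsub>mval (homotopy S' n) X\<^esub> h n X ` B"
        if "A \<in> carrier (mval (homotopy S n) X)" "B \<in> carrier (mval (homotopy S n) X)" for A B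
        using add[OF X subsetD[OF mvalU[OF X that(1)]] subsetD[OF mvalU[OF X that(2)]]] unfolding mult
        by (simp add: image_UN)
    qed
    \<comment> \<open>Cosets are subsets of \<open>U\<close>, and an injective map determines
      subsets by their images.\<close>
    moreover have "inj_on ((`) (h n X)) (carrier (mval (homotopy S n) X))"
      using inj_on_image_eq_iff[OF inj[OF X]] mvalU[OF X] by (intro inj_onI) blast
    ultimately show "(`) (h n X) \<in> iso (mval (homotopy S n) X) (mval (homotopy S' n) X)"
      using im by (simp add: iso_def bij_betw_def)
  next
    fix X Y f assume f: "gmap G X Y f"
    then have X: "is_gset G X" and Y: "is_gset G Y" by (simp_all add: gmap_def)
    show "h n X ` mres (homotopy S n) X Y f C = mres (homotopy S' n) X Y f (h n Y ` C)"
      if "C \<in> carrier (mval (homotopy S n) Y)" for C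
      using coset(2)[OF X] res[OF f subsetD[OF mvalU[OF Y that]]] by (simp add: homotopy_def image_UN)
    show "h n Y ` mtr (homotopy S n) X Y f C = mtr (homotopy S' n) X Y f (h n X ` C)"
      if "C \<in> carrier (mval (homotopy S n) X)" for C
      using coset(2)[OF Y] tr[OF f subsetD[OF mvalU[OF X that]]] by (simp add: homotopy_def image_UN)
  qed
qed

section \<open>The orbits of \<open>P\<close>\<close>

text \<open>The edge with cut \<open>c = 1\<close> collapses under \<open>d\<^sub>0\<close> to a
  vertex in the orbit of \<open>x\<^sub>0'\<close>, and the one with \<open>c = n\<close> collapses
  under \<open>d\<^sub>n\<close> to the orbit of \<open>x\<^sub>0\<close>. They must therefore be
  neighbours of the positions \<open>n + 1\<close> and \<open>0\<close>, which forces
  \<open>c = n + 1 - j\<close>.\<close>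

definition orbit_at :: "nat \<Rightarrow> nat \<Rightarrow> nat \<Rightarrow> psimplex set" where
  "orbit_at m n j = (if j = 0 then Vx ` {0..<m} else if j = n + 1 then Vx' ` {0..<m}
     else (\<lambda>g. Ed g (n + 1 - j)) ` {0..<2 * m})"

definition kind_at :: "nat \<Rightarrow> nat \<Rightarrow> orbit_type" where
  "kind_at n j = (if j = 0 then OD2 else if j = n + 1 then OD2' else Oe)"

lemma orbit_at_nonempty: "m \<ge> 1 \<Longrightarrow> orbit_at m n j \<noteq> {}"
  by (auto simp: orbit_at_def)

lemma simplex_type_orbit_at: "x \<in> orbit_at m n j \<Longrightarrow> simplex_type x = kind_at n j"
  by (auto simp: orbit_at_def kind_at_def split: if_splits)

lemma orbit_kind_orbit_at:
  assumes "m \<ge> 1"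
  shows "orbit_kind (orbit_at m n j) = kind_at n j"
  using orbit_at_nonempty[OF assms, of n j] simplex_type_orbit_at[of _ m n j]
  unfolding orbit_kind_def by (intro the_equality) auto

text \<open>The kind separates the two vertex orbits from each other and from the edges; among edge
  orbits the common cut of the members does.\<close>

lemma orbit_at_inj:
  assumes m: "m \<ge> 1"
  shows "inj_on (orbit_at m n) {0..n + 1}"
proof (rule inj_onI)
  fix j l assume jl: "j \<in> {0..n + 1}" "l \<in> {0..n + 1}" and e: "orbit_at m n j = orbit_at m n l"
  have k: "kind_at n j = kind_at n l" using e orbit_kind_orbit_at[OF m] by metis
  show "j = l"
  proof (cases "kind_at n j = Oe")
    case True
    then have "j \<noteq> 0" "j \<noteq> n + 1" "l \<noteq> 0" "l \<noteq> n + 1"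
      using k by (auto simp: kind_at_def split: if_splits)
    moreover from this have "Ed 0 (n + 1 - j) \<in> orbit_at m n l"
      unfolding e[symmetric] using m by (auto simp: orbit_at_def)
    ultimately have "n + 1 - j = n + 1 - l" by (auto simp: orbit_at_def)
    then show ?thesis using jl by auto
  qed (use k in \<open>auto simp: kind_at_def split: if_splits\<close>)
qed

lemma orbit_eq_orbit_at:
  assumes m: "m \<ge> 1"
  shows "k < m \<Longrightarrow> orbit (dihedral m) (P_act m) (Vx k) = orbit_at m n 0"
    and "k < m \<Longrightarrow> orbit (dihedral m) (P_act m) (Vx' k) = orbit_at m n (n + 1)"
    and "\<lbrakk>g < 2 * m; 1 \<le> j; j \<le> n\<rbrakk>
      \<Longrightarrow> orbit (dihedral m) (P_act m) (Ed g (n + 1 - j)) = orbit_at m n j"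
proof -
  interpret D: group "dihedral m" by (rule group_dihedral[OF m])
  have m0: "0 < m" using m by simp
  \<comment> \<open>Transitivity on vertices: the rotation by \<open>l - k\<close> modulo
    \<open>m\<close> takes \<open>x\<^sub>k\<close> to \<open>x\<^sub>l\<close>, and likewise for
    the primed vertices.\<close>
  have add: "addm m (subm m l k) k = l" if "k < m" "l < m" for k l
    using that m0 by (simp add: of_nat_eq_iff[where 'a = int, symmetric] int_addm int_subm mod_simps)
  have reach: "\<exists>i<m. addm m i k = l" if "k < m" "l < m" for k l
    using add[OF that] subm_less[OF m0] by blast
  have orb: "orbit (dihedral m) (P_act m) x = (\<lambda>g. P_act m g x) ` {0..<2 * m}" for x
    by (auto simp: orbit_def)
  show "orbit (dihedral m) (P_act m) (Vx k) = orbit_at m n 0"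
    and "orbit (dihedral m) (P_act m) (Vx' k) = orbit_at m n (n + 1)" if k: "k < m"
  proof -
    have "P_act m g (Vx k) \<in> Vx ` {0..<m}" "P_act m g (Vx' k) \<in> Vx' ` {0..<m}" for g
      using m0 by auto
    moreover have "Vx l \<in> (\<lambda>g. P_act m g (Vx k)) ` {0..<2 * m}" "Vx' l \<in> (\<lambda>g. P_act m g (Vx' k)) ` {0..<2 * m}"
      if l: "l < m" for l
    proof -
      obtain i where i: "i < m" "addm m i k = l" using reach[OF k l] by blast
      have "Vx l = P_act m i (Vx k)" "Vx' l = P_act m i (Vx' k)"
        using P_act_vertices(1,3)[OF k i(1)] i(2) by simp_all
      then show "Vx l \<in> (\<lambda>g. P_act m g (Vx k)) ` {0..<2 * m}" "Vx' l \<in> (\<lambda>g. P_act m g (Vx' k)) ` {0..<2 * m}"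
        using i(1) by (auto simp del: P_act.simps)
    qed
    ultimately show "orbit (dihedral m) (P_act m) (Vx k) = orbit_at m n 0"
      "orbit (dihedral m) (P_act m) (Vx' k) = orbit_at m n (n + 1)"
      unfolding orb orbit_at_def by (auto simp del: P_act.simps)
  qed
  assume g: "g < 2 * m" and j: "1 \<le> j" "j \<le> n"
  have gc: "g \<in> carrier (dihedral m)" using g by simp
  \<comment> \<open>Edges with a fixed cut form a copy of the group under left translation, so the
    orbit of the edge at \<open>g\<close> is the coset of the whole group through
    \<open>g\<close>.\<close>
  have "(\<lambda>h. h \<otimes>\<^bsub>dihedral m\<^esub> g) ` carrier (dihedral m) = carrier (dihedral m)"
  proof (intro equalityI subsetI)
    fix x assume x: "x \<in> carrier (dihedral m)"
    then have "x = (x \<otimes>\<^bsub>dihedral m\<^esub> inv\<^bsub>dihedral m\<^esub> g) \<otimes>\<^bsub>dihedral m\<^esub> g"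
      using D.m_assoc[OF x D.inv_closed[OF gc] gc] D.l_inv[OF gc] D.r_one[OF x] by metis
    then show "x \<in> (\<lambda>h. h \<otimes>\<^bsub>dihedral m\<^esub> g) ` carrier (dihedral m)"
      using D.m_closed[OF x D.inv_closed[OF gc]] by (rule image_eqI)
  qed (use gc D.m_closed in blast)
  then have "(\<lambda>h. Ed h (n + 1 - j)) ` (\<lambda>h. h \<otimes>\<^bsub>dihedral m\<^esub> g) ` carrier (dihedral m)
      = (\<lambda>h. Ed h (n + 1 - j)) ` carrier (dihedral m)"
    by (rule arg_cong)
  then show "orbit (dihedral m) (P_act m) (Ed g (n + 1 - j)) = orbit_at m n j"
    using j unfolding orb by (simp add: orbit_at_def image_image)
qed

lemma P_orbits_eq:
  assumes m: "m \<ge> 1"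
  shows "P_orbits m n = orbit_at m n ` {0..n + 1}"
proof (intro equalityI subsetI)
  fix Q assume "Q \<in> P_orbits m n"
  then obtain x where x: "x \<in> P2m m n" "Q = orbit (dihedral m) (P_act m) x" by (auto simp: orbits_def)
  from x(1) show "Q \<in> orbit_at m n ` {0..n + 1}"
  proof (cases rule: P2m_cases)
    case (3 g c)
    then show ?thesis using orbit_eq_orbit_at(3)[OF m, of g "n + 1 - c" n] x(2)
      by (auto intro!: image_eqI[of _ _ "n + 1 - c"])
  qed (use x(2) orbit_eq_orbit_at(1,2)[OF m, of _ n] in auto)
next
  fix Q assume "Q \<in> orbit_at m n ` {0..n + 1}"
  then obtain j where j: "j \<le> n + 1" "Q = orbit_at m n j" by auto
  consider "j = 0" | "j = n + 1" | "1 \<le> j" "j \<le> n" using j(1) by linarith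
  then show "Q \<in> P_orbits m n"
  proof cases
    case 1
    then show ?thesis using orbit_eq_orbit_at(1)[OF m, of 0 n] j m by (auto simp: orbits_def P2m_iff intro!: exI[of _ "Vx 0"])
  next
    case 2
    then show ?thesis using orbit_eq_orbit_at(2)[OF m, of 0 n] j m by (auto simp: orbits_def P2m_iff intro!: exI[of _ "Vx' 0"])
  next
    case 3
    then have "Q = orbit (dihedral m) (P_act m) (Ed 0 (n + 1 - j))" "Ed 0 (n + 1 - j) \<in> P2m m n"
      using orbit_eq_orbit_at(3)[OF m, of 0 j n] j(2) m by (simp_all only: P2m_iff) auto
    then show ?thesis unfolding orbits_def by blast
  qed
qed

text \<open>The edge orbits are numbered backwards, so that \<open>d\<^sub>i\<close> and \<open>s\<^sub>i\<close> act at the position \<open>n - i\<close>.\<close>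

lemma P_face_orbit_at:
  assumes m: "m \<ge> 1" and n: "n \<ge> 1" and i: "i \<le> n" and l: "l \<le> n + 1"
  shows "P_face m n i ` orbit_at m n l = orbit_at m (n - 1) (if l \<le> n - i then l else l - 1)"
proof -
  have v: "d0_edge m k = Vx' k" "d1_edge m k = Vx k" if "k < m" for k
    using that by (simp_all add: d0_edge_def d1_edge_def)
  have "d0_edge m g \<in> Vx' ` {0..<m}" "d1_edge m g \<in> Vx ` {0..<m}" if "g < 2 * m" for g
    using that by (auto simp: d0_edge_def d1_edge_def)
  moreover have "Vx' ` {0..<m} = d0_edge m ` {0..<m}" "Vx ` {0..<m} = d1_edge m ` {0..<m}"
    by (rule image_cong; simp add: v)+
  \<comment> \<open>The edges indexed by rotations alone already reach every vertex.\<close>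
  moreover have "f ` {0..<m} \<subseteq> f ` {0..<2 * m}" for f :: "nat \<Rightarrow> psimplex"
    by (intro image_mono) auto
  ultimately have d0: "d0_edge m ` {0..<2 * m} = Vx' ` {0..<m}"
    and d1: "d1_edge m ` {0..<2 * m} = Vx ` {0..<m}"
    by auto
  consider "l = 0" | "l = n + 1" | "1 \<le> l" "l \<le> n" using l by linarith
  then show ?thesis
  proof cases
    case 3
    define c where "c = n + 1 - l"
    \<comment> \<open>Here \<open>i < c\<close> means \<open>l \<le> n - i\<close>. The position of
      the cut \<open>c'\<close> in degree \<open>n - 1\<close> is \<open>n - c'\<close>, which is
      \<open>l\<close> in this case and \<open>l - 1\<close> otherwise.\<close>
    define c' where "c' = (if i < c then c - 1 else c)"
    have "P_face m n i ` orbit_at m n l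
      = (\<lambda>g. if c' = 0 then d0_edge m g else if c' = n then d1_edge m g else Ed g c') ` {0..<2 * m}"
      using 3 by (simp add: orbit_at_def image_image c_def c'_def Let_def)
    moreover have "c' = 0 \<longleftrightarrow> (if l \<le> n - i then l else l - 1) = n"
      "c' = n \<longleftrightarrow> (if l \<le> n - i then l else l - 1) = 0"
      "c' = n - (if l \<le> n - i then l else l - 1)"
      using 3 i n by (auto simp: c_def c'_def)
    ultimately show ?thesis using n d0 d1 by (simp add: orbit_at_def)
  qed (use n i in \<open>simp_all add: orbit_at_def image_image\<close>)
qed

lemma P_degen_orbit_at:
  assumes i: "i \<le> n" and l: "l \<le> n + 1"
  shows "P_degen i ` orbit_at m n l = orbit_at m (n + 1) (if l \<le> n - i then l else l + 1)"
proof -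
  consider "l = 0" | "l = n + 1" | "1 \<le> l" "l \<le> n" using l by linarith
  then show ?thesis
    by cases (use i in \<open>auto simp: orbit_at_def image_image\<close>)
qed

text \<open>Injectivity of \<open>orbit_at\<close> in degree \<open>k\<close> turns the condition on
  orbits into an equation of positions, so that fibres become explicit sets of numbers.\<close>

lemma fibre_orbit_at:
  assumes m: "m \<ge> 1"
    and d: "\<And>l. l \<le> n + 1 \<Longrightarrow> d ` orbit_at m n l = orbit_at m k (pos l) \<and> pos l \<le> k + 1"
    and j: "j \<le> k + 1"
  shows "{Q \<in> P_orbits m n. d ` Q = orbit_at m k j} = orbit_at m n ` {l. l \<le> n + 1 \<and> pos l = j}"
  using d j inj_onD[OF orbit_at_inj[OF m, of k]] unfolding P_orbits_eq[OF m] by fastforce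

lemma (in comm_monoid) finprod_one_or_two:
  shows "f x \<in> carrier G \<Longrightarrow> finprod G f {x} = f x"
    and "\<lbrakk>x \<noteq> y; f x \<in> carrier G; f y \<in> carrier G\<rbrakk> \<Longrightarrow> finprod G f {x, y} = f x \<otimes> f y"
  by (simp_all add: finprod_insert)

lemma bar_family_eq:
  "bar_family (loday_coeff m \<phi> R OD2) (loday_coeff m \<phi> R Oe) (loday_coeff m \<phi> R OD2') n j
     = loday_coeff m \<phi> R (kind_at n j)"
  by (simp add: bar_family_def kind_at_def)

section \<open>Fold maps of the Loday construction as bar faces and degeneracies\<close>

context
  fixes m :: nat and \<phi> :: "nat \<Rightarrow> nat" and R :: "'a tambara_data"
  assumes m: "m \<ge> 1"
    and coeff: "\<And>t. tambara (dihedral m) (loday_coeff m \<phi> R t)"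
    and act_M: "\<And>X c. \<lbrakk>is_gset (dihedral m) X; c \<in> carrier (tval (loday_coeff m \<phi> R Oe) X)\<rbrakk>
        \<Longrightarrow> act_M m R X c \<in> carrier (tval (loday_coeff m \<phi> R OD2) X)"
    and act_N: "\<And>X c. \<lbrakk>is_gset (dihedral m) X; c \<in> carrier (tval (loday_coeff m \<phi> R Oe) X)\<rbrakk>
        \<Longrightarrow> act_N m \<phi> R X c \<in> carrier (tval (loday_coeff m \<phi> R OD2') X)"
begin

text \<open>The fibre of \<open>d\<^sub>i\<close> over a position is a single position, except over
  \<open>n - i\<close>, where it consists of \<open>n - i\<close> and \<open>n - i + 1\<close>. The
  product is then the multiplication of these two factors. Carrier membership of \<open>a\<close> is
  what allows \<open>finprod\<close> to be evaluated.\<close>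

lemma loday_map_face:
  assumes n: "n \<ge> 1" and i: "i \<le> n" and Y: "is_gset (dihedral m) Y" and j: "j \<le> n"
    and a: "\<And>l. l \<le> n + 1 \<Longrightarrow> a (orbit_at m n l) \<in> carrier (tval (loday_coeff m \<phi> R (kind_at n l)) Y)"
    and b: "\<And>l. l \<le> n + 1 \<Longrightarrow> b l = a (orbit_at m n l)"
  shows "loday_map m \<phi> R (P_orbits m n) (P_face m n i) Y a (orbit_at m (n - 1) j)
    = bar_face (loday_coeff m \<phi> R OD2) (loday_coeff m \<phi> R Oe) (loday_coeff m \<phi> R OD2')
        (act_M m R) (act_N m \<phi> R) n i Y b j"
proof -
  let ?p = "\<lambda>l. loday_proj m \<phi> R (kind_at n l) (kind_at (n - 1) j) Y (a (orbit_at m n l))"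
  interpret cring "tval (loday_coeff m \<phi> R (kind_at (n - 1) j)) Y"
    by (rule tambara.val_cring[OF coeff Y])
  define k where "k = n - i"
  have k: "k \<le> n" by (simp add: k_def)
  let ?f = "\<lambda>Q. loday_proj m \<phi> R (orbit_kind Q) (kind_at (n - 1) j) Y (a Q)"
  have "{Q \<in> P_orbits m n. P_face m n i ` Q = orbit_at m (n - 1) j}
      = orbit_at m n ` {l. l \<le> n + 1 \<and> (if l \<le> k then l else l - 1) = j}"
    using P_face_orbit_at[OF m n i] j n i by (intro fibre_orbit_at[OF m]) (auto simp: k_def)
  moreover have "{l. l \<le> n + 1 \<and> (if l \<le> k then l else l - 1) = j}
      = (if j < k then {j} else if j = k then {j, j + 1} else {j + 1})"
    using j k by (auto split: if_splits)
  ultimately have S: "{Q \<in> P_orbits m n. P_face m n i ` Q = orbit_at m (n - 1) j}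
      = orbit_at m n ` (if j < k then {j} else if j = k then {j, j + 1} else {j + 1})"
    by (simp only:)
  have ne: "orbit_at m n l \<noteq> orbit_at m n (l + 1)" if "l \<le> n" for l
    using inj_onD[OF orbit_at_inj[OF m, of n], of l "l + 1"] that by auto
  have f: "?f (orbit_at m n l) = ?p l" for l
    by (simp add: orbit_kind_orbit_at[OF m])
  \<comment> \<open>An orbit either keeps its kind or is an edge orbit projected to a vertex orbit,
    so the factor map is the identity, \<open>act_M\<close> or \<open>act_N\<close>.\<close>
  have p: "?p l \<in> carrier (tval (loday_coeff m \<phi> R (kind_at (n - 1) j)) Y)
      \<and> ?p l = (if kind_at n l = kind_at (n - 1) j then b l
       else if kind_at (n - 1) j = OD2 then act_M m R Y (b l) else act_N m \<phi> R Y (b l))"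
    if l: "l \<le> n + 1" "(if l \<le> k then l else l - 1) = j" for l
  proof -
    have "kind_at n l = kind_at (n - 1) j \<or> kind_at n l = Oe \<and> kind_at (n - 1) j \<noteq> Oe"
      using l n k by (auto simp: kind_at_def split: if_splits)
    then consider "kind_at n l = kind_at (n - 1) j" | "kind_at n l = Oe" "kind_at (n - 1) j = OD2"
      | "kind_at n l = Oe" "kind_at (n - 1) j = OD2'"
      by (cases "kind_at (n - 1) j") auto
    then show ?thesis
    proof cases
      case 1
      then show ?thesis using a[OF l(1)] b[OF l(1)] by (cases "kind_at (n - 1) j") auto
    next
      case 2
      then show ?thesis using act_M[OF Y] a[OF l(1)] b[OF l(1)] by simp
    next
      case 3
      then show ?thesis using act_N[OF Y] a[OF l(1)] b[OF l(1)] by simp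
    qed
  qed
  have L: "loday_map m \<phi> R (P_orbits m n) (P_face m n i) Y a (orbit_at m (n - 1) j)
      = finprod (tval (loday_coeff m \<phi> R (kind_at (n - 1) j)) Y) ?f
          (orbit_at m n ` (if j < k then {j} else if j = k then {j, j + 1} else {j + 1}))"
    unfolding loday_map_def orbit_kind_orbit_at[OF m] S by (rule refl)
  have single: "finprod (tval (loday_coeff m \<phi> R (kind_at (n - 1) j)) Y) ?f {orbit_at m n l} = b l"
    if "l \<le> n + 1" "(if l \<le> k then l else l - 1) = j" "kind_at n l = kind_at (n - 1) j" for l
  proof -
    have "?p l = b l" using p[OF that(1,2)] that(3) by auto
    then show ?thesis
      using finprod_one_or_two(1)[of ?f "orbit_at m n l"] conjunct1[OF p[OF that(1,2)]] unfolding f by simp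
  qed
  consider "j < k" | "j = k" | "j > k" by linarith
  then show ?thesis
  proof cases
    case 1
    then have "kind_at n j = kind_at (n - 1) j" using k n by (auto simp: kind_at_def)
    then show ?thesis
      unfolding L using single[of j] 1 j by (simp add: bar_face_def k_def[symmetric] Let_def)
  next
    case 2
    note pk = p[of k] p[of "k + 1"]
    have q: "?p k \<in> carrier (tval (loday_coeff m \<phi> R (kind_at (n - 1) j)) Y)"
      "?p (k + 1) \<in> carrier (tval (loday_coeff m \<phi> R (kind_at (n - 1) j)) Y)"
      using pk 2 j by auto
    have "finprod (tval (loday_coeff m \<phi> R (kind_at (n - 1) j)) Y) ?f {orbit_at m n k, orbit_at m n (k + 1)}
        = ?p k \<otimes>\<^bsub>tval (loday_coeff m \<phi> R (kind_at (n - 1) j)) Y\<^esub> ?p (k + 1)"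
      using finprod_one_or_two(2)[OF ne[OF k], of ?f] q unfolding f by blast
    then have L': "loday_map m \<phi> R (P_orbits m n) (P_face m n i) Y a (orbit_at m (n - 1) j)
        = ?p k \<otimes>\<^bsub>tval (loday_coeff m \<phi> R (kind_at (n - 1) j)) Y\<^esub> ?p (k + 1)"
      unfolding L using 2 by simp
    \<comment> \<open>These are the action on the left module, the action on the right module, and
      the multiplication of two copies of the algebra.\<close>
    consider "k = 0" | "0 < k" "k = n" | "0 < k" "k < n" using k by linarith
    then show ?thesis
      unfolding L' using pk 2 n j
      by cases (simp_all add: kind_at_def bar_face_def k_def[symmetric] Let_def)
  next
    case 3
    then have "kind_at n (j + 1) = kind_at (n - 1) j" using k n by (auto simp: kind_at_def)
    then show ?thesis
      unfolding L using single[of "j + 1"] 3 j by (simp add: bar_face_def k_def[symmetric] Let_def)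
  qed
qed

lemma loday_map_degen:
  assumes i: "i \<le> n" and Y: "is_gset (dihedral m) Y" and j: "j \<le> n + 2"
    and a: "\<And>l. l \<le> n + 1 \<Longrightarrow> a (orbit_at m n l) \<in> carrier (tval (loday_coeff m \<phi> R (kind_at n l)) Y)"
    and b: "\<And>l. l \<le> n + 1 \<Longrightarrow> b l = a (orbit_at m n l)"
  shows "loday_map m \<phi> R (P_orbits m n) (P_degen i) Y a (orbit_at m (n + 1) j)
    = bar_degen (loday_coeff m \<phi> R Oe) n i Y b j"
proof -
  interpret cring "tval (loday_coeff m \<phi> R (kind_at (n + 1) j)) Y"
    by (rule tambara.val_cring[OF coeff Y])
  define k where "k = n - i"
  have k: "k \<le> n" by (simp add: k_def)
  let ?f = "\<lambda>Q. loday_proj m \<phi> R (orbit_kind Q) (kind_at (n + 1) j) Y (a Q)"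
  have "{Q \<in> P_orbits m n. P_degen i ` Q = orbit_at m (n + 1) j}
      = orbit_at m n ` {l. l \<le> n + 1 \<and> (if l \<le> k then l else l + 1) = j}"
    using P_degen_orbit_at[OF i] j by (intro fibre_orbit_at[OF m]) (auto simp: k_def)
  moreover have "{l. l \<le> n + 1 \<and> (if l \<le> k then l else l + 1) = j}
      = (if j \<le> k then {j} else if j = k + 1 then {} else {j - 1})"
    using j k by (auto split: if_splits)
  ultimately have L: "loday_map m \<phi> R (P_orbits m n) (P_degen i) Y a (orbit_at m (n + 1) j)
      = finprod (tval (loday_coeff m \<phi> R (kind_at (n + 1) j)) Y) ?f
          (orbit_at m n ` (if j \<le> k then {j} else if j = k + 1 then {} else {j - 1}))"
    unfolding loday_map_def orbit_kind_orbit_at[OF m] by (simp only:)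
  have single: "finprod (tval (loday_coeff m \<phi> R (kind_at (n + 1) j)) Y) ?f {orbit_at m n l} = b l"
    if l: "l \<le> n + 1" "kind_at n l = kind_at (n + 1) j" for l
  proof -
    have "?f (orbit_at m n l) = b l"
      using l b by (cases "kind_at (n + 1) j") (simp_all add: orbit_kind_orbit_at[OF m])
    then show ?thesis using a[OF l(1)] b[OF l(1)] l(2) finprod_one_or_two(1)[of ?f "orbit_at m n l"] by simp
  qed
  consider "j \<le> k" | "j = k + 1" | "j > k + 1" by linarith
  then show ?thesis
  proof cases
    case 1
    then have "kind_at n j = kind_at (n + 1) j" using k by (auto simp: kind_at_def)
    then show ?thesis
      unfolding L using single[of j] 1 k by (simp add: bar_degen_def k_def[symmetric] Let_def)
  next
    \<comment> \<open>The new position is hit by no orbit. As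
      \<open>1 \<le> k + 1 \<le> n + 1\<close>, it is never an end in degree \<open>n + 1\<close>,
      so the empty product is the unit of the edge coefficient.\<close>
    case 2
    then have "kind_at (n + 1) j = Oe" using k by (simp add: kind_at_def)
    then show ?thesis
      unfolding L using 2 finprod_empty[of ?f] by (simp add: bar_degen_def k_def[symmetric] Let_def)
  next
    case 3
    then have "kind_at n (j - 1) = kind_at (n + 1) j" using j by (auto simp: kind_at_def)
    then show ?thesis
      unfolding L using single[of "j - 1"] 3 j by (simp add: bar_degen_def k_def[symmetric] Let_def)
  qed
qed

end

section \<open>Maps out of norms\<close>

text \<open>With no tests, \<open>norm_tests\<close> says that \<open>R\<close> is closed under its
  operations, which is the hypothesis of \<open>norm_universal_closed\<close>. A restriction has
  this closure by induction of G-sets, and in this form \<open>ring_e\<close> is fed into the norms.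
  The type annotation fixes the type of the empty set.\<close>

abbreviation closed_data :: "nat monoid \<Rightarrow> nat set \<Rightarrow> 'a tambara_data \<Rightarrow> bool" where
  "closed_data G H R \<equiv> norm_tests G H R ({} :: ('a norm_val tambara_data \<times> (gset \<Rightarrow> 'a \<Rightarrow> 'a norm_val)) set)"

text \<open>The existence half of universality, at the value type of \<open>T\<close>, shows that
  the choice in \<open>adjoint_map\<close> has a witness.\<close>

lemma adjoint_map_hom:
  fixes R :: "'a tambara_data" and T :: "'b tambara_data"
  assumes G: "group G" "finite (carrier G)" "subgroup H G"
    and R: "closed_data G H R"
    and T: "tambara G T" and f: "tambara_hom (subgrp G H) R (restr G H T) f"
  shows "tambara_hom G (norm G H R) T (adjoint_map G H R T f)"
proof -
  have "universal_arrow G H R (norm G H R) (norm_unit G H R) TYPE('b)"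
    by (rule norm_universal_closed[OF G R])
  then have "\<exists>h. tambara_hom G (norm G H R) T h \<and> (\<forall>X. is_gset (subgrp G H) X \<longrightarrow>
      (\<forall>x\<in>carrier (tval R X). h (ind G H X) (norm_unit G H R X x) = f X x))"
    using T f unfolding universal_arrow_def by blast
  from someI_ex[OF this] show ?thesis unfolding adjoint_map_def by blast
qed

lemma norm_unit_hom:
  assumes "group G" "finite (carrier G)" "subgroup H G" "closed_data G H R"
  shows "tambara G (norm G H R)" and "tambara_hom (subgrp G H) R (restr G H (norm G H R)) (norm_unit G H R)"
  using norm_pair_exists[OF assms] by (simp_all add: universal_arrow_def)

lemma norm_tests_restr:
  assumes G: "group G" "finite (carrier G)" "subgroup H G" and T: "tambara G T"
  shows "closed_data G H (restr G H T)"
proof -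
  have r: "ring (tval T (ind G H X))" if "is_gset (subgrp G H) X" for X
    using tambara.val_cring[OF T is_gset_ind[OF G that]] by (simp add: cring_def)
  show ?thesis
    using G tambara.map_closed[OF T gmap_ind[OF G]]
    by (intro norm_tests.intro) (simp_all add: restr_def ring.ring_simprules(1,5,6)[OF r])
qed

lemma norm_tests_transfer:
  assumes "closed_data G H R" "group G'" "finite (carrier G')" "subgroup H G'" "subgrp G' H = subgrp G H"
  shows "closed_data G' H R"
  using assms unfolding norm_tests_def by simp

lemma tambara_hom_restr:
  assumes G: "group G" "finite (carrier G)" "subgroup H G" and h: "tambara_hom G S T h"
  shows "tambara_hom (subgrp G H) (restr G H S) (restr G H T) (\<lambda>X. h (ind G H X))"
  using h is_gset_ind[OF G] gmap_ind[OF G] by (simp add: tambara_hom_def restr_def)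

lemma counit_hom:
  assumes G: "group G" "finite (carrier G)" "subgroup H G" and T: "tambara G T"
  shows "tambara_hom G (norm G H (restr G H T)) T (counit G H T)"
  unfolding counit_def
  by (rule adjoint_map_hom[OF G norm_tests_restr[OF G T] T]) (simp add: tambara_hom_def ring_hom_def)

lemma norm_map_hom:
  assumes G: "group G" "finite (carrier G)" "subgroup H G"
    and R: "closed_data G H R" and S: "closed_data G H S" and f: "tambara_hom (subgrp G H) R S f"
  shows "tambara_hom G (norm G H R) (norm G H S) (norm_map G H R S f)"
  unfolding norm_map_def
  by (rule adjoint_map_hom[OF G R norm_unit_hom(1)[OF G S] tambara_hom_comp[OF f norm_unit_hom(2)[OF G S]]])

text \<open>Common form of a restriction, of an iterated restriction and of the restriction of a
  \<open>pull\<close>. Reordering and the twisted counit both compare two such forms along a natural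
  bijection of G-sets.\<close>

definition reindex :: "'a tambara_data \<Rightarrow> (gset \<Rightarrow> gset) \<Rightarrow> ((nat \<Rightarrow> nat) \<Rightarrow> nat \<Rightarrow> nat) \<Rightarrow> 'a tambara_data" where
  "reindex T A a = \<lparr>
     tval = (\<lambda>X. tval T (A X)),
     tres = (\<lambda>X Y f. tres T (A X) (A Y) (a f)),
     ttr = (\<lambda>X Y f. ttr T (A X) (A Y) (a f)),
     tnm = (\<lambda>X Y f. tnm T (A X) (A Y) (a f)) \<rparr>"

text \<open>A naturality square with two opposite sides bijective is a pullback. Base change then
  gives compatibility with transfers and norms, while restrictions only use functoriality. The map
  goes from \<open>B\<close> to \<open>A\<close> because it is a restriction along
  \<open>\<theta>\<close>.\<close>

lemma reindex_hom:
  assumes T: "tambara G T"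
    and \<theta>: "\<And>X. is_gset L X \<Longrightarrow> gmap G (A X) (B X) (\<theta> X) \<and> bij_betw (\<theta> X) (pts (A X)) (pts (B X))"
    and a: "\<And>X Y f. gmap L X Y f \<Longrightarrow> gmap G (A X) (A Y) (a f)"
    and b: "\<And>X Y f. gmap L X Y f \<Longrightarrow> gmap G (B X) (B Y) (b f)"
    and nat: "\<And>X Y f c. \<lbrakk>gmap L X Y f; c \<in> pts (A X)\<rbrakk> \<Longrightarrow> \<theta> Y (a f c) = b f (\<theta> X c)"
  shows "tambara_hom L (reindex T B b) (reindex T A a) (\<lambda>X. tres T (A X) (B X) (\<theta> X))"
proof -
  interpret tambara G T by fact
  show ?thesis
    unfolding tambara_hom_def
  proof (intro conjI allI impI ballI)
    fix X assume "is_gset L X"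
    then show "tres T (A X) (B X) (\<theta> X) \<in> ring_hom (tval (reindex T B b) X) (tval (reindex T A a) X)"
      using res_hom \<theta> by (simp add: reindex_def)
  next
    fix X Y f assume f: "gmap L X Y f"
    then have X: "is_gset L X" and Y: "is_gset L Y" by (simp_all add: gmap_def)
    have \<theta>X: "gmap G (A X) (B X) (\<theta> X)" and \<theta>Y: "gmap G (A Y) (B Y) (\<theta> Y)" using \<theta>[OF X] \<theta>[OF Y] by auto
    have iX: "inj_on (\<theta> X) (pts (A X))" "\<theta> X ` pts (A X) = pts (B X)"
      and iY: "inj_on (\<theta> Y) (pts (A Y))"
      using \<theta>[OF X] \<theta>[OF Y] by (auto simp: bij_betw_def)
    have af: "a f c \<in> pts (A Y)" if "c \<in> pts (A X)" for c using a[OF f] that by (auto simp: gmap_def)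
    have uniq: "\<exists>!w. w \<in> pts (A X) \<and> \<theta> X w = x \<and> a f w = y"
      if x: "x \<in> pts (B X)" and y: "y \<in> pts (A Y)" and e: "b f x = \<theta> Y y" for x y
    proof -
      obtain w where w: "w \<in> pts (A X)" "\<theta> X w = x" using x unfolding iX(2)[symmetric] by (elim imageE) simp
      have "\<theta> Y (a f w) = \<theta> Y y" using nat[OF f w(1)] w(2) e by simp
      then have "a f w = y" by (rule inj_onD[OF iY _ af[OF w(1)] y])
      moreover have "v = w" if "v \<in> pts (A X)" "\<theta> X v = x" for v
        by (rule inj_onD[OF iX(1) _ that(1) w(1)]) (simp add: w(2) that(2))
      ultimately show ?thesis using w by blast
    qed
    have pb: "is_pullback G (A X) (B X) (A Y) (B Y) (\<theta> X) (a f) (b f) (\<theta> Y)"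
      unfolding is_pullback_def
    proof (intro conjI ballI impI)
      show "b f (\<theta> X w) = \<theta> Y (a f w)" if "w \<in> pts (A X)" for w
        using nat[OF f that] by (rule sym)
    qed (fact \<theta>X \<theta>Y a[OF f] b[OF f] | rule uniq, assumption+)+
    show "tres T (A X) (B X) (\<theta> X) (tres (reindex T B b) X Y f c)
        = tres (reindex T A a) X Y f (tres T (A Y) (B Y) (\<theta> Y) c)"
      if "c \<in> carrier (tval (reindex T B b) Y)" for c
    proof -
      have c: "c \<in> carrier (tval T (B Y))" using that by (simp add: reindex_def)
      have g: "gmap G (A X) (B Y) (\<theta> Y \<circ> a f)" 
        using a[OF f] \<theta>Y by (auto simp: gmap_def)
      have "tres T (A X) (B Y) (\<theta> Y \<circ> a f) c = tres T (A X) (B Y) (b f \<circ> \<theta> X) c"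
        using map_cong[OF g, of "b f \<circ> \<theta> X"] nat[OF f] c by simp
      then show ?thesis
        using res_comp[OF \<theta>X b[OF f] c] res_comp[OF a[OF f] \<theta>Y c] by (simp add: reindex_def)
    qed
    show "tres T (A Y) (B Y) (\<theta> Y) (ttr (reindex T B b) X Y f c)
        = ttr (reindex T A a) X Y f (tres T (A X) (B X) (\<theta> X) c)"
      and "tres T (A Y) (B Y) (\<theta> Y) (tnm (reindex T B b) X Y f c)
        = tnm (reindex T A a) X Y f (tres T (A X) (B X) (\<theta> X) c)"
      if "c \<in> carrier (tval (reindex T B b) X)" for c
      using tr_base_change[OF pb] nm_base_change[OF pb] that by (simp_all add: reindex_def)
  qed
qed

lemma coset_rep_trivial:
  assumes "group G" "g \<in> carrier G"
  shows "coset_rep G {\<one>\<^bsub>G\<^esub>} g = g"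
proof -
  interpret group G by fact
  show ?thesis using assms(2) by (auto simp: coset_rep_def l_coset_def intro!: Least_equality)
qed

lemma ind_trivial:
  assumes "group G" and X: "is_gset (subgrp G {\<one>\<^bsub>G\<^esub>}) X"
  shows "pts (ind G {\<one>\<^bsub>G\<^esub>} X) = {prod_encode (t, x) | t x. t \<in> carrier G \<and> x \<in> pts X}"
    and "\<lbrakk>g \<in> carrier G; t \<in> carrier G; x \<in> pts X\<rbrakk>
      \<Longrightarrow> act (ind G {\<one>\<^bsub>G\<^esub>} X) g (prod_encode (t, x)) = prod_encode (g \<otimes>\<^bsub>G\<^esub> t, x)"
proof -
  interpret group G by fact
  show "pts (ind G {\<one>\<^bsub>G\<^esub>} X) = {prod_encode (t, x) | t x. t \<in> carrier G \<and> x \<in> pts X}"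
    using coset_rep_trivial[OF assms(1)] by (auto simp: ind_def)
  assume g: "g \<in> carrier G" "t \<in> carrier G" "x \<in> pts X"
  have "act X \<one>\<^bsub>G\<^esub> x = x" using X g(3) by (simp add: is_gset_def)
  then show "act (ind G {\<one>\<^bsub>G\<^esub>} X) g (prod_encode (t, x)) = prod_encode (g \<otimes>\<^bsub>G\<^esub> t, x)"
    using g coset_rep_trivial[OF assms(1)] l_inv[of "g \<otimes>\<^bsub>G\<^esub> t"] by (simp add: ind_def Let_def m_assoc)
qed

section \<open>Induction in stages from the trivial subgroup\<close>

context
  fixes G :: "nat monoid" and K :: "nat set"
  assumes G: "group G" "finite (carrier G)" and K: "subgroup K G"
begin

interpretation group G by (rule G(1))
interpretation K: subgroup K G by (rule K)

private abbreviation (input) "L \<equiv> {\<one>\<^bsub>G\<^esub>}"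
private abbreviation (input) "GK \<equiv> subgrp G K"

lemma subgroup_facts: "group GK" "finite (carrier GK)" "subgroup L G" "subgroup L GK"
proof -
  show GK: "group GK" using K.subgroup_is_group[OF G(1)] .
  show "finite (carrier GK)" using finite_subset[OF K.subset G(2)] by simp
  show "subgroup L G" by (rule triv_subgroup)
  show "subgroup L GK" using group.triv_subgroup[OF GK] by simp
qed

lemmas GK = subgroup_facts(1,2) and L = subgroup_facts(3,4)

text \<open>With \<open>u\<close> the representative of the coset of \<open>t\<close>, the map
  splits \<open>t\<close> as \<open>u\<close> times an element of \<open>K\<close>; multiplying the
  two parts together inverts it.\<close>

lemma ind_assoc_trivial:
  assumes X: "is_gset (subgrp G L) X"
  shows "\<lbrakk>t \<in> carrier G; x \<in> pts X\<rbrakk> \<Longrightarrow> ind_assoc G K L X (prod_encode (t, x))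
      = prod_encode (coset_rep G K t, prod_encode (inv\<^bsub>G\<^esub> (coset_rep G K t) \<otimes>\<^bsub>G\<^esub> t, x))"
    and "gmap G (ind G L X) (ind G K (ind GK L X)) (ind_assoc G K L X)"
    and "bij_betw (ind_assoc G K L X) (pts (ind G L X)) (pts (ind G K (ind GK L X)))"
proof -
  note rep = coset_rep_facts[OF G(1) K]
  have XK: "is_gset (subgrp GK L) X" using X by simp
  have repK: "coset_rep GK L k = k" if "k \<in> K" for k
    using coset_rep_trivial[OF GK(1), of k] that by simp
  have X1: "act X \<one>\<^bsub>G\<^esub> x = x" if "x \<in> pts X" for x using X that by (simp add: is_gset_def)
  show formula: "ind_assoc G K L X (prod_encode (t, x))
      = prod_encode (coset_rep G K t, prod_encode (inv\<^bsub>G\<^esub> (coset_rep G K t) \<otimes>\<^bsub>G\<^esub> t, x))"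
    if t: "t \<in> carrier G" and x: "x \<in> pts X" for t x
  proof -
    let ?u = "coset_rep G K t"
    have u: "?u \<in> carrier G" "inv\<^bsub>G\<^esub> ?u \<otimes>\<^bsub>G\<^esub> t \<in> K" using rep(1,2)[OF t] by auto
    have "inv\<^bsub>G\<^esub> (inv\<^bsub>G\<^esub> ?u \<otimes>\<^bsub>G\<^esub> t) \<otimes>\<^bsub>G\<^esub> inv\<^bsub>G\<^esub> ?u \<otimes>\<^bsub>G\<^esub> t = \<one>\<^bsub>G\<^esub>"
      using l_inv[of "inv\<^bsub>G\<^esub> ?u \<otimes>\<^bsub>G\<^esub> t"] u(1) t by (simp add: m_assoc)
    then show ?thesis using repK[OF u(2)] X1[OF x] by (simp add: ind_assoc_def Let_def)
  qed
  have ptsL: "pts (ind G L X) = {prod_encode (t, x) | t x. t \<in> carrier G \<and> x \<in> pts X}"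
    by (rule ind_trivial(1)[OF G(1) X])
  have ptsK: "pts (ind GK L X) = {prod_encode (t, x) | t x. t \<in> K \<and> x \<in> pts X}"
    using ind_trivial(1)[OF GK(1)] XK by simp
  have ptsGK: "pts (ind G K (ind GK L X)) = {prod_encode (u, prod_encode (k, x)) | u k x.
      u \<in> coset_rep G K ` carrier G \<and> k \<in> K \<and> x \<in> pts X}"
    unfolding ind_def[of G K] ptsK by auto
  have actK: "act (ind GK L X) k (prod_encode (l, x)) = prod_encode (k \<otimes>\<^bsub>G\<^esub> l, x)"
    if "k \<in> K" "l \<in> K" "x \<in> pts X" for k l x
    using ind_trivial(2)[OF GK(1)] XK that by simp
  show "gmap G (ind G L X) (ind G K (ind GK L X)) (ind_assoc G K L X)"
    unfolding gmap_def
  proof (intro conjI ballI)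
    show "is_gset G (ind G L X)" by (rule is_gset_ind[OF G L(1) X])
    show "is_gset G (ind G K (ind GK L X))"
      using is_gset_ind[OF G K is_gset_ind[OF GK L(2) XK]] .
    show "ind_assoc G K L X \<in> pts (ind G L X) \<rightarrow> pts (ind G K (ind GK L X))"
      unfolding ptsL ptsGK using formula rep(2) by fastforce
    fix g c assume g: "g \<in> carrier G" and "c \<in> pts (ind G L X)"
    then obtain t x where c: "c = prod_encode (t, x)" and t: "t \<in> carrier G" and x: "x \<in> pts X"
      unfolding ptsL by auto
    let ?u = "coset_rep G K t" and ?w = "coset_rep G K (g \<otimes>\<^bsub>G\<^esub> t)"
    have u: "?u \<in> carrier G" "inv\<^bsub>G\<^esub> ?u \<otimes>\<^bsub>G\<^esub> t \<in> K" using rep(1,2)[OF t] by auto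
    have w: "?w \<in> carrier G" "inv\<^bsub>G\<^esub> ?w \<otimes>\<^bsub>G\<^esub> (g \<otimes>\<^bsub>G\<^esub> t) \<in> K" using rep(1,2)[of "g \<otimes>\<^bsub>G\<^esub> t"] g t by auto
    \<comment> \<open>The second factor lies in \<open>K\<close>, so the products of
      \<open>g\<close> with \<open>?u\<close> and with \<open>t\<close> share their representative
      \<open>?w\<close>. The \<open>K\<close>-component is then the one prescribed by the action of
      \<open>g\<close>.\<close>
    have gt: "(g \<otimes>\<^bsub>G\<^esub> ?u) \<otimes>\<^bsub>G\<^esub> (inv\<^bsub>G\<^esub> ?u \<otimes>\<^bsub>G\<^esub> t) = g \<otimes>\<^bsub>G\<^esub> t"
      using g t u(1) by (simp add: m_assoc) (simp add: m_assoc[symmetric])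
    have gu: "coset_rep G K (g \<otimes>\<^bsub>G\<^esub> ?u) = ?w"
      using rep(3)[of "g \<otimes>\<^bsub>G\<^esub> ?u", OF _ u(2)] g u(1) gt by simp
    have k: "inv\<^bsub>G\<^esub> ?w \<otimes>\<^bsub>G\<^esub> g \<otimes>\<^bsub>G\<^esub> ?u \<in> K"
      using rep(2)[of "g \<otimes>\<^bsub>G\<^esub> ?u"] gu g u(1) w(1) by (simp add: m_assoc)
    have "inv\<^bsub>G\<^esub> ?w \<otimes>\<^bsub>G\<^esub> g \<otimes>\<^bsub>G\<^esub> ?u \<otimes>\<^bsub>G\<^esub> (inv\<^bsub>G\<^esub> ?u \<otimes>\<^bsub>G\<^esub> t) = inv\<^bsub>G\<^esub> ?w \<otimes>\<^bsub>G\<^esub> (g \<otimes>\<^bsub>G\<^esub> t)"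
      using gt g t u(1) w(1) by (simp add: m_assoc)
    then show "ind_assoc G K L X (act (ind G L X) g c) = act (ind G K (ind GK L X)) g (ind_assoc G K L X c)"
      using actK[OF k u(2) x] g t x
      by (simp add: c ind_trivial(2)[OF G(1) X] formula ind_def[of G K] gu Let_def)
  qed
  show "bij_betw (ind_assoc G K L X) (pts (ind G L X)) (pts (ind G K (ind GK L X)))"
  proof (rule bij_betwI')
    fix c d assume "c \<in> pts (ind G L X)" "d \<in> pts (ind G L X)"
    then obtain t x t' x' where c: "c = prod_encode (t, x)" "t \<in> carrier G" "x \<in> pts X"
      and d: "d = prod_encode (t', x')" "t' \<in> carrier G" "x' \<in> pts X"
      unfolding ptsL by auto
    show "(ind_assoc G K L X c = ind_assoc G K L X d) = (c = d)"
      using c d rep(1)[OF c(2)] by (auto simp: formula)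
  next
    fix c assume "c \<in> pts (ind G L X)"
    then show "ind_assoc G K L X c \<in> pts (ind G K (ind GK L X))"
      unfolding ptsL ptsGK using formula rep(2) by fastforce
  next
    fix d assume "d \<in> pts (ind G K (ind GK L X))"
    then obtain t k x where d: "d = prod_encode (coset_rep G K t, prod_encode (k, x))"
      and t: "t \<in> carrier G" and k: "k \<in> K" and x: "x \<in> pts X"
      unfolding ptsGK by auto
    let ?u = "coset_rep G K t"
    have u: "?u \<in> carrier G" using rep(1)[OF t] .
    have "coset_rep G K (?u \<otimes>\<^bsub>G\<^esub> k) = ?u" using rep(3)[OF u k] coset_rep_idem[OF G(1) K t] by simp
    moreover have "inv\<^bsub>G\<^esub> ?u \<otimes>\<^bsub>G\<^esub> (?u \<otimes>\<^bsub>G\<^esub> k) = k" using u k by (simp add: m_assoc[symmetric])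
    ultimately have "ind_assoc G K L X (prod_encode (?u \<otimes>\<^bsub>G\<^esub> k, x)) = d"
      using u k x by (simp add: formula d)
    then show "\<exists>c\<in>pts (ind G L X). d = ind_assoc G K L X c"
      unfolding ptsL using u k x by (intro bexI[of _ "prod_encode (?u \<otimes>\<^bsub>G\<^esub> k, x)"]) auto
  qed
qed

lemma reorder_hom:
  assumes B: "closed_data GK L B"
  shows "tambara_hom G (norm G L B) (norm G K (norm GK L B)) (reorder G K L B)"
proof -
  let ?M = "norm GK L B" and ?N = "norm G K (norm GK L B)"
  have M: "tambara GK ?M" "tambara_hom (subgrp G L) B (restr GK L ?M) (norm_unit GK L B)"
    using norm_unit_hom[OF GK L(2) B] by simp_all
  note Nt = norm_tests_empty[OF G K M(1)]
  have N: "tambara G ?N" "tambara_hom GK ?M (restr G K ?N) (norm_unit G K ?M)"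
    using norm_unit_hom[OF G K Nt] .
  let ?f = "\<lambda>X x. norm_unit G K ?M (ind GK L X) (norm_unit GK L B X x)"
  \<comment> \<open>The composite of the two units lands in the iterated restriction;
    \<open>2\<close> carries it to the direct one along \<open>ind_assoc\<close>, which gives the
    map whose adjoint is \<open>reorder\<close>.\<close>
  have 1: "tambara_hom (subgrp G L) B (restr GK L (restr G K ?N)) ?f"
    using tambara_hom_comp[OF M(2)] tambara_hom_restr[OF GK L(2) N(2)] by simp
  have 2: "tambara_hom (subgrp G L)
      (reindex ?N (\<lambda>X. ind G K (ind GK L X)) (\<lambda>f. ind_map (ind_map f))) (reindex ?N (ind G L) ind_map)
      (\<lambda>X. tres ?N (ind G L X) (ind G K (ind GK L X)) (ind_assoc G K L X))"
  proof (rule reindex_hom[OF N(1)])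
    fix X Y f c assume f: "gmap (subgrp G L) X Y f" and "c \<in> pts (ind G L X)"
    then have X: "is_gset (subgrp G L) X" and Y: "is_gset (subgrp G L) Y" by (simp_all add: gmap_def)
    obtain t x where c: "c = prod_encode (t, x)" "t \<in> carrier G" "x \<in> pts X"
      using \<open>c \<in> _\<close> unfolding ind_trivial(1)[OF G(1) X] by auto
    have "f x \<in> pts Y" using f c by (auto simp: gmap_def)
    then show "ind_assoc G K L Y (ind_map f c) = ind_map (ind_map f) (ind_assoc G K L X c)"
      using c by (simp add: ind_assoc_trivial(1)[OF X] ind_assoc_trivial(1)[OF Y] ind_map_def)
  qed (use ind_assoc_trivial(2,3) gmap_ind[OF G L(1)] gmap_ind[OF G K gmap_ind[OF GK L(2)]] in auto)
  have "restr GK L (restr G K ?N) = reindex ?N (\<lambda>X. ind G K (ind GK L X)) (\<lambda>f. ind_map (ind_map f))"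
    "restr G L ?N = reindex ?N (ind G L) ind_map"
    by (simp_all add: restr_def reindex_def)
  then have 3: "tambara_hom (subgrp G L) B (restr G L ?N)
      (\<lambda>X x. tres ?N (ind G L X) (ind G K (ind GK L X)) (ind_assoc G K L X) (?f X x))"
    using tambara_hom_comp[OF 1] 2 by simp
  show ?thesis
    unfolding reorder_def Let_def
    by (rule adjoint_map_hom[OF G L(1) norm_tests_transfer[OF B G L(1)] N(1) 3]) simp
qed

end

section \<open>Transport along an isomorphism of groups\<close>

context
  fixes K K' :: "nat monoid" and \<phi> :: "nat \<Rightarrow> nat"
  assumes K: "group K" and K': "group K'" and \<phi>: "\<phi> \<in> iso K K'"
begin

private abbreviation (input) "push \<equiv> push_gset (carrier K) \<phi>"
private abbreviation (input) "\<psi> \<equiv> inv_into (carrier K) \<phi>"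

lemma push_gset_sel [simp]: "pts (push X) = pts X" "act (push X) k x = act X (\<psi> k) x"
  by (simp_all add: push_gset_def)

lemma inv_into_iso:
  shows "k \<in> carrier K' \<Longrightarrow> \<psi> k \<in> carrier K"
    and "\<lbrakk>k \<in> carrier K'; l \<in> carrier K'\<rbrakk> \<Longrightarrow> \<psi> (k \<otimes>\<^bsub>K'\<^esub> l) = \<psi> k \<otimes>\<^bsub>K\<^esub> \<psi> l"
    and "\<psi> \<one>\<^bsub>K'\<^esub> = \<one>\<^bsub>K\<^esub>"
proof -
  have "\<psi> \<in> iso K' K" by (rule group.iso_set_sym[OF K \<phi>])
  then have h: "\<psi> \<in> hom K' K" by (simp add: iso_def)
  then show "k \<in> carrier K' \<Longrightarrow> \<psi> k \<in> carrier K"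
    "\<lbrakk>k \<in> carrier K'; l \<in> carrier K'\<rbrakk> \<Longrightarrow> \<psi> (k \<otimes>\<^bsub>K'\<^esub> l) = \<psi> k \<otimes>\<^bsub>K\<^esub> \<psi> l"
    by (auto simp: hom_def)
  show "\<psi> \<one>\<^bsub>K'\<^esub> = \<one>\<^bsub>K\<^esub>" by (rule hom_one[OF h K' K])
qed

lemma is_gset_push: "is_gset K X \<Longrightarrow> is_gset K' (push X)"
  by (simp add: is_gset_def inv_into_iso)

lemma gmap_push: "gmap K X Y f \<Longrightarrow> gmap K' (push X) (push Y) f"
  using inv_into_iso(1) by (simp add: gmap_def is_gset_push)

text \<open>Pushing changes neither the points nor the underlying maps, and so preserves pullback,
  exponential and coproduct diagrams. Each axiom is then an instance of the same axiom for
  \<open>R\<close>.\<close>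

lemma tambara_pull:
  assumes "tambara K' R"
  shows "tambara K (pull (carrier K) \<phi> R)"
proof -
  interpret R: tambara K' R by fact
  have pb: "is_pullback K' (push W) (push X) (push Y) (push Z) p q f g" if "is_pullback K W X Y Z p q f g"
    for W X Y Z p q f g
    using that by (auto simp: is_pullback_def gmap_push)
  have ex: "is_exponential K' (push X) (push Y) (push Z) (push A) (push B) f g e p q w"
    if "is_exponential K X Y Z A B f g e p q w" for X Y Z A B f g e p q w
    using that unfolding is_exponential_def by (simp add: gmap_push pb)
  have cp: "is_coproduct K' (push X) (push Y) (push W) i j" if "is_coproduct K X Y W i j" for X Y W i j
    using that by (simp add: is_coproduct_def gmap_push)
  note simps = pull_def tambara_data.simps
  show ?thesis
    apply (rule tambara.intro; unfold simps)
                    apply (rule R.val_cring[OF is_gset_push], assumption)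
                   apply (rule R.res_hom[OF gmap_push], assumption)
                  apply (rule R.tr_hom[OF gmap_push], assumption)
                 apply (rule R.nm_hom[OF gmap_push], assumption)
                apply (rule R.nm_one[OF gmap_push], assumption)
               apply (rule R.map_cong[OF gmap_push], assumption, simp)
              apply (rule R.map_id[OF is_gset_push], assumption, assumption)
             apply (rule R.res_comp[OF gmap_push gmap_push], assumption, assumption, assumption)
            apply (rule R.tr_comp[OF gmap_push gmap_push], assumption, assumption, assumption)
           apply (rule R.nm_comp[OF gmap_push gmap_push], assumption, assumption, assumption)
          apply (rule R.tr_base_change[OF pb], assumption, assumption)
         apply (rule R.nm_base_change[OF pb], assumption, assumption)
        apply (rule R.distributive[OF ex], assumption, assumption)
       apply (rule R.val_coproduct[OF cp], assumption)
      apply (rule R.val_empty[OF is_gset_push], assumption, simp)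
     done
qed

text \<open>An element \<open>k\<close> acts on the pushed set through its preimage under
  \<open>\<phi>\<close>, and \<open>\<phi>\<close> takes the product of this preimage with
  \<open>t\<close> to the product of \<open>k\<close> with \<open>\<phi> t\<close>. The hypothesis
  on trivial subgroups lets the same \<open>X\<close> be induced to both groups.\<close>

lemma transport_induced:
  assumes fin: "finite (carrier K)" "finite (carrier K')"
    and L: "subgrp K {\<one>\<^bsub>K\<^esub>} = subgrp K' {\<one>\<^bsub>K'\<^esub>}" and X: "is_gset (subgrp K {\<one>\<^bsub>K\<^esub>}) X"
  defines "\<theta> \<equiv> \<lambda>c. case prod_decode c of (t, x) \<Rightarrow> prod_encode (\<phi> t, x)"
  shows "gmap K' (push (ind K {\<one>\<^bsub>K\<^esub>} X)) (ind K' {\<one>\<^bsub>K'\<^esub>} X) \<theta>"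
    and "bij_betw \<theta> (pts (push (ind K {\<one>\<^bsub>K\<^esub>} X))) (pts (ind K' {\<one>\<^bsub>K'\<^esub>} X))"
proof -
  have X': "is_gset (subgrp K' {\<one>\<^bsub>K'\<^esub>}) X" using X L by simp
  note pK = ind_trivial(1)[OF K X] and pK' = ind_trivial(1)[OF K' X']
  have bij: "bij_betw \<phi> (carrier K) (carrier K')" and hom: "\<phi> \<in> hom K K'" using \<phi> by (auto simp: iso_def)
  have \<theta>: "\<theta> (prod_encode (t, x)) = prod_encode (\<phi> t, x)" for t x by (simp add: \<theta>_def)
  have c: "\<phi> t \<in> carrier K'" if "t \<in> carrier K" for t using bij that by (rule bij_betw_apply)
  show "bij_betw \<theta> (pts (push (ind K {\<one>\<^bsub>K\<^esub>} X))) (pts (ind K' {\<one>\<^bsub>K'\<^esub>} X))"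
    unfolding push_gset_sel
  proof (rule bij_betwI')
    fix a b assume "a \<in> pts (ind K {\<one>\<^bsub>K\<^esub>} X)" "b \<in> pts (ind K {\<one>\<^bsub>K\<^esub>} X)"
    then show "(\<theta> a = \<theta> b) = (a = b)"
      using inj_onD[OF bij_betw_imp_inj_on[OF bij]] unfolding pK by (auto simp: \<theta>)
  next
    fix a assume "a \<in> pts (ind K {\<one>\<^bsub>K\<^esub>} X)"
    then show "\<theta> a \<in> pts (ind K' {\<one>\<^bsub>K'\<^esub>} X)" unfolding pK pK' using c by (auto simp: \<theta>)
  next
    fix b assume "b \<in> pts (ind K' {\<one>\<^bsub>K'\<^esub>} X)"
    then obtain t x where b: "b = prod_encode (\<phi> t, x)" and t: "t \<in> carrier K" "x \<in> pts X"
      unfolding pK' bij_betw_imp_surj_on[OF bij, symmetric] by blast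
    then show "\<exists>a\<in>pts (ind K {\<one>\<^bsub>K\<^esub>} X). b = \<theta> a"
      unfolding pK by (intro bexI[of _ "prod_encode (t, x)"]) (auto simp: \<theta>)
  qed
  then have "\<theta> \<in> pts (push (ind K {\<one>\<^bsub>K\<^esub>} X)) \<rightarrow> pts (ind K' {\<one>\<^bsub>K'\<^esub>} X)"
    by (auto dest: bij_betw_apply)
  moreover have "\<theta> (act (push (ind K {\<one>\<^bsub>K\<^esub>} X)) k a) = act (ind K' {\<one>\<^bsub>K'\<^esub>} X) k (\<theta> a)"
    if k: "k \<in> carrier K'" and "a \<in> pts (ind K {\<one>\<^bsub>K\<^esub>} X)" for k a
  proof -
    obtain t x where a: "a = prod_encode (t, x)" and t: "t \<in> carrier K" and x: "x \<in> pts X"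
      using \<open>a \<in> _\<close> unfolding pK by auto
    have "\<phi> (\<psi> k \<otimes>\<^bsub>K\<^esub> t) = k \<otimes>\<^bsub>K'\<^esub> \<phi> t"
      using hom_mult[OF hom inv_into_iso(1)[OF k] t] bij_betw_inv_into_right[OF bij k] by simp
    then show ?thesis
      unfolding a push_gset_sel ind_trivial(2)[OF K X inv_into_iso(1)[OF k] t x] \<theta>
        ind_trivial(2)[OF K' X' k c[OF t] x] by simp
  qed
  ultimately show "gmap K' (push (ind K {\<one>\<^bsub>K\<^esub>} X)) (ind K' {\<one>\<^bsub>K'\<^esub>} X) \<theta>"
    using is_gset_push[OF is_gset_ind[OF K fin(1) group.triv_subgroup[OF K] X]]
      is_gset_ind[OF K' fin(2) group.triv_subgroup[OF K'] X'] by (auto simp: gmap_def)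
qed

lemma transport_induced_hom:
  assumes fin: "finite (carrier K)" "finite (carrier K')"
    and L: "subgrp K {\<one>\<^bsub>K\<^esub>} = subgrp K' {\<one>\<^bsub>K'\<^esub>}" and R: "tambara K' R"
  shows "tambara_hom (subgrp K {\<one>\<^bsub>K\<^esub>}) (restr K' {\<one>\<^bsub>K'\<^esub>} R) (restr K {\<one>\<^bsub>K\<^esub>} (pull (carrier K) \<phi> R))
    (\<lambda>X. tres R (push (ind K {\<one>\<^bsub>K\<^esub>} X)) (ind K' {\<one>\<^bsub>K'\<^esub>} X)
       (\<lambda>c. case prod_decode c of (t, x) \<Rightarrow> prod_encode (\<phi> t, x)))"
proof -
  have "tambara_hom (subgrp K {\<one>\<^bsub>K\<^esub>}) (reindex R (ind K' {\<one>\<^bsub>K'\<^esub>}) ind_map)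
    (reindex R (\<lambda>X. push (ind K {\<one>\<^bsub>K\<^esub>} X)) ind_map)
    (\<lambda>X. tres R (push (ind K {\<one>\<^bsub>K\<^esub>} X)) (ind K' {\<one>\<^bsub>K'\<^esub>} X)
       (\<lambda>c. case prod_decode c of (t, x) \<Rightarrow> prod_encode (\<phi> t, x)))"
  proof (rule reindex_hom[OF R])
    show "gmap K' (ind K' {\<one>\<^bsub>K'\<^esub>} X) (ind K' {\<one>\<^bsub>K'\<^esub>} Y) (ind_map f)"
      if "gmap (subgrp K {\<one>\<^bsub>K\<^esub>}) X Y f" for X Y f
      using gmap_ind[OF K' fin(2) group.triv_subgroup[OF K']] that L by simp
    show "gmap K' (push (ind K {\<one>\<^bsub>K\<^esub>} X)) (push (ind K {\<one>\<^bsub>K\<^esub>} Y)) (ind_map f)"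
      if "gmap (subgrp K {\<one>\<^bsub>K\<^esub>}) X Y f" for X Y f
      using gmap_push[OF gmap_ind[OF K fin(1) group.triv_subgroup[OF K] that]] .
  qed (use transport_induced[OF fin L] in \<open>auto simp: ind_map_def split: prod.splits\<close>)
  then show ?thesis by (simp add: reindex_def restr_def pull_def)
qed

end

text \<open>Both choices are governed by the same predicate, since it sees \<open>f\<close> only on
  carriers; so \<open>SOME\<close> returns the same map.\<close>

lemma adjoint_map_cong:
  assumes "\<And>X x. \<lbrakk>is_gset (subgrp G H) X; x \<in> carrier (tval R X)\<rbrakk> \<Longrightarrow> f X x = f' X x"
  shows "adjoint_map G H R T f = adjoint_map G H R T f'"
  unfolding adjoint_map_def using assms by (intro arg_cong[where f = Eps] ext) auto

lemma push_gset_cong: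
  assumes "\<And>k. k \<in> K \<Longrightarrow> \<phi> k = \<phi>' k"
  shows "push_gset K \<phi> = push_gset K \<phi>'"
proof -
  have "inv_into K \<phi> = inv_into K \<phi>'"
    using assms by (auto simp: inv_into_def fun_eq_iff intro!: arg_cong[where f = Eps])
  then show ?thesis by (simp add: push_gset_def fun_eq_iff)
qed

section \<open>The dihedral group\<close>

context
  fixes m :: nat and R :: "'a tambara_data" and \<phi> :: "nat \<Rightarrow> nat"
  assumes m: "m \<ge> 1"
    and R: "tambara (subgrp (dihedral m) (D2 m)) R"
    and \<phi>: "\<phi> \<in> iso (dihedral m) (dihedral m)"
    and \<phi>_rs: "\<phi> (rot m \<otimes>\<^bsub>dihedral m\<^esub> flip m) = flip m"
begin

private abbreviation (input) "D \<equiv> dihedral m"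
private abbreviation (input) "H \<equiv> subgrp D (D2 m)"
private abbreviation (input) "H' \<equiv> subgrp D (D2' m)"

interpretation D: group D by (rule group_dihedral[OF m])

lemma dihedral_facts: "group D" "finite (carrier D)" "subgroup (D2 m) D" "subgroup (D2' m) D"
proof -
  show "subgroup (D2 m) D"
    unfolding D2_def using m by (intro D.generate_is_subgroup) (auto simp: flip_def)
  have "m + rot m < 2 * m" using m by (simp add: rot_def)
  then show "subgroup (D2' m) D"
    unfolding D2'_def D2_eq(3)[OF m] by (intro D.generate_is_subgroup) auto
qed (simp_all add: D.group_axioms)

lemmas H_facts = subgroup_facts[OF dihedral_facts(1-3)] and H'_facts = subgroup_facts[OF dihedral_facts(1,2,4)]

lemma iso_D2'_D2: "\<phi> \<in> iso H' H" and c_zeta_eq: "k \<in> D2' m \<Longrightarrow> \<phi> k = c_zeta m k"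
proof -
  have hom: "\<phi> \<in> hom D D" and inj: "inj_on \<phi> (carrier D)" using \<phi> by (auto simp: iso_def bij_betw_def)
  have one: "\<phi> 0 = 0" using hom_one[OF hom dihedral_facts(1) dihedral_facts(1)] by simp
  have rs: "\<phi> (m + rot m) = m" using \<phi>_rs unfolding D2_eq(3)[OF m] unfolding flip_def .
  have D2': "D2' m = {0, m + rot m}" and D2: "D2 m = {0, m}" using D2_eq[OF m] by auto
  have "\<phi> ` D2' m = D2 m" unfolding D2 D2' using one rs by simp
  moreover have "\<phi> \<in> hom H' H"
  proof (rule homI)
    show "\<phi> x \<in> carrier H" if "x \<in> carrier H'" for x using that \<open>\<phi> ` D2' m = D2 m\<close> by auto
    show "\<phi> (x \<otimes>\<^bsub>H'\<^esub> y) = \<phi> x \<otimes>\<^bsub>H\<^esub> \<phi> y" if "x \<in> carrier H'" "y \<in> carrier H'" for x y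
      using hom_mult[OF hom] that subsetD[OF subgroup.subset[OF dihedral_facts(4)]] by simp
  qed
  ultimately show "\<phi> \<in> iso H' H"
    using inj_on_subset[OF inj subgroup.subset[OF dihedral_facts(4)]] by (simp add: iso_def bij_betw_def)
  show "\<phi> k = c_zeta m k" if "k \<in> D2' m"
  proof -
    \<comment> \<open>Separates the neutral element from \<open>rs\<close> in the case distinction
      of \<open>c_zeta\<close>, including \<open>m = 1\<close>, where \<open>r\<close> is itself
      neutral.\<close>
    have "m + rot m \<noteq> 0" using m by simp
    then show ?thesis using that one rs unfolding D2' c_zeta_def D2_eq(3)[OF m] unfolding flip_def by auto
  qed
qed

lemma tambara_pull_R: "tambara H' (pull (D2' m) \<phi> R)"
  using tambara_pull[OF H'_facts(1) H_facts(1) iso_D2'_D2 R] by simp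

text \<open>The ring is restricted from \<open>D2 m\<close> but normed up to \<open>D2' m\<close>
  and to the whole group as well; the three groups have the same trivial subgroup as a record, so
  closure transfers.\<close>

lemma closed_ring_e: "closed_data H (D1 m) (ring_e m R)" "closed_data H' (D1 m) (ring_e m R)"
  "closed_data D (D1 m) (ring_e m R)"
proof -
  show 1: "closed_data H (D1 m) (ring_e m R)"
    unfolding ring_e_def using norm_tests_restr[OF H_facts(1,2,4) R] .
  show "closed_data H' (D1 m) (ring_e m R)"
    by (rule norm_tests_transfer[OF 1 H'_facts(1,2,4)]) simp
  show "closed_data D (D1 m) (ring_e m R)"
    by (rule norm_tests_transfer[OF 1 dihedral_facts(1,2) H_facts(3)]) simp
qed

lemma tambara_loday_coeff: "tambara D (loday_coeff m \<phi> R t)"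
proof (cases t)
  case OD2
  then show ?thesis
    using norm_unit_hom(1)[OF dihedral_facts(1-3) norm_tests_empty[OF dihedral_facts(1-3) R]] by simp
next
  case Oe
  then show ?thesis
    using norm_unit_hom(1)[OF dihedral_facts(1,2) H_facts(3) closed_ring_e(3)] by simp
next
  case OD2'
  then show ?thesis
    using norm_unit_hom(1)[OF dihedral_facts(1,2,4) norm_tests_empty[OF dihedral_facts(1,2,4) tambara_pull_R]] by simp
qed

lemma act_M_hom: "tambara_hom D (loday_coeff m \<phi> R Oe) (loday_coeff m \<phi> R OD2) (act_M m R)"
proof -
  have "tambara_hom H (norm H (D1 m) (ring_e m R)) R (counit H (D1 m) R)"
    using counit_hom[OF H_facts(1,2,4) R] by (simp only: ring_e_def)
  moreover have "tambara H (norm H (D1 m) (ring_e m R))"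
    by (rule norm_unit_hom(1)[OF H_facts(1,2,4) closed_ring_e(1)])
  ultimately have "tambara_hom D (norm D (D2 m) (norm H (D1 m) (ring_e m R))) (norm D (D2 m) R)
      (norm_map D (D2 m) (norm H (D1 m) (ring_e m R)) R (counit H (D1 m) R))"
    by (intro norm_map_hom norm_tests_empty dihedral_facts R)
  from tambara_hom_comp[OF reorder_hom[OF dihedral_facts(1-3) closed_ring_e(1)] this]
  show ?thesis unfolding loday_coeff.simps act_M_def[abs_def] .
qed

lemma twisted_counit_hom:
  "tambara_hom H' (norm H' (D1 m) (ring_e m R)) (pull (D2' m) \<phi> R) (twisted_counit m \<phi> R)"
proof -
  have e: "subgrp H' {\<one>\<^bsub>H'\<^esub>} = subgrp H {\<one>\<^bsub>H\<^esub>}" by simp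
  show ?thesis
    unfolding twisted_counit_def
    by (rule adjoint_map_hom[OF H'_facts(1,2,4) closed_ring_e(2) tambara_pull_R])
      (use transport_induced_hom[OF H'_facts(1) H_facts(1) iso_D2'_D2 H'_facts(2) H_facts(2) e R]
       in \<open>simp add: ring_e_def\<close>)
qed

lemma act_N_hom: "tambara_hom D (loday_coeff m \<phi> R Oe) (loday_coeff m \<phi> R OD2') (act_N m \<phi> R)"
proof -
  have "tambara H' (norm H' (D1 m) (ring_e m R))"
    by (rule norm_unit_hom(1)[OF H'_facts(1,2,4) closed_ring_e(2)])
  then have "tambara_hom D (norm D (D2' m) (norm H' (D1 m) (ring_e m R))) (norm D (D2' m) (pull (D2' m) \<phi> R))
      (norm_map D (D2' m) (norm H' (D1 m) (ring_e m R)) (pull (D2' m) \<phi> R) (twisted_counit m \<phi> R))"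
    by (intro norm_map_hom norm_tests_empty dihedral_facts tambara_pull_R twisted_counit_hom)
  from tambara_hom_comp[OF reorder_hom[OF dihedral_facts(1,2,4) closed_ring_e(2)] this]
  show ?thesis unfolding loday_coeff.simps act_N_def[abs_def] .
qed

text \<open>An equality and not just an isomorphism: \<open>pull\<close> sees \<open>\<phi>\<close>
  through its inverse on \<open>D2' m\<close>, and \<open>twisted_counit\<close> also through the
  transport map, whose first coordinates lie in \<open>D2' m\<close>. Equal arguments give equal
  chosen norms and adjoints.\<close>

lemma real_bar_c_zeta: "real_bar m \<phi> R = real_bar m (c_zeta m) R"
proof -
  have push: "push_gset (D2' m) \<phi> = push_gset (D2' m) (c_zeta m)"
    by (rule push_gset_cong[OF c_zeta_eq])
  then have pull: "pull (D2' m) \<phi> = pull (D2' m) (c_zeta m)" by (simp add: pull_def fun_eq_iff)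
  have e: "subgrp H' {\<one>\<^bsub>H'\<^esub>} = subgrp H {\<one>\<^bsub>H\<^esub>}" by simp
  have "twisted_counit m \<phi> R = twisted_counit m (c_zeta m) R"
    unfolding twisted_counit_def pull push
  proof (rule adjoint_map_cong)
    fix X x assume X: "is_gset (subgrp H' (D1 m)) X" and x: "x \<in> carrier (tval (ring_e m R) X)"
    \<comment> \<open>As functions on all numbers the two transport maps may differ; they agree on
      the points, and \<open>map_cong\<close> makes their restrictions equal.\<close>
    have "gmap H (push_gset (D2' m) \<phi> (ind H' (D1 m) X)) (ind H (D1 m) X)
        (\<lambda>c. case prod_decode c of (t, x) \<Rightarrow> prod_encode (\<phi> t, x))"
      using transport_induced(1)[OF H'_facts(1) H_facts(1) iso_D2'_D2 H'_facts(2) H_facts(2) e] X by simp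
    moreover have "(case prod_decode c of (t, x) \<Rightarrow> prod_encode (\<phi> t, x))
        = (case prod_decode c of (t, x) \<Rightarrow> prod_encode (c_zeta m t, x))"
      if "c \<in> pts (push_gset (D2' m) \<phi> (ind H' (D1 m) X))" for c
      using that c_zeta_eq ind_trivial(1)[OF H'_facts(1)] X by (auto simp: push_gset_def)
    ultimately show "tres R (push_gset (D2' m) (c_zeta m) (ind H' (D1 m) X)) (ind H (D1 m) X)
        (\<lambda>c. case prod_decode c of (t, x) \<Rightarrow> prod_encode (\<phi> t, x)) x
      = tres R (push_gset (D2' m) (c_zeta m) (ind H' (D1 m) X)) (ind H (D1 m) X)
        (\<lambda>c. case prod_decode c of (t, x) \<Rightarrow> prod_encode (c_zeta m t, x)) x"
      using tambara.map_cong[OF R, of _ _ "\<lambda>c. case prod_decode c of (t, x) \<Rightarrow> prod_encode (\<phi> t, x)"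
          "\<lambda>c. case prod_decode c of (t, x) \<Rightarrow> prod_encode (c_zeta m t, x)"] x
      unfolding push[symmetric] ring_e_def restr_def by simp
  qed
  then have "act_N m \<phi> R = act_N m (c_zeta m) R"
    unfolding act_N_def pull by (simp only:)
  then show ?thesis by (simp add: real_bar_def pull)
qed

lemma coeff_closed:
  assumes "is_gset D X" "c \<in> carrier (tval (loday_coeff m \<phi> R Oe) X)"
  shows "act_M m R X c \<in> carrier (tval (loday_coeff m \<phi> R OD2) X)"
    and "act_N m \<phi> R X c \<in> carrier (tval (loday_coeff m \<phi> R OD2') X)"
  using act_M_hom act_N_hom assms unfolding tambara_hom_def by (blast intro: ring_hom_closed)+

section \<open>The simplicial isomorphism and its effect on homotopy groups\<close>

private abbreviation (input) "coeff \<equiv> \<lambda>Q. loday_coeff m \<phi> R (orbit_kind Q)"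
private abbreviation (input) "bar_coeff \<equiv>
  bar_family (loday_coeff m \<phi> R OD2) (loday_coeff m \<phi> R Oe) (loday_coeff m \<phi> R OD2')"
private abbreviation (input) "position n \<equiv> inv_into {0..n + 1} (orbit_at m n)"

lemma relabelling_orbits:
  "relabelling D (P_orbits m n) {0..n + 1} coeff (bar_coeff n) (orbit_at m n) (position n)"
  unfolding P_orbits_eq[OF m]
proof (rule relabelling.intro)
  show "position n (orbit_at m n j) = j" if "j \<in> {0..n + 1}" for j
    by (rule inv_into_f_f[OF orbit_at_inj[OF m] that])
  show "bar_coeff n j = coeff (orbit_at m n j)" if "j \<in> {0..n + 1}" for j
    by (simp only: bar_family_eq orbit_kind_orbit_at[OF m])
  show "position n Q \<in> {0..n + 1}" "orbit_at m n (position n Q) = Q"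
    if "Q \<in> orbit_at m n ` {0..n + 1}" for Q
    using inv_into_into[OF that] f_inv_into_f[OF that] by this+
qed (use tambara_loday_coeff in auto)

private abbreviation (input) "relabel_at n \<equiv> relabelling.relabel D {0..n + 1} (bar_coeff n) (position n)"
private abbreviation (input) "saturated_at n \<equiv> relabelling.saturated D (P_orbits m n) coeff"

lemma real_bar_eq: "real_bar m \<phi> R = bar D (loday_coeff m \<phi> R OD2) (loday_coeff m \<phi> R Oe)
    (loday_coeff m \<phi> R OD2') (act_M m R) (act_N m \<phi> R)"
  by (simp only: real_bar_def loday_coeff.simps)

lemma relabel_face:
  assumes c: "c \<in> saturated_at n X" and n: "n \<ge> 1" and i: "i \<le> n"
  shows "relabel_at (n - 1) X (face (loday m \<phi> R) n i X c) = face (real_bar m \<phi> R) n i X (relabel_at n X c)"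
proof -
  \<comment> \<open>\<open>bar\<close> indexes the target of a face by \<open>{0..n}\<close>, the
    relabelling in degree \<open>n - 1\<close> by \<open>{0..n - 1 + 1}\<close>.\<close>
  have n1: "n - 1 + 1 = n" using n by simp
  have a: "m' (orbit_at m n l) \<in> carrier (tval (loday_coeff m \<phi> R (kind_at n l)) Y)"
    if "\<And>Q. Q \<in> P_orbits m n \<Longrightarrow> m' Q \<in> carrier (tval (coeff Q) Y)" "l \<le> n + 1" for m' Y l
    using that(1)[of "orbit_at m n l"] that(2) unfolding P_orbits_eq[OF m] orbit_kind_orbit_at[OF m] by auto
  have "relabel_at (n - 1) X (box_map D (P_orbits m (n - 1)) coeff (loday_map m \<phi> R (P_orbits m n) (P_face m n i)) X c)
    = box_map D {0..n - 1 + 1} (bar_coeff (n - 1))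
        (bar_face (loday_coeff m \<phi> R OD2) (loday_coeff m \<phi> R Oe) (loday_coeff m \<phi> R OD2')
          (act_M m R) (act_N m \<phi> R) n i) X (relabel_at n X c)"
    by (rule relabelling.relabel_box_map[OF relabelling_orbits relabelling_orbits c], rule sym,
        rule loday_map_face[OF m tambara_loday_coeff coeff_closed n i])
      (use n in \<open>auto intro: a simp del: loday_coeff.simps\<close>)
  then show ?thesis by (simp only: loday_def real_bar_eq bar_def simplicial_data.simps n1)
qed

lemma relabel_degen:
  assumes c: "c \<in> saturated_at n X" and i: "i \<le> n"
  shows "relabel_at (n + 1) X (degen (loday m \<phi> R) n i X c) = degen (real_bar m \<phi> R) n i X (relabel_at n X c)"
proof -
  have a: "m' (orbit_at m n l) \<in> carrier (tval (loday_coeff m \<phi> R (kind_at n l)) Y)"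
    if "\<And>Q. Q \<in> P_orbits m n \<Longrightarrow> m' Q \<in> carrier (tval (coeff Q) Y)" "l \<le> n + 1" for m' Y l
    using that(1)[of "orbit_at m n l"] that(2) unfolding P_orbits_eq[OF m] orbit_kind_orbit_at[OF m] by auto
  have "relabel_at (n + 1) X (box_map D (P_orbits m (n + 1)) coeff (loday_map m \<phi> R (P_orbits m n) (P_degen i)) X c)
    = box_map D {0..n + 1 + 1} (bar_coeff (n + 1)) (bar_degen (loday_coeff m \<phi> R Oe) n i) X (relabel_at n X c)"
    by (rule relabelling.relabel_box_map[OF relabelling_orbits relabelling_orbits c], rule sym,
        rule loday_map_degen[OF m tambara_loday_coeff coeff_closed i])
      (auto intro: a simp del: loday_coeff.simps)
  then show ?thesis by (simp add: loday_def real_bar_eq bar_def del: loday_coeff.simps)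
qed

lemma level_loday: "level (loday m \<phi> R) n = box D (P_orbits m n) coeff"
  and level_real_bar: "level (real_bar m \<phi> R) n = box D {0..n + 1} (bar_coeff n)"
  by (simp_all only: loday_def real_bar_eq bar_def simplicial_data.simps)

lemma loday_iso_real_bar: "simplicial_tambara_iso D (loday m \<phi> R) (real_bar m \<phi> R) relabel_at"
  unfolding simplicial_tambara_iso_def level_loday level_real_bar
proof (intro conjI allI ballI impI)
  fix n show "tambara_iso D (box D (P_orbits m n) coeff) (box D {0..n + 1} (bar_coeff n)) (relabel_at n)"
    by (rule relabelling.relabel_tambara_iso[OF relabelling_orbits])
next
  fix n i X c assume "c \<in> carrier (tval (box D (P_orbits m n) coeff) X)" and i: "is_gset D X \<and> i \<le> n"
  then have c: "c \<in> saturated_at n X" by (intro relabelling.carrier_saturated[OF relabelling_orbits])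
  show "relabel_at (n - 1) X (face (loday m \<phi> R) n i X c) = face (real_bar m \<phi> R) n i X (relabel_at n X c)"
    if "1 \<le> n" using relabel_face[OF c that] i by simp
  show "relabel_at (n + 1) X (degen (loday m \<phi> R) n i X c) = degen (real_bar m \<phi> R) n i X (relabel_at n X c)"
    using relabel_degen[OF c] i by simp
qed

text \<open>The saturated sets serve as \<open>U\<close>: every operation lands in them by
  construction, and \<open>relabel\<close> is injective on them and respects the operations
  there.\<close>

lemma homotopy_loday_iso:
  "mackey_iso D (homotopy (loday m \<phi> R) n) (homotopy (real_bar m \<phi> R) n) (\<lambda>X C. relabel_at n X ` C)"
proof (rule mackey_iso_homotopy[OF loday_iso_real_bar, where U = saturated_at], unfold level_loday level_real_bar)
  fix n
  interpret relabelling D "P_orbits m n" "{0..n + 1}" coeff "bar_coeff n" "orbit_at m n" "position n"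
    by (rule relabelling_orbits)
  have v: "tval (box D (P_orbits m n) coeff) X = box_ring D (P_orbits m n) coeff X"
    "tval (box D {0..n + 1} (bar_coeff n)) X = box_ring D {0..n + 1} (bar_coeff n) X" for X
    by (simp_all only: box_def tambara_data.simps)
  show "carrier (tval (box D (P_orbits m n) coeff) X) \<subseteq> saturated X" for X
    using carrier_saturated by (rule subsetI)
  show "inj_on (relabel X) (saturated X)" for X
    using relabel_inverse by (rule inj_on_inverseI)
  show "face (loday m \<phi> R) (Suc n) i X c \<in> saturated X" for i X c
    by (simp only: loday_def simplicial_data.simps diff_Suc_1 saturated_ops)
  show "\<zero>\<^bsub>tval (box D (P_orbits m n) coeff) X\<^esub> \<in> saturated X
      \<and> relabel X \<zero>\<^bsub>tval (box D (P_orbits m n) coeff) X\<^esub> = \<zero>\<^bsub>tval (box D {0..n + 1} (bar_coeff n)) X\<^esub>" for X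
    unfolding v using saturated_ops(3) relabel_zero by blast
  show "c \<oplus>\<^bsub>tval (box D (P_orbits m n) coeff) X\<^esub> d \<in> saturated X
      \<and> relabel X (c \<oplus>\<^bsub>tval (box D (P_orbits m n) coeff) X\<^esub> d)
        = relabel X c \<oplus>\<^bsub>tval (box D {0..n + 1} (bar_coeff n)) X\<^esub> relabel X d"
    if "c \<in> saturated X" "d \<in> saturated X" for X c d
    unfolding v using saturated_ops(2) relabel_ops(2)[OF that] by blast
  show "tres (box D (P_orbits m n) coeff) X Y f c \<in> saturated X
      \<and> relabel X (tres (box D (P_orbits m n) coeff) X Y f c) = tres (box D {0..n + 1} (bar_coeff n)) X Y f (relabel Y c)"
    if "c \<in> saturated Y" for X Y f c
    using saturated_ops(4) relabel_maps(1)[OF that] by blast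
  show "ttr (box D (P_orbits m n) coeff) X Y f c \<in> saturated Y
      \<and> relabel Y (ttr (box D (P_orbits m n) coeff) X Y f c) = ttr (box D {0..n + 1} (bar_coeff n)) X Y f (relabel X c)"
    if "c \<in> saturated X" for X Y f c
    using saturated_ops(5) relabel_maps(2)[OF that] by blast
qed

end

theorem theorem5p4:
  fixes m :: nat and R :: "'a tambara_data" and \<phi> :: "nat \<Rightarrow> nat"
  assumes "m \<ge> 1"
    and "tambara (subgrp (dihedral m) (D2 m)) R"
    and "\<phi> \<in> iso (dihedral m) (dihedral m)"
    and "\<phi> (rot m \<otimes>\<^bsub>dihedral m\<^esub> flip m) = flip m"
    and "\<phi> (rot m) = rot m"
  shows "(\<exists>h. simplicial_tambara_iso (dihedral m) (loday m \<phi> R)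
             (bar (dihedral m)
                (norm (dihedral m) (D2 m) R)
                (norm (dihedral m) (D1 m) (ring_e m R))
                (norm (dihedral m) (D2' m) (pull (D2' m) \<phi> R))
                (act_M m R) (act_N m \<phi> R)) h)
       \<and> (\<forall>n. \<exists>h. mackey_iso (dihedral m) (homotopy (loday m \<phi> R) n) (HR m R n) h)"
  \<comment> \<open>\<open>HR\<close> is formed with \<open>c_zeta\<close>; rewriting it back to
    \<open>\<phi>\<close> makes the second claim literally the isomorphism of homotopy
    groups.\<close>
  using loday_iso_real_bar[OF assms(1-4)] homotopy_loday_iso[OF assms(1-4)]
  unfolding HR_def real_bar_c_zeta[OF assms(1-4), symmetric] by (auto simp only: real_bar_def)

end
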